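(* Let $n \geq 2$. For all finitely presentable $n$-parameter persistence modules $M,N : \mathbf{R}^n \to \mathbf{vec}$, we have $$\widehat{d_B}\big(\beta\mathcal{B}(M),\, \beta\mathcal{B}(N)\big) \leq (n^2 - 1)\cdot d_I(M,N).$$ In other words, $$d_B\big(\beta_{2\mathbb{N}}(M) \cup \beta_{2\mathbb{N}+1}(N),\ \beta_{2\mathbb{N}}(N) \cup \beta_{2\mathbb{N}+1}(M)\big) \leq (n^2 - 1)\cdot d_I(M,N).$$
   Context: Fix a field $\mathbb{k}$. $\mathbf{vec}$ is the category of finite-dimensional $\mathbb{k}$-vector spaces. $\mathbf{R}^n$ is the set $\mathbb{R}^n$ with the product order, viewed as a category. An $n$-parameter persistence module is a functor $\mathbf{R}^n \to \mathbf{vec}$; morphisms are natural transformations. Interleavings: for real $\epsilon \geq 0$, the $\epsilon$-shift of $M$ is $M[\epsilon](r) = M(r+(\epsilon,\dots,\epsilon))$ with the evident structure maps (functorial in $M$), and $\iota^M_\epsilon : M \to M[\epsilon]$ is the natural transformation given by the structure maps of $M$. $M$ and $N$ are $\epsilon$-interleaved if there are natural transformations $f : M \to N[\epsilon]$ and $g : N \to M[\epsilon]$ with $g[\epsilon]\circ f = \iota^M_{2\epsilon}$ and $f[\epsilon]\circ g = \iota^N_{2\epsilon}$. $d_I(M,N) \in [0,\infty]$ is the infimum of the $\epsilon \geq 0$ such that $M$ and $N$ are $\epsilon$-interleaved. Free modules: for $i \in \mathbb{R}^n$, $F_i$ is the persistence module that is $\mathbb{k}$ on $\{j : j \geq i\}$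 and $0$ elsewhere, with identity structure maps inside the support. A module is free if it is isomorphic to a direct sum of modules $F_i$; the barcode $\mathcal{B}(P)$ of a free module $P$ is the unique multiset of elements of $\mathbb{R}^n$ with $P \cong \bigoplus_{i \in \mathcal{B}(P)} F_i$; its rank is the cardinality of $\mathcal{B}(P)$. A module is finitely presentable if it is the cokernel of a morphism between free modules of finite rank; finitely presentable modules are projective if and only if they are free. Betti numbers: every finitely presentable $M$ has a minimal projective resolution $P_\bullet \to M$ (each $P_k$ has minimal rank among all possible $k$-th terms of projective resolutions of $M$), unique up to isomorphism, and of finite length. The multigraded Betti numbers are $\beta_k(M) = \mathcal{B}(P_k)$. Put $\beta_{2\mathbb{N}}(M) = \bigcup_{k \text{ even}} \beta_k(M)$ and $\beta_{2\mathbb{N}+1}(M) = \bigcup_{k \text{ odd}} \beta_k(M)$, where $\cup$ always denotes the disjoint union of multisets (multiplicities add). The Betti signed barcode is the pair $\beta\mathcal{B}(M) = (\beta_{2\mathbb{N}}(M), \beta_{2\mathbb{N}+1}(M))$. Bottleneck: for finite multisets $\mathcal{B}, \mathcal{C}$ of elements of $\mathbb{R}^n$, an $\epsilon$-bijection is a bijection of multisets $h : \mathcal{B} \to \mathcal{C}$ with $\|i - h(i)\|_\infty \leq \epsilon$ for all $i \in \mathcal{B}$ (no unmatched elements allowed), and $d_B(\mathcal{B},\mathcal{C}) \in [0,\infty]$ is the infimum of the $\epsilon \geq 0$ for which an $\epsilon$-bijection exists. For pairs of finite multisets (finite signed barcodes), $\widehat{d_B}\big((\mathcal{B}_+,\mathcal{B}_-),(\mathcal{C}_+,\mathcal{C}_-)\big)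 = d_B(\mathcal{B}_+ \cup \mathcal{C}_-,\ \mathcal{C}_+ \cup \mathcal{B}_-)$. *)

theory Defs
  imports
    "HOL-Analysis.Analysis"
    "HOL-Library.Multiset"
    "HOL-Library.Function_Algebras"
begin

section \<open>Persistence modules\<close>

text \<open>
  The index category is \<^typ>\<open>real ^ 'n\<close> with its componentwise order, so
  \<open>n = CARD('n)\<close>.  The field is the type \<open>'k::field\<close>.  The vector spaces
  \<open>obj M r\<close> are subspaces of one ambient vector space, the type \<open>'v\<close> with
  scalar multiplication \<open>scl M\<close>.  This is no restriction: given any family of
  vector spaces, each embeds in their direct sum, and neither \<open>'v\<close> nor \<open>scl M\<close>
  is fixed.  The maps \<open>arr M r s\<close> matter only for \<open>r \<le> s\<close>, and only on \<open>obj M r\<close>.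
\<close>

record ('k, 'n, 'v) pmodule =
  scl :: "'k \<Rightarrow> 'v \<Rightarrow> 'v"
  obj :: "real ^ 'n \<Rightarrow> 'v set"
  arr :: "real ^ 'n \<Rightarrow> real ^ 'n \<Rightarrow> 'v \<Rightarrow> 'v"

definition linear_between ::
  "('k \<Rightarrow> 'v::ab_group_add \<Rightarrow> 'v) \<Rightarrow> 'v set \<Rightarrow> ('k \<Rightarrow> 'w::ab_group_add \<Rightarrow> 'w) \<Rightarrow> 'w set \<Rightarrow> ('v \<Rightarrow> 'w) \<Rightarrow> bool"
  where
  "linear_between s V t W f \<longleftrightarrow>
     f \<in> V \<rightarrow> W \<and>
     (\<forall>x\<in>V. \<forall>y\<in>V. f (x + y) = f x + f y) \<and>
     (\<forall>c. \<forall>x\<in>V. f (s c x) = t c (f x))"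

locale persistence_module =
  fixes M :: "('k::field, 'n::finite, 'v::ab_group_add) pmodule"
  assumes vector_space: "vector_space (scl M)"
    and subspace: "module.subspace (scl M) (obj M r)"
    and finite_dimensional: "\<exists>S. finite S \<and> module.span (scl M) S = obj M r"
    and linear: "r \<le> s \<Longrightarrow> linear_between (scl M) (obj M r) (scl M) (obj M s) (arr M r s)"
    and arr_id: "x \<in> obj M r \<Longrightarrow> arr M r r x = x"
    and arr_comp: "\<lbrakk>r \<le> s; s \<le> t; x \<in> obj M r\<rbrakk> \<Longrightarrow> arr M s t (arr M r s x) = arr M r t x"

definition morphism ::
  "('k, 'n::finite, 'v::ab_group_add) pmodule \<Rightarrow> ('k, 'n, 'w::ab_group_add) pmodule \<Rightarrow>
   (real ^ 'n \<Rightarrow> 'v \<Rightarrow> 'w) \<Rightarrow> bool"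
  where
  "morphism M N f \<longleftrightarrow>
     (\<forall>r. linear_between (scl M) (obj M r) (scl N) (obj N r) (f r)) \<and>
     (\<forall>r s. r \<le> s \<longrightarrow> (\<forall>x\<in>obj M r. f s (arr M r s x) = arr N r s (f r x)))"

definition isomorphic ::
  "('k, 'n::finite, 'v::ab_group_add) pmodule \<Rightarrow> ('k, 'n, 'w::ab_group_add) pmodule \<Rightarrow> bool"
  where
  "isomorphic M N \<longleftrightarrow>
     (\<exists>f g. morphism M N f \<and> morphism N M g \<and>
        (\<forall>r. \<forall>x\<in>obj M r. g r (f r x) = x) \<and> (\<forall>r. \<forall>y\<in>obj N r. f r (g r y) = y))"

definition surjective ::
  "('k, 'n::finite, 'v) pmodule \<Rightarrow> ('k, 'n, 'w) pmodule \<Rightarrow> (real ^ 'n \<Rightarrow> 'v \<Rightarrow> 'w) \<Rightarrow> bool"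
  where
  "surjective M N f \<longleftrightarrow> (\<forall>r. f r ` obj M r = obj N r)"

definition exact_at ::
  "('k, 'n::finite, 'u) pmodule \<Rightarrow> (real ^ 'n \<Rightarrow> 'u \<Rightarrow> 'v) \<Rightarrow> ('k, 'n, 'v) pmodule \<Rightarrow>
   (real ^ 'n \<Rightarrow> 'v \<Rightarrow> 'w::zero) \<Rightarrow> bool"
  where
  "exact_at L f M g \<longleftrightarrow> (\<forall>r. f r ` obj L r = {x \<in> obj M r. g r x = 0})"


section \<open>Interleavings\<close>

definition shift :: "('k, 'n::finite, 'v) pmodule \<Rightarrow> real \<Rightarrow> ('k, 'n, 'v) pmodule" where
  "shift M \<epsilon> =
     \<lparr>scl = scl M,
      obj = (\<lambda>r. obj M (r + (\<chi> i. \<epsilon>))),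
      arr = (\<lambda>r s. arr M (r + (\<chi> i. \<epsilon>)) (s + (\<chi> i. \<epsilon>)))\<rparr>"

definition shift_hom ::
  "(real ^ 'n::finite \<Rightarrow> 'v \<Rightarrow> 'w) \<Rightarrow> real \<Rightarrow> (real ^ 'n \<Rightarrow> 'v \<Rightarrow> 'w)" where
  "shift_hom f \<epsilon> r = f (r + (\<chi> i. \<epsilon>))"

definition shift_unit ::
  "('k, 'n::finite, 'v) pmodule \<Rightarrow> real \<Rightarrow> (real ^ 'n \<Rightarrow> 'v \<Rightarrow> 'v)" where
  "shift_unit M \<epsilon> r = arr M r (r + (\<chi> i. \<epsilon>))"

definition interleaved ::
  "real \<Rightarrow> ('k, 'n::finite, 'v::ab_group_add) pmodule \<Rightarrow> ('k, 'n, 'w::ab_group_add) pmodule \<Rightarrow> bool"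
  where
  "interleaved \<epsilon> M N \<longleftrightarrow>
     (\<exists>f g. morphism M (shift N \<epsilon>) f \<and> morphism N (shift M \<epsilon>) g \<and>
        (\<forall>r. \<forall>x\<in>obj M r. shift_hom g \<epsilon> r (f r x) = shift_unit M (2 * \<epsilon>) r x) \<and>
        (\<forall>r. \<forall>y\<in>obj N r. shift_hom f \<epsilon> r (g r y) = shift_unit N (2 * \<epsilon>) r y))"

definition interleaving_distance ::
  "('k, 'n::finite, 'v::ab_group_add) pmodule \<Rightarrow> ('k, 'n, 'w::ab_group_add) pmodule \<Rightarrow> ennreal"
  where
  "interleaving_distance M N = (INF \<epsilon>\<in>{\<epsilon>. 0 \<le> \<epsilon> \<and> interleaved \<epsilon> M N}. ennreal \<epsilon>)"


section \<open>Free modules, barcodes and finite presentations\<close>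

definition free_at :: "real ^ 'n::finite \<Rightarrow> ('k::field, 'n, 'k) pmodule" where
  "free_at i =
     \<lparr>scl = (*), obj = (\<lambda>j. if i \<le> j then UNIV else {0}), arr = (\<lambda>_ _ x. x)\<rparr>"

definition direct_sum ::
  "'j set \<Rightarrow> ('j \<Rightarrow> ('k, 'n::finite, 'v::zero) pmodule) \<Rightarrow> ('k, 'n, 'j \<Rightarrow> 'v) pmodule" where
  "direct_sum J N =
     \<lparr>scl = (\<lambda>c x j. scl (N j) c (x j)),
      obj = (\<lambda>r. {x. finite {j. x j \<noteq> 0} \<and> (\<forall>j\<in>J. x j \<in> obj (N j) r) \<and> (\<forall>j. j \<notin> J \<longrightarrow> x j = 0)}),
      arr = (\<lambda>r s x j. if j \<in> J then arr (N j) r s (x j) else 0)\<rparr>"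

text \<open>The underlying set of a multiset: an element of multiplicity \<open>m\<close> has the copies \<open>0, \<dots>, m - 1\<close>.\<close>

definition copies :: "'a multiset \<Rightarrow> ('a \<times> nat) set" where
  "copies B = {(i, k). k < count B i}"

definition free_module ::
  "(real ^ 'n::finite) multiset \<Rightarrow> ('k::field, 'n, (real ^ 'n) \<times> nat \<Rightarrow> 'k) pmodule" where
  "free_module B = direct_sum (copies B) (\<lambda>(i, _). free_at i)"

definition barcode ::
  "('k::field, 'n::finite, 'v::ab_group_add) pmodule \<Rightarrow> (real ^ 'n) multiset" where
  "barcode P = (THE B. isomorphic P (free_module B))"

definition free_rank :: "('k::field, 'n::finite, 'v::ab_group_add) pmodule \<Rightarrow> nat" where
  "free_rank P = size (barcode P)"

text \<open>\<open>p\<close> exhibits \<open>M\<close> as the cokernel of \<open>f\<close>, that is, \<open>free_module B \<rightarrow> free_module C \<rightarrow> M \<rightarrow> 0\<close> is exact.\<close>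

definition finitely_presentable ::
  "('k::field, 'n::finite, 'v::ab_group_add) pmodule \<Rightarrow> bool" where
  "finitely_presentable M \<longleftrightarrow>
     persistence_module M \<and>
     (\<exists>B C f p. morphism (free_module B) (free_module C) f \<and>
        morphism (free_module C) M p \<and>
        exact_at (free_module B) f (free_module C) p \<and>
        surjective (free_module C) M p)"


section \<open>Minimal projective resolutions and Betti numbers\<close>

text \<open>
  A definition cannot quantify over all types of vectors.  The test modules \<open>A\<close>, \<open>B\<close>
  below and the terms of a resolution therefore live in the infinite-dimensional type
  of vectors used for \<^const>\<open>free_module\<close>.  Every persistence module is
  isomorphic to one of this type, because every \<open>obj M r\<close> is finite-dimensional.
\<close>

type_synonym ('k, 'n) concrete_pmodule = "('k, 'n, (real ^ 'n) \<times> nat \<Rightarrow> 'k) pmodule"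

definition projective :: "('k::field, 'n::finite, 'v::ab_group_add) pmodule \<Rightarrow> bool" where
  "projective P \<longleftrightarrow>
     persistence_module P \<and>
     (\<forall>(A :: ('k, 'n) concrete_pmodule) (B :: ('k, 'n) concrete_pmodule) g h.
        persistence_module A \<and> persistence_module B \<and>
        morphism A B g \<and> surjective A B g \<and> morphism P B h \<longrightarrow>
        (\<exists>l. morphism P A l \<and> (\<forall>r. \<forall>x\<in>obj P r. g r (l r x) = h r x)))"

definition projective_resolution ::
  "('k::field, 'n::finite, 'v::ab_group_add) pmodule \<Rightarrow> (nat \<Rightarrow> ('k, 'n) concrete_pmodule) \<Rightarrow>
   (nat \<Rightarrow> real ^ 'n \<Rightarrow> ((real ^ 'n) \<times> nat \<Rightarrow> 'k) \<Rightarrow> ((real ^ 'n) \<times> nat \<Rightarrow> 'k)) \<Rightarrow>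
   (real ^ 'n \<Rightarrow> ((real ^ 'n) \<times> nat \<Rightarrow> 'k) \<Rightarrow> 'v) \<Rightarrow> bool"
  where
  "projective_resolution M P d e \<longleftrightarrow>
     (\<forall>k. finitely_presentable (P k) \<and> projective (P k)) \<and>
     (\<forall>k. morphism (P (Suc k)) (P k) (d k)) \<and>
     morphism (P 0) M e \<and>
     surjective (P 0) M e \<and>
     exact_at (P 1) (d 0) (P 0) e \<and>
     (\<forall>k. exact_at (P (Suc (Suc k))) (d (Suc k)) (P (Suc k)) (d k))"

definition minimal_projective_resolution ::
  "('k::field, 'n::finite, 'v::ab_group_add) pmodule \<Rightarrow> (nat \<Rightarrow> ('k, 'n) concrete_pmodule) \<Rightarrow>
   (nat \<Rightarrow> real ^ 'n \<Rightarrow> ((real ^ 'n) \<times> nat \<Rightarrow> 'k) \<Rightarrow> ((real ^ 'n) \<times> nat \<Rightarrow> 'k)) \<Rightarrow>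
   (real ^ 'n \<Rightarrow> ((real ^ 'n) \<times> nat \<Rightarrow> 'k) \<Rightarrow> 'v) \<Rightarrow> bool"
  where
  "minimal_projective_resolution M P d e \<longleftrightarrow>
     projective_resolution M P d e \<and>
     (\<forall>P' d' e'. projective_resolution M P' d' e' \<longrightarrow> (\<forall>k. free_rank (P k) \<le> free_rank (P' k)))"

definition betti ::
  "('k::field, 'n::finite, 'v::ab_group_add) pmodule \<Rightarrow> nat \<Rightarrow> (real ^ 'n) multiset" where
  "betti M k = (THE B. \<exists>P d e. minimal_projective_resolution M P d e \<and> B = barcode (P k))"

text \<open>
  Minimal resolutions have finite length, so only finitely many \<open>betti M k\<close> are
  nonempty.  The sums are restricted to these because a sum over an infinite index
  set is \<open>{#}\<close> by convention.
\<close>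

definition betti_even ::
  "('k::field, 'n::finite, 'v::ab_group_add) pmodule \<Rightarrow> (real ^ 'n) multiset" where
  "betti_even M = (\<Sum>k\<in>{k. even k \<and> betti M k \<noteq> {#}}. betti M k)"

definition betti_odd ::
  "('k::field, 'n::finite, 'v::ab_group_add) pmodule \<Rightarrow> (real ^ 'n) multiset" where
  "betti_odd M = (\<Sum>k\<in>{k. odd k \<and> betti M k \<noteq> {#}}. betti M k)"

definition betti_signed_barcode ::
  "('k::field, 'n::finite, 'v::ab_group_add) pmodule \<Rightarrow> (real ^ 'n) multiset \<times> (real ^ 'n) multiset" where
  "betti_signed_barcode M = (betti_even M, betti_odd M)"


section \<open>Bottleneck dissimilarity\<close>

definition eps_bijection ::
  "real \<Rightarrow> (real ^ 'n::finite) multiset \<Rightarrow> (real ^ 'n) multiset \<Rightarrow>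
   ((real ^ 'n) \<times> nat \<Rightarrow> (real ^ 'n) \<times> nat) \<Rightarrow> bool" where
  "eps_bijection \<epsilon> B C h \<longleftrightarrow>
     bij_betw h (copies B) (copies C) \<and> (\<forall>x\<in>copies B. infnorm (fst x - fst (h x)) \<le> \<epsilon>)"

definition bottleneck_distance ::
  "(real ^ 'n::finite) multiset \<Rightarrow> (real ^ 'n) multiset \<Rightarrow> ennreal" where
  "bottleneck_distance B C = (INF \<epsilon>\<in>{\<epsilon>. 0 \<le> \<epsilon> \<and> (\<exists>h. eps_bijection \<epsilon> B C h)}. ennreal \<epsilon>)"

fun signed_bottleneck ::
  "(real ^ 'n::finite) multiset \<times> (real ^ 'n) multiset \<Rightarrow>
   (real ^ 'n) multiset \<times> (real ^ 'n) multiset \<Rightarrow> ennreal" where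
  "signed_bottleneck (B_pos, B_neg) (C_pos, C_neg) =
     bottleneck_distance (B_pos + C_neg) (C_pos + B_neg)"

end

theory Submission
  imports Defs
begin

text \<open>
  A free module of finite rank is a coordinate space filtered by subspaces: its value at
  a grade is spanned by the generators born up to that grade, and its structure maps are
  inclusions.  A morphism of free modules is therefore one linear map that respects the
  filtrations.  The whole argument takes place among such filtered spaces, with a module
  presented as a quotient \<open>A / Z\<close> of a free module \<open>A\<close> by a family of subspaces.

  The first idea is a persistent form of Schanuel's lemma (\<open>schanuel_step\<close>).  Let \<open>A / Z\<close>
  and \<open>B / W\<close> be \<open>\<epsilon>\<close>-interleaved, with \<open>A\<close> and \<open>B\<close> free, and let \<open>P' \<rightarrow> Z\<close> and \<open>Q' \<rightarrow> W\<close> be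
  free covers.  Then \<open>A \<oplus> W[\<epsilon>]\<close> and \<open>B \<oplus> Z[\<epsilon>]\<close> are again \<open>\<epsilon>\<close>-interleaved, and
  \<open>A \<oplus> Q'[\<epsilon>]\<close> and \<open>B \<oplus> P'[\<epsilon>]\<close> cover them.  Iterating along resolutions \<open>P\<close> of \<open>M\<close> and \<open>Q\<close> of \<open>N\<close> of
  length at most \<open>n\<close> shows that the free modules
  \<open>P\<^sub>0 \<oplus> Q\<^sub>1[\<epsilon>] \<oplus> P\<^sub>2[2\<epsilon>] \<oplus> \<dots>\<close> and \<open>Q\<^sub>0 \<oplus> P\<^sub>1[\<epsilon>] \<oplus> Q\<^sub>2[2\<epsilon>] \<oplus> \<dots>\<close> are \<open>\<epsilon>\<close>-interleaved, because all
  syzygies have become zero (\<open>alternating_interleaving\<close>, \<open>resolutions_interleaving\<close>).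

  The second idea is a matching of the generators of \<open>\<epsilon>\<close>-interleaved free modules that
  moves each grade by at most \<open>(n - 1) \<epsilon>\<close> (\<open>free_interleaving_bijection\<close>).  By Hall's
  theorem it is enough that no set of generators has too few neighbours.  If it had, some
  combination of its generators would be sent to generators far from all of them.  But a
  generator through which the interleaving runs from a source to a target with at least the
  same sum of coordinates is close to the source or to the target.

  Undoing the shifts by \<open>k \<epsilon>\<close> with \<open>k \<le> n\<close> costs at most \<open>n \<epsilon>\<close> more, and
  \<open>(n - 1) + n \<le> n\<^sup>2 - 1\<close> for \<open>n \<ge> 2\<close>.

  It remains to see that Betti numbers come from resolutions of length at most \<open>n\<close>.  Covers
  by a smallest generating family yield a free resolution whose syzygies lie in the radical.
  The case \<open>\<epsilon> = 0\<close> of the first idea compares it with any other resolution of the same module and shows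
  that it has the fewest generators in every degree and at every grade
  (\<open>minimal_resolution_count_le\<close>).  Finitely presentable projective modules are free
  (\<open>projective_isomorphic_free\<close>), so this covers all projective resolutions and identifies
  \<open>betti\<close> (\<open>betti_eq\<close>).  Finally, Schreyer's construction, with
  leading terms in place of a monomial order, gives some free resolution of length at most \<open>n\<close>
  (\<open>schreyer_step\<close>, \<open>short_free_resolution\<close>).
\<close>

section \<open>Finite combinatorics and elementary linear algebra\<close>

text \<open>
  The induction of Halmos and Vaughan: if some proper nonempty subset has exactly as many
  neighbours as elements, it is matched on its own and the rest is matched outside its
  neighbours; otherwise one edge can be fixed without spoiling the condition.
\<close>

lemma hall_marriage:
  fixes N :: "'a \<Rightarrow> 'b set"
  assumes "finite I" and "\<And>i. i \<in> I \<Longrightarrow> finite (N i)"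
    and "\<And>S. S \<subseteq> I \<Longrightarrow> card S \<le> card (\<Union>(N ` S))"
  shows "\<exists>h. inj_on h I \<and> (\<forall>i\<in>I. h i \<in> N i)"
  using assms
proof (induction "card I" arbitrary: I N rule: less_induct)
  case less
  note fin = less.prems(1) and finN = less.prems(2) and hall = less.prems(3)
  consider "I = {}"
    | S where "S \<subseteq> I" "S \<noteq> {}" "S \<noteq> I" "card (\<Union>(N ` S)) \<le> card S"
    | "I \<noteq> {}" "\<And>S. S \<subseteq> I \<Longrightarrow> S \<noteq> {} \<Longrightarrow> S \<noteq> I \<Longrightarrow> card S < card (\<Union>(N ` S))"
    by (meson not_le)
  then show ?case
  proof cases
    case 1
    then show ?thesis by simp
  next
    case 2
    have finS: "finite S" using 2 fin finite_subset by blast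
    have "card S < card I" using 2 fin by (simp add: psubset_card_mono psubset_eq)
    then obtain h1 where h1: "inj_on h1 S" "\<forall>i\<in>S. h1 i \<in> N i"
      using less.hyps[of S N] finS finN hall 2 by (meson subset_trans subsetD)
    define N' where "N' = (\<lambda>i. N i - \<Union>(N ` S))"
    have "card (I - S) < card I"
      using 2 fin by (intro psubset_card_mono) auto
    moreover have "card T \<le> card (\<Union>(N' ` T))" if T: "T \<subseteq> I - S" for T
    proof -
      have "finite T" using T fin finite_subset by blast
      have "card T + card S = card (T \<union> S)"
        using T finS \<open>finite T\<close> by (subst card_Un_disjoint) auto
      also have "\<dots> \<le> card (\<Union>(N ` (T \<union> S)))" using T 2 by (intro hall) auto
      also have "\<Union>(N ` (T \<union> S)) = \<Union>(N' ` T) \<union> \<Union>(N ` S)" unfolding N'_def by auto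
      also have "card \<dots> \<le> card (\<Union>(N' ` T)) + card (\<Union>(N ` S))" by (rule card_Un_le)
      finally show ?thesis using 2 by linarith
    qed
    moreover have "finite (N' i)" if "i \<in> I - S" for i using that finN unfolding N'_def by auto
    ultimately obtain h2 where h2: "inj_on h2 (I - S)" "\<forall>i\<in>I - S. h2 i \<in> N' i"
      using less.hyps[of "I - S" N'] fin by blast
    define h where "h = (\<lambda>i. if i \<in> S then h1 i else h2 i)"
    have "inj_on h I"
    proof -
      have "h1 ` S \<inter> h2 ` (I - S) = {}"
      proof -
        have "h1 ` S \<subseteq> \<Union>(N ` S)" using h1(2) by auto
        moreover have "h2 ` (I - S) \<inter> \<Union>(N ` S) = {}" using h2(2) unfolding N'_def by auto
        ultimately show ?thesis by blast
      qed
      then have "inj_on h (S \<union> (I - S))"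
        unfolding h_def using inj_on_disjoint_Un[OF h1(1) h2(1)] by simp
      moreover have "S \<union> (I - S) = I" using 2 by blast
      ultimately show ?thesis by simp
    qed
    moreover have "\<forall>i\<in>I. h i \<in> N i" using h1 h2 unfolding h_def N'_def by auto
    ultimately show ?thesis by blast
  next
    case 3
    then obtain i where i: "i \<in> I" by blast
    have "card {i} \<le> card (\<Union>(N ` {i}))" using i by (intro hall) auto
    then have "N i \<noteq> {}" by auto
    then obtain j where j: "j \<in> N i" by blast
    define N' where "N' = (\<lambda>k. N k - {j})"
    have "card (I - {i}) < card I" using card_Diff1_less[OF fin i] .
    moreover have "card T \<le> card (\<Union>(N' ` T))" if T: "T \<subseteq> I - {i}" for T
    proof (cases "T = {}")
      case False
      have "card T < card (\<Union>(N ` T))" using 3(2)[of T] T i False by blast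
      moreover have "card (\<Union>(N' ` T)) = card (\<Union>(N ` T) - {j})"
        unfolding N'_def by (rule arg_cong[of _ _ card]) auto
      moreover have "card (\<Union>(N ` T)) - 1 \<le> card (\<Union>(N ` T) - {j})"
        by (metis card_Diff_singleton_if diff_le_self order_refl)
      ultimately show ?thesis by linarith
    qed simp
    moreover have "finite (N' k)" if "k \<in> I - {i}" for k using that finN unfolding N'_def by auto
    ultimately obtain h where h: "inj_on h (I - {i})" "\<forall>k\<in>I - {i}. h k \<in> N' k"
      using less.hyps[of "I - {i}" N'] fin by blast
    have "inj_on (h(i := j)) I"
      using h inj_on_fun_updI[of h "I - {i}" j i] i unfolding N'_def
      by (auto simp: insert_absorb inj_on_def)
    moreover have "\<forall>k\<in>I. (h(i := j)) k \<in> N k" using h j unfolding N'_def by auto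
    ultimately show ?thesis by blast
  qed
qed

text \<open>
  A maximal element gets the last position.  This is how the generators of a syzygy module
  are ordered below, where the order only has to refine a strict partial order.
\<close>

lemma linear_extension:
  assumes "finite A" and "\<And>x. \<not> R x x" and "\<And>x y z. R x y \<Longrightarrow> R y z \<Longrightarrow> R x z"
  shows "\<exists>pos :: 'a \<Rightarrow> nat. inj_on pos A \<and> (\<forall>x\<in>A. \<forall>y\<in>A. R x y \<longrightarrow> pos x < pos y)"
  using assms(1)
proof (induction "card A" arbitrary: A)
  case 0
  then show ?case by simp
next
  case (Suc m)
  have "\<exists>a\<in>A. \<forall>b\<in>A. \<not> R a b"
  proof -
    have "A \<noteq> {}" using Suc.hyps(2) by auto
    moreover have "asymp_on A R" using assms(2,3) by (auto intro!: asymp_onI)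
    moreover have "transp_on A R" using assms(3) by (auto intro!: transp_onI)
    ultimately show ?thesis using Finite_Set.bex_max_element[of A R] Suc.prems assms(2) by metis
  qed
  then obtain a where a: "a \<in> A" "\<forall>b\<in>A. \<not> R a b" by blast
  have "finite (A - {a})" "m = card (A - {a})" using Suc a by auto
  then obtain p :: "'a \<Rightarrow> nat" where p: "inj_on p (A - {a})" "\<forall>x\<in>A - {a}. \<forall>y\<in>A - {a}. R x y \<longrightarrow> p x < p y"
    using Suc.hyps(1) by blast
  define q where "q = p(a := Suc (Max (insert 0 (p ` (A - {a})))))"
  have lt: "p x < Suc (Max (insert 0 (p ` (A - {a}))))" if "x \<in> A - {a}" for x
    using that Suc.prems by (simp add: less_Suc_eq_le)
  have "inj_on q A"
  proof (rule inj_onI)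
    fix x y assume xy: "x \<in> A" "y \<in> A" "q x = q y"
    show "x = y"
    proof (cases "x = a \<or> y = a")
      case True
      then show ?thesis using xy lt[of x] lt[of y] unfolding q_def by (auto split: if_splits)
    next
      case False
      then show ?thesis using xy p(1) unfolding q_def by (auto dest: inj_onD)
    qed
  qed
  moreover have "\<forall>x\<in>A. \<forall>y\<in>A. R x y \<longrightarrow> q x < q y"
    using p(2) lt a(2) assms(2) unfolding q_def by auto
  ultimately show ?case by blast
qed

text \<open>
  Gaussian elimination: a homogeneous system with more unknowns than equations has a
  nontrivial solution.  All dimension arguments below rest on this.
\<close>

lemma linear_dependence:
  fixes A :: "'a \<Rightarrow> 'b \<Rightarrow> 'k::field"
  assumes "finite T" and "finite S" and "card T < card S"
  shows "\<exists>c. (\<exists>i\<in>S. c i \<noteq> 0) \<and> (\<forall>j\<in>T. (\<Sum>i\<in>S. c i * A i j) = 0)"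
  using assms
proof (induction T arbitrary: S A rule: finite_induct)
  case empty
  then obtain i where "i \<in> S" by fastforce
  then show ?case by (intro exI[of _ "\<lambda>_. 1"]) auto
next
  case (insert j T)
  show ?case
  proof (cases "\<forall>i\<in>S. A i j = 0")
    case True
    have "card T < card S" using insert by simp
    then obtain c where "\<exists>i\<in>S. c i \<noteq> 0" "\<forall>j\<in>T. (\<Sum>i\<in>S. c i * A i j) = 0"
      using insert.IH[of S A] insert.prems by blast
    then show ?thesis using True by (intro exI[of _ c]) auto
  next
    case False
    then obtain p where p: "p \<in> S" "A p j \<noteq> 0" by blast
    \<comment> \<open>Eliminate the unknown \<open>p\<close> by means of the equation \<open>j\<close>.\<close>
    define A' where "A' = (\<lambda>i k. A i k - A i j / A p j * A p k)"
    have "card T < card (S - {p})" using insert p by simp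
    then obtain c where c: "\<exists>i\<in>S - {p}. c i \<noteq> 0" "\<forall>j\<in>T. (\<Sum>i\<in>S - {p}. c i * A' i j) = 0"
      using insert.IH[of "S - {p}" A'] insert.prems by blast
    define c' where "c' = c(p := - (\<Sum>i\<in>S - {p}. c i * (A i j / A p j)))"
    have split: "(\<Sum>i\<in>S. c' i * A i k) = (\<Sum>i\<in>S - {p}. c i * A' i k)" for k
    proof -
      have "(\<Sum>i\<in>S. c' i * A i k) = c' p * A p k + (\<Sum>i\<in>S - {p}. c i * A i k)"
        using p insert.prems by (subst sum.remove[of S p]) (auto simp: c'_def)
      also have "\<dots> = (\<Sum>i\<in>S - {p}. c i * A i k) - (\<Sum>i\<in>S - {p}. c i * (A i j / A p j) * A p k)"
        by (simp add: c'_def sum_distrib_right)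
      also have "\<dots> = (\<Sum>i\<in>S - {p}. c i * A' i k)"
        by (simp add: A'_def right_diff_distrib sum_subtractf mult.assoc)
      finally show ?thesis .
    qed
    have "(\<Sum>i\<in>S. c' i * A i j) = 0" unfolding split A'_def using p by simp
    moreover have "\<exists>i\<in>S. c' i \<noteq> 0" using c(1) by (auto simp: c'_def)
    ultimately show ?thesis using c(2) split by (intro exI[of _ c']) auto
  qed
qed

section \<open>Filtered coordinate spaces\<close>

definition smul :: "'k::field \<Rightarrow> ('i \<Rightarrow> 'k) \<Rightarrow> 'i \<Rightarrow> 'k" where
  "smul c x = (\<lambda>i. c * x i)"

definition unit_vec :: "'i \<Rightarrow> 'i \<Rightarrow> 'k::field" where
  "unit_vec i = (\<lambda>j. if j = i then 1 else 0)"

definition lin :: "(('i \<Rightarrow> 'k::field) \<Rightarrow> ('j \<Rightarrow> 'k)) \<Rightarrow> bool" where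
  "lin f \<longleftrightarrow> (\<forall>x y. f (x + y) = f x + f y) \<and> (\<forall>c x. f (smul c x) = smul c (f x))"

definition lincomb :: "'i set \<Rightarrow> ('i \<Rightarrow> 'j \<Rightarrow> 'k::field) \<Rightarrow> ('i \<Rightarrow> 'k) \<Rightarrow> 'j \<Rightarrow> 'k" where
  "lincomb I g x = (\<Sum>i\<in>I. smul (x i) (g i))"

text \<open>
  The free module with generators \<open>I\<close> of grades \<open>b\<close>: its value at \<open>r\<close> is spanned by the
  generators of grade at most \<open>r\<close>, and its structure maps are inclusions.
\<close>

definition fil :: "'i set \<Rightarrow> ('i \<Rightarrow> real ^ 'n) \<Rightarrow> real ^ 'n \<Rightarrow> ('i \<Rightarrow> 'k::field) set" where
  "fil I b r = {x. \<forall>i. x i \<noteq> 0 \<longrightarrow> i \<in> I \<and> b i \<le> r}"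

definition restr :: "'i set \<Rightarrow> ('i \<Rightarrow> 'k::field) \<Rightarrow> 'i \<Rightarrow> 'k" where
  "restr I x = (\<lambda>i. if i \<in> I then x i else 0)"

interpretation fv: vector_space "smul :: 'k::field \<Rightarrow> ('i \<Rightarrow> 'k) \<Rightarrow> 'i \<Rightarrow> 'k"
  by unfold_locales (auto simp: smul_def fun_eq_iff algebra_simps)

lemma smul_apply [simp]: "smul c x i = c * x i"
  by (simp add: smul_def)

lemma sum_fun_apply: "(\<Sum>a\<in>A. f a) i = (\<Sum>a\<in>A. f a i)"
  for f :: "'a \<Rightarrow> 'i \<Rightarrow> 'k::comm_monoid_add"
  by (induction A rule: infinite_finite_induct) auto

lemma unit_vec_apply: "unit_vec i j = (if j = i then 1 else 0)"
  by (simp add: unit_vec_def)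

lemma lincomb_apply: "lincomb I g x j = (\<Sum>i\<in>I. x i * g i j)"
  by (simp add: lincomb_def sum_fun_apply)

lemma linI:
  assumes "\<And>x y. f (x + y) = f x + f y" and "\<And>c x. f (smul c x) = smul c (f x)"
  shows "lin f"
  using assms by (simp add: lin_def)

lemma lin_add: "lin f \<Longrightarrow> f (x + y) = f x + f y"
  by (simp add: lin_def)

lemma lin_smul: "lin f \<Longrightarrow> f (smul c x) = smul c (f x)"
  by (simp add: lin_def)

lemma lin_0: "lin f \<Longrightarrow> f 0 = 0"
  using lin_smul[of f 0 0] by simp

lemma lin_diff: "lin f \<Longrightarrow> f (x - y) = f x - f y"
  using lin_add[of f "x - y" y] by (simp add: algebra_simps)

lemma lin_sum: "lin f \<Longrightarrow> f (\<Sum>a\<in>A. g a) = (\<Sum>a\<in>A. f (g a))"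
  by (induction A rule: infinite_finite_induct) (auto simp: lin_0 lin_add)

lemma lin_lincomb: "lin (lincomb I g)"
  by (rule linI) (auto simp: fun_eq_iff lincomb_apply algebra_simps sum.distrib sum_distrib_left)

lemma lin_restr: "lin (restr I)"
  by (rule linI) (auto simp: restr_def fun_eq_iff)

lemma lin_id: "lin (\<lambda>x. x)"
  by (rule linI) auto

lemma lin_comp: "lin f \<Longrightarrow> lin g \<Longrightarrow> lin (\<lambda>x. g (f x))"
  by (simp add: lin_def)

lemma lin_plus: "lin f \<Longrightarrow> lin g \<Longrightarrow> lin (\<lambda>x. f x + g x)"
  by (simp add: lin_def fv.scale_right_distrib algebra_simps)

lemma lin_minus: "lin f \<Longrightarrow> lin g \<Longrightarrow> lin (\<lambda>x. f x - g x)"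
  by (simp add: lin_def fv.scale_right_diff_distrib algebra_simps)

lemma lin_zero: "lin (\<lambda>_. 0)"
  by (rule linI) auto

lemma lincomb_unit: "finite I \<Longrightarrow> i \<in> I \<Longrightarrow> lincomb I g (unit_vec i) = g i"
  by (auto simp: fun_eq_iff lincomb_apply unit_vec_apply if_distrib[of "\<lambda>x. x * _"] cong: if_cong)

lemma fil_iff: "x \<in> fil I b r \<longleftrightarrow> (\<forall>i. x i \<noteq> 0 \<longrightarrow> i \<in> I \<and> b i \<le> r)"
  by (simp add: fil_def)

lemma filD: "x \<in> fil I b r \<Longrightarrow> x i \<noteq> 0 \<Longrightarrow> i \<in> I" "x \<in> fil I b r \<Longrightarrow> x i \<noteq> 0 \<Longrightarrow> b i \<le> r"
  by (auto simp: fil_def)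

lemma fil_mono: "r \<le> s \<Longrightarrow> fil I b r \<subseteq> fil I b s"
  by (force simp: fil_def)

lemma subspace_fil: "fv.subspace (fil I b r)"
  unfolding fv.subspace_def fil_def by auto (metis add.right_neutral)+

lemma unit_vec_fil: "i \<in> I \<Longrightarrow> b i \<le> r \<Longrightarrow> unit_vec i \<in> fil I b r"
  by (auto simp: fil_def unit_vec_apply)

lemma fil_eq_lincomb:
  assumes "finite I" "x \<in> fil I b r"
  shows "x = lincomb I unit_vec x"
proof
  fix j
  have "lincomb I unit_vec x j = (\<Sum>i\<in>I. if j = i then x i else 0)"
    by (auto simp: lincomb_apply unit_vec_apply intro!: sum.cong)
  also have "\<dots> = x j" using assms by (auto simp: fil_def)
  finally show "x j = lincomb I unit_vec x j" by simp
qed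

lemma lin_lincomb_eq: "lin f \<Longrightarrow> f (lincomb I g x) = lincomb I (\<lambda>i. f (g i)) x"
  unfolding lincomb_def by (subst lin_sum) (auto intro!: sum.cong dest: lin_smul[of f])

lemma lin_eq_lincomb:
  assumes "finite I" "x \<in> fil I b r" "lin f"
  shows "f x = lincomb I (\<lambda>i. f (unit_vec i)) x"
  using fil_eq_lincomb[OF assms(1,2)] lin_lincomb_eq[OF assms(3), of I unit_vec x] by simp

lemma lincomb_in_subspace:
  assumes "fv.subspace V" "\<And>i. i \<in> I \<Longrightarrow> x i \<noteq> 0 \<Longrightarrow> g i \<in> V"
  shows "lincomb I g x \<in> V"
  unfolding lincomb_def
proof (rule fv.subspace_sum[OF assms(1)])
  fix i assume "i \<in> I"
  then show "smul (x i) (g i) \<in> V"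
    using assms fv.subspace_scale[OF assms(1)] fv.subspace_0[OF assms(1)]
    by (cases "x i = 0") auto
qed

text \<open>
  A linear map out of a free module is fixed by its values on generators, so a lift through
  \<open>d\<close> is chosen generator by generator.  The shift \<open>v\<close> is that of an interleaving.
\<close>

lemma lift_lin:
  fixes d :: "('j \<Rightarrow> 'k::field) \<Rightarrow> ('l \<Rightarrow> 'k)" and u :: "('i \<Rightarrow> 'k) \<Rightarrow> ('l \<Rightarrow> 'k)"
  assumes "finite I" "lin d" "lin u"
    and "\<And>i. i \<in> I \<Longrightarrow> \<exists>y \<in> fil J c (b i + v). d y = u (unit_vec i)"
  shows "\<exists>f. lin f \<and> (\<forall>r. \<forall>x\<in>fil I b r. f x \<in> fil J c (r + v) \<and> d (f x) = u x)"
proof -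
  obtain g where g: "\<And>i. i \<in> I \<Longrightarrow> g i \<in> fil J c (b i + v)" "\<And>i. i \<in> I \<Longrightarrow> d (g i) = u (unit_vec i)"
    using assms(4) by metis
  let ?f = "lincomb I g"
  have "?f x \<in> fil J c (r + v)" "d (?f x) = u x" if x: "x \<in> fil I b r" for x r
  proof -
    show "?f x \<in> fil J c (r + v)"
    proof (rule lincomb_in_subspace[OF subspace_fil])
      fix i assume "i \<in> I" "x i \<noteq> 0"
      then show "g i \<in> fil J c (r + v)"
        using g(1)[of i] filD(2)[OF x] fil_mono[of "b i + v" "r + v" J c] by auto
    qed
    have "d (?f x) = lincomb I (\<lambda>i. d (g i)) x" by (rule lin_lincomb_eq[OF assms(2)])
    also have "\<dots> = lincomb I (\<lambda>i. u (unit_vec i)) x"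
      unfolding lincomb_def using g(2) by auto
    also have "\<dots> = u x" using lin_eq_lincomb[OF assms(1) x assms(3)] by simp
    finally show "d (?f x) = u x" .
  qed
  then show ?thesis using lin_lincomb by blast
qed

lemma restr_fil: "x \<in> fil (I \<union> J) b r \<Longrightarrow> restr I x \<in> fil I b r"
  by (auto simp: fil_def restr_def)

lemma restr_same: "x \<in> fil I b r \<Longrightarrow> restr I x = x"
  by (auto simp: fil_def restr_def fun_eq_iff)

lemma restr_disjoint: "x \<in> fil I b r \<Longrightarrow> I \<inter> J = {} \<Longrightarrow> restr J x = 0"
  by (auto simp: fil_def restr_def fun_eq_iff)

lemma restr_split: "x \<in> fil (I \<union> J) b r \<Longrightarrow> I \<inter> J = {} \<Longrightarrow> x = restr I x + restr J x"
  by (force simp: fil_def restr_def fun_eq_iff)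

lemma fil_Un: "fil I b r \<subseteq> fil (I \<union> J) b r" "fil J b r \<subseteq> fil (I \<union> J) b r"
  by (auto simp: fil_def)

section \<open>Interleavings of presented modules and the persistent Schanuel lemma\<close>

abbreviation diag :: "real \<Rightarrow> real ^ 'n::finite" where
  "diag \<epsilon> \<equiv> (\<chi> i. \<epsilon>)"

lemma add_diag_diag: "r + diag a + diag b = r + diag (a + b)"
  by (simp add: vec_eq_iff)

text \<open>
  The pair of \<open>fil I b\<close> and \<open>Z\<close> stands for the quotient module.  The conditions say that
  \<open>\<phi>\<close> and \<open>\<psi>\<close> induce an \<open>\<epsilon>\<close>-interleaving of the two quotients; as the structure maps of free modules
  are inclusions, the composites are compared with the identity.
\<close>

definition presented_interleaving ::
  "real \<Rightarrow> 'i set \<Rightarrow> ('i \<Rightarrow> real ^ 'n::finite) \<Rightarrow> (real ^ 'n \<Rightarrow> ('i \<Rightarrow> 'k::field) set) \<Rightarrow>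
   'j set \<Rightarrow> ('j \<Rightarrow> real ^ 'n) \<Rightarrow> (real ^ 'n \<Rightarrow> ('j \<Rightarrow> 'k) set) \<Rightarrow> bool" where
  "presented_interleaving \<epsilon> I b Z J c W \<longleftrightarrow> (\<exists>\<phi> \<psi>. lin \<phi> \<and> lin \<psi> \<and>
     (\<forall>r. (\<forall>x\<in>fil I b r. \<phi> x \<in> fil J c (r + diag \<epsilon>) \<and> x - \<psi> (\<phi> x) \<in> Z (r + diag (2 * \<epsilon>))) \<and>
          (\<forall>y\<in>fil J c r. \<psi> y \<in> fil I b (r + diag \<epsilon>) \<and> y - \<phi> (\<psi> y) \<in> W (r + diag (2 * \<epsilon>))) \<and>
          (\<forall>x\<in>Z r. \<phi> x \<in> W (r + diag \<epsilon>)) \<and> (\<forall>y\<in>W r. \<psi> y \<in> Z (r + diag \<epsilon>))))"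

text \<open>
  The map \<open>x \<mapsto> x - \<psi> (\<phi> x)\<close> takes values in the syzygies \<open>Z\<close>, and so does \<open>\<psi>\<close> on the syzygies \<open>W\<close>;
  hence the combination below factors through the cover \<open>d\<close> of \<open>Z\<close>.
\<close>

lemma schanuel_lift:
  fixes Z :: "real ^ 'n::finite \<Rightarrow> ('a \<Rightarrow> 'k::field) set" and b c :: "'a \<Rightarrow> real ^ 'n"
  assumes fin: "finite I" "finite J'" and disj: "I \<inter> J' = {}"
    and lin: "lin \<phi>" "lin \<psi>" "lin d" "lin \<delta>"
    and Z: "\<And>r. fv.subspace (Z r)"
    and \<phi>\<psi>: "\<And>r x. x \<in> fil I b r \<Longrightarrow> x - \<psi> (\<phi> x) \<in> Z (r + diag (2 * \<epsilon>))"
    and \<psi>: "\<And>r y. y \<in> W r \<Longrightarrow> \<psi> y \<in> Z (r + diag \<epsilon>)"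
    and d: "\<And>r. d ` fil I' c r = Z (r + diag \<epsilon>)"
    and \<delta>: "\<And>r. \<delta> ` fil J' b r = W (r + diag \<epsilon>)"
  shows "\<exists>l. lin l \<and> (\<forall>r. \<forall>x\<in>fil (I \<union> J') b r. l x \<in> fil I' c (r + diag \<epsilon>) \<and>
      d (l x) = restr I x - \<psi> (\<phi> (restr I x) + \<delta> (restr J' x)))"
proof (rule lift_lin)
  have "lin (\<lambda>x. \<phi> (restr I x) + \<delta> (restr J' x))"
    by (intro lin_plus lin_comp[OF lin_restr] lin)
  then show "lin (\<lambda>x. restr I x - \<psi> (\<phi> (restr I x) + \<delta> (restr J' x)))"
    by (intro lin_minus lin_restr lin_comp[OF _ lin(2)])
  fix i assume i: "i \<in> I \<union> J'"
  have "restr I (unit_vec i) - \<psi> (\<phi> (restr I (unit_vec i)) + \<delta> (restr J' (unit_vec i)))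
      \<in> Z (b i + diag (2 * \<epsilon>))" (is "?z \<in> _")
  proof (cases "i \<in> I")
    case True
    have u: "(unit_vec i :: 'a \<Rightarrow> 'k) \<in> fil I b (b i)" using True by (rule unit_vec_fil) simp
    show ?thesis
      using \<phi>\<psi>[OF u] restr_same[OF u] restr_disjoint[OF u disj] lin_0[OF lin(4)] by simp
  next
    case False
    have u: "(unit_vec i :: 'a \<Rightarrow> 'k) \<in> fil J' b (b i)" using i False by (intro unit_vec_fil) auto
    have "\<delta> (unit_vec i) \<in> W (b i + diag \<epsilon>)" using u \<delta> by blast
    then have "\<psi> (\<delta> (unit_vec i)) \<in> Z (b i + diag (2 * \<epsilon>))"
      using \<psi>[of _ "b i + diag \<epsilon>"] by (simp add: add_diag_diag)
    then have "- \<psi> (\<delta> (unit_vec i)) \<in> Z (b i + diag (2 * \<epsilon>))" by (rule fv.subspace_neg[OF Z])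
    moreover have "restr I (unit_vec i :: 'a \<Rightarrow> 'k) = 0" "restr J' (unit_vec i :: 'a \<Rightarrow> 'k) = unit_vec i"
      using restr_same[OF u] restr_disjoint[OF u, of I] disj by (auto simp: Int_commute)
    ultimately show ?thesis by (simp only: lin_0[OF lin(1)] add_0 diff_0)
  qed
  moreover have "Z (b i + diag (2 * \<epsilon>)) = d ` fil I' c (b i + diag \<epsilon>)"
    by (simp add: d add_diag_diag)
  ultimately have "?z \<in> d ` fil I' c (b i + diag \<epsilon>)" by (simp only:)
  then show "\<exists>y\<in>fil I' c (b i + diag \<epsilon>). d y = ?z" by (elim imageE) (erule bexI[rotated], erule sym)
qed (use fin lin in auto)

text \<open>
  On the level of modules, the isomorphism behind Schanuel's lemma sends \<open>(x, w)\<close> with \<open>w \<in> W\<close> to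
  \<open>(y, x - \<psi> y)\<close> with \<open>y = \<phi> x + w\<close>, and its inverse sends \<open>(y, z)\<close> to \<open>(x, y - \<phi> x)\<close> with
  \<open>x = \<psi> y + z\<close>.  The maps \<open>\<phi>\<close> and \<open>\<psi>\<close> raise grades by \<open>\<epsilon>\<close>, so this is an \<open>\<epsilon>\<close>-interleaving once
  \<open>W\<close> and \<open>Z\<close> are shifted by \<open>\<epsilon>\<close>.  Lifting the second components through the covers \<open>d\<close> and \<open>\<delta>\<close>
  presents it by free modules again.  The shift of the covers is absorbed in the grades of \<open>I'\<close> and \<open>J'\<close>.
\<close>

lemma schanuel_step:
  fixes Z W :: "real ^ 'n::finite \<Rightarrow> ('a \<Rightarrow> 'k::field) set" and b c :: "'a \<Rightarrow> real ^ 'n"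
  assumes "\<epsilon> \<ge> 0" and fin: "finite I" "finite J" "finite I'" "finite J'"
    and disj: "I \<inter> J' = {}" "J \<inter> I' = {}"
    and int: "presented_interleaving \<epsilon> I b Z J c W"
    and sub: "\<And>r. fv.subspace (Z r)" "\<And>r. fv.subspace (W r)"
      "\<And>r. Z r \<subseteq> fil I b r" "\<And>r. W r \<subseteq> fil J c r"
    and lin: "lin d" "lin \<delta>"
    and d: "\<And>r. d ` fil I' c r = Z (r + diag \<epsilon>)"
    and \<delta>: "\<And>r. \<delta> ` fil J' b r = W (r + diag \<epsilon>)"
  shows "presented_interleaving \<epsilon> (I \<union> J') b (\<lambda>r. {x \<in> fil J' b r. \<delta> x = 0})
           (J \<union> I') c (\<lambda>r. {x \<in> fil I' c r. d x = 0})"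
proof -
  obtain \<phi> \<psi> where lin': "lin \<phi>" "lin \<psi>"
    and \<phi>: "\<And>r x. x \<in> fil I b r \<Longrightarrow> \<phi> x \<in> fil J c (r + diag \<epsilon>)"
      "\<And>r x. x \<in> fil I b r \<Longrightarrow> x - \<psi> (\<phi> x) \<in> Z (r + diag (2 * \<epsilon>))"
      "\<And>r x. x \<in> Z r \<Longrightarrow> \<phi> x \<in> W (r + diag \<epsilon>)"
    and \<psi>: "\<And>r x. x \<in> fil J c r \<Longrightarrow> \<psi> x \<in> fil I b (r + diag \<epsilon>)"
      "\<And>r x. x \<in> fil J c r \<Longrightarrow> x - \<phi> (\<psi> x) \<in> W (r + diag (2 * \<epsilon>))"
      "\<And>r x. x \<in> W r \<Longrightarrow> \<psi> x \<in> Z (r + diag \<epsilon>)"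
    using int unfolding presented_interleaving_def by auto
  obtain l where l: "lin l"
    "\<And>r x. x \<in> fil (I \<union> J') b r \<Longrightarrow> l x \<in> fil I' c (r + diag \<epsilon>)"
    "\<And>r x. x \<in> fil (I \<union> J') b r \<Longrightarrow> d (l x) = restr I x - \<psi> (\<phi> (restr I x) + \<delta> (restr J' x))"
    using schanuel_lift[OF fin(1,4) disj(1) lin' lin sub(1) \<phi>(2) \<psi>(3) d \<delta>] by blast
  obtain m where m: "lin m"
    "\<And>r x. x \<in> fil (J \<union> I') c r \<Longrightarrow> m x \<in> fil J' b (r + diag \<epsilon>)"
    "\<And>r x. x \<in> fil (J \<union> I') c r \<Longrightarrow> \<delta> (m x) = restr J x - \<phi> (\<psi> (restr J x) + d (restr I' x))"
    using schanuel_lift[OF fin(2,3) disj(2) lin'(2,1) lin(2,1) sub(2) \<psi>(2) \<phi>(3) \<delta> d] by blast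
  \<comment> \<open>The first two terms are the component in \<open>J\<close>, the last is the lift of the component in \<open>Z\<close>.\<close>
  define f where "f = (\<lambda>x. \<phi> (restr I x) + \<delta> (restr J' x) + l x)"
  define g where "g = (\<lambda>x. \<psi> (restr J x) + d (restr I' x) + m x)"
  have linfg: "lin f" "lin g"
    unfolding f_def g_def
    by (intro lin_plus lin_comp[OF lin_restr] lin lin' l(1) m(1))+
  have f1: "\<phi> (restr I x) + \<delta> (restr J' x) \<in> fil J c (r + diag \<epsilon>)" if "x \<in> fil (I \<union> J') b r" for x r
  proof (rule fv.subspace_add[OF subspace_fil])
    show "\<phi> (restr I x) \<in> fil J c (r + diag \<epsilon>)" by (rule \<phi>(1)[OF restr_fil[OF that]])
    have "restr J' x \<in> fil J' b r" using that restr_fil[of x J' I b r] by (simp add: Un_commute)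
    then show "\<delta> (restr J' x) \<in> fil J c (r + diag \<epsilon>)" using \<delta> sub(4) by blast
  qed
  have g1: "\<psi> (restr J x) + d (restr I' x) \<in> fil I b (r + diag \<epsilon>)" if "x \<in> fil (J \<union> I') c r" for x r
  proof (rule fv.subspace_add[OF subspace_fil])
    show "\<psi> (restr J x) \<in> fil I b (r + diag \<epsilon>)" by (rule \<psi>(1)[OF restr_fil[OF that]])
    have "restr I' x \<in> fil I' c r" using that restr_fil[of x I' J c r] by (simp add: Un_commute)
    then show "d (restr I' x) \<in> fil I b (r + diag \<epsilon>)" using d sub(3) by blast
  qed
  have f2: "f x \<in> fil (J \<union> I') c (r + diag \<epsilon>)" if "x \<in> fil (I \<union> J') b r" for x r
    unfolding f_def
    by (rule fv.subspace_add[OF subspace_fil subsetD[OF fil_Un(1) f1[OF that]] subsetD[OF fil_Un(2) l(2)[OF that]]])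
  have g2: "g x \<in> fil (I \<union> J') b (r + diag \<epsilon>)" if "x \<in> fil (J \<union> I') c r" for x r
    unfolding g_def
    by (rule fv.subspace_add[OF subspace_fil subsetD[OF fil_Un(1) g1[OF that]] subsetD[OF fil_Un(2) m(2)[OF that]]])
  have rf: "restr J (f x) = \<phi> (restr I x) + \<delta> (restr J' x)" "restr I' (f x) = l x"
    if "x \<in> fil (I \<union> J') b r" for x r
    using restr_same[OF f1[OF that]] restr_same[OF l(2)[OF that]] disj(2)
      restr_disjoint[OF f1[OF that] disj(2)] restr_disjoint[OF l(2)[OF that], of J]
    unfolding f_def by (simp_all add: lin_add[OF lin_restr] Int_commute)
  have rg: "restr I (g x) = \<psi> (restr J x) + d (restr I' x)" "restr J' (g x) = m x"
    if "x \<in> fil (J \<union> I') c r" for x r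
    using restr_same[OF g1[OF that]] restr_same[OF m(2)[OF that]] disj(1)
      restr_disjoint[OF g1[OF that] disj(1)] restr_disjoint[OF m(2)[OF that], of I]
    unfolding g_def by (simp_all add: lin_add[OF lin_restr] Int_commute)
  have mono: "x \<in> fil K e (r + diag (2 * \<epsilon>))" if "x \<in> fil K e r" for K x r and e :: "'a \<Rightarrow> real ^ 'n"
    using that fil_mono[of r "r + diag (2 * \<epsilon>)" K e] \<open>\<epsilon> \<ge> 0\<close> by (auto simp: less_eq_vec_def)
  have gf: "x - g (f x) \<in> {x \<in> fil J' b (r + diag (2 * \<epsilon>)). \<delta> x = 0}" if x: "x \<in> fil (I \<union> J') b r" for x r
  proof -
    have gf: "g (f x) = restr I x + m (f x)"
      unfolding g_def rf[OF x] l(3)[OF x] by simp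
    have eq: "x - g (f x) = restr J' x - m (f x)"
      unfolding gf using restr_split[OF x disj(1)] by (metis add_diff_cancel_left)
    have "restr J' x \<in> fil J' b (r + diag (2 * \<epsilon>))"
      using x restr_fil[of x J' I b r] by (intro mono) (simp add: Un_commute)
    moreover have "m (f x) \<in> fil J' b (r + diag (2 * \<epsilon>))"
      using m(2)[OF f2[OF x]] by (simp add: add_diag_diag)
    moreover have "\<delta> (restr J' x - m (f x)) = 0"
      using lin_diff[OF lin(2)] m(3)[OF f2[OF x]] rf[OF x] l(3)[OF x] by simp
    ultimately show ?thesis
      unfolding eq using fv.subspace_diff[OF subspace_fil] by blast
  qed
  have fg: "x - f (g x) \<in> {x \<in> fil I' c (r + diag (2 * \<epsilon>)). d x = 0}" if x: "x \<in> fil (J \<union> I') c r" for x r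
  proof -
    have fg: "f (g x) = restr J x + l (g x)"
      unfolding f_def rg[OF x] m(3)[OF x] by simp
    have eq: "x - f (g x) = restr I' x - l (g x)"
      unfolding fg using restr_split[OF x disj(2)] by (metis add_diff_cancel_left)
    have "restr I' x \<in> fil I' c (r + diag (2 * \<epsilon>))"
      using x restr_fil[of x I' J c r] by (intro mono) (simp add: Un_commute)
    moreover have "l (g x) \<in> fil I' c (r + diag (2 * \<epsilon>))"
      using l(2)[OF g2[OF x]] by (simp add: add_diag_diag)
    moreover have "d (restr I' x - l (g x)) = 0"
      using lin_diff[OF lin(1)] l(3)[OF g2[OF x]] rg[OF x] m(3)[OF x] by simp
    ultimately show ?thesis
      unfolding eq using fv.subspace_diff[OF subspace_fil] by blast
  qed
  have "f x \<in> {x \<in> fil I' c (r + diag \<epsilon>). d x = 0}" if x: "x \<in> fil J' b r" "\<delta> x = 0" for x r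
  proof -
    have x': "x \<in> fil (I \<union> J') b r" using x(1) fil_Un(2) by blast
    have "f x = l x" "d (l x) = 0"
      using l(3)[OF x'] restr_same[OF x(1)] restr_disjoint[OF x(1), of I] disj(1) x(2)
        lin_0[OF lin'(1)] lin_0[OF lin'(2)] unfolding f_def by (simp_all add: Int_commute)
    then show ?thesis using l(2)[OF x'] by simp
  qed
  moreover have "g x \<in> {x \<in> fil J' b (r + diag \<epsilon>). \<delta> x = 0}" if x: "x \<in> fil I' c r" "d x = 0" for x r
  proof -
    have x': "x \<in> fil (J \<union> I') c r" using x(1) fil_Un(2) by blast
    have "g x = m x" "\<delta> (m x) = 0"
      using m(3)[OF x'] restr_same[OF x(1)] restr_disjoint[OF x(1), of J] disj(2) x(2)
        lin_0[OF lin'(1)] lin_0[OF lin'(2)] unfolding g_def by (simp_all add: Int_commute)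
    then show ?thesis using m(2)[OF x'] by simp
  qed
  ultimately show ?thesis
    unfolding presented_interleaving_def
    using linfg f2 g2 gf fg by - (rule exI[of _ f], rule exI[of _ g], simp, blast)
qed

text \<open>
  All stages of a resolution use the same index type, so direct sums of several stages are
  formed over pairs of a level and an index.
\<close>

definition tag :: "nat \<Rightarrow> ('i \<Rightarrow> 'k::field) \<Rightarrow> nat \<times> 'i \<Rightarrow> 'k" where
  "tag m x = (\<lambda>(k, i). if k = m then x i else 0)"

definition untag :: "nat \<Rightarrow> (nat \<times> 'i \<Rightarrow> 'k::field) \<Rightarrow> 'i \<Rightarrow> 'k" where
  "untag m x = (\<lambda>i. x (m, i))"

text \<open>
  Level \<open>k\<close> is shifted by \<open>k \<epsilon>\<close>; shifting a module by \<open>c\<close> lowers the grades of its generators by \<open>c\<close>.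
\<close>

definition level_grade :: "real \<Rightarrow> ('i \<Rightarrow> real ^ 'n::finite) \<Rightarrow> nat \<times> 'i \<Rightarrow> real ^ 'n" where
  "level_grade \<epsilon> b = (\<lambda>(k, i). b i - diag (real k * \<epsilon>))"

text \<open>
  The flag selects one of two resolutions.  The sum for \<open>s\<close> takes the even levels from
  resolution \<open>s\<close> and the odd levels from the other one.
\<close>

definition alternating :: "(bool \<Rightarrow> nat \<Rightarrow> 'i set) \<Rightarrow> bool \<Rightarrow> nat \<Rightarrow> (nat \<times> 'i) set" where
  "alternating I s m = {(k, i). k \<le> m \<and> i \<in> I (s = even k) k}"

lemma lin_tag: "lin (tag m)"
  by (rule linI) (auto simp: tag_def fun_eq_iff)

lemma lin_untag: "lin (untag m)"
  by (rule linI) (auto simp: untag_def fun_eq_iff)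

lemma untag_tag [simp]: "untag m (tag m x) = x"
  by (simp add: tag_def untag_def)

lemma tag_eq_0_iff [simp]: "tag m x = 0 \<longleftrightarrow> x = 0"
  by (metis lin_0 lin_tag lin_untag untag_tag)

lemma tag_image_iff [simp]: "tag m x \<in> tag m ` A \<longleftrightarrow> x \<in> A"
  by (metis image_iff untag_tag)

lemma tag_in_fil_iff:
  "tag m x \<in> fil ({m} \<times> I) (level_grade \<epsilon> b) r \<longleftrightarrow> x \<in> fil I b (r + diag (real m * \<epsilon>))"
  by (auto simp: fil_def tag_def level_grade_def diff_le_eq)

lemma fil_level: "fil ({m} \<times> I) (level_grade \<epsilon> b) r = tag m ` fil I b (r + diag (real m * \<epsilon>))"
proof -
  have "x = tag m (untag m x)" if "x \<in> fil ({m} \<times> I) (level_grade \<epsilon> b) r" for x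
    using that by (auto simp: fil_def tag_def untag_def fun_eq_iff)
  then have "x \<in> tag m ` fil I b (r + diag (real m * \<epsilon>))" if "x \<in> fil ({m} \<times> I) (level_grade \<epsilon> b) r" for x
    using that tag_in_fil_iff[of m "untag m x" I \<epsilon> b r] by (intro image_eqI[of _ _ "untag m x"]) auto
  then show ?thesis using tag_in_fil_iff[of m _ I \<epsilon> b r] by blast
qed

lemma subspace_lin_image:
  "lin f \<Longrightarrow> fv.subspace V \<Longrightarrow> fv.subspace (f ` V)"
proof (rule fv.subspaceI)
  assume f: "lin f" and V: "fv.subspace V"
  show "0 \<in> f ` V" using lin_0[OF f] fv.subspace_0[OF V] by (intro image_eqI[of _ _ 0]) auto
  fix x y assume "x \<in> f ` V" "y \<in> f ` V"
  then obtain x' y' where "x' \<in> V" "x = f x'" "y' \<in> V" "y = f y'" by blast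
  then show "x + y \<in> f ` V"
    using lin_add[OF f, of x' y'] fv.subspace_add[OF V, of x' y'] by (intro image_eqI[of _ _ "x' + y'"]) auto
next
  fix x c assume f: "lin f" and V: "fv.subspace V" and "x \<in> f ` V"
  then obtain x' where "x' \<in> V" "x = f x'" by blast
  then show "smul c x \<in> f ` V"
    using lin_smul[OF f, of c x'] fv.subspace_scale[OF V, of x' c] by (intro image_eqI[of _ _ "smul c x'"]) auto
qed

lemma subspace_fil_kernel: "lin f \<Longrightarrow> fv.subspace {x \<in> fil I b r. f x = 0}"
  using subspace_fil[of I b r]
  by (auto intro!: fv.subspaceI simp: lin_0 lin_add lin_smul fv.subspace_0
      intro: fv.subspace_add fv.subspace_scale)

lemma alternating_Suc:
  "alternating I s (Suc m) = alternating I s m \<union> {Suc m} \<times> I (s = even (Suc m)) (Suc m)"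
  unfolding alternating_def by (auto simp: le_Suc_eq)

lemma finite_alternating:
  assumes "\<And>s k. finite (I s k)"
  shows "finite (alternating I s m)"
proof (induction m)
  case 0
  have "alternating I s 0 = {0} \<times> I s 0" by (auto simp: alternating_def)
  then show ?case using assms by simp
next
  case (Suc m)
  then show ?case using assms by (auto simp: alternating_Suc)
qed

lemma presented_interleaving_level_0:
  assumes "presented_interleaving \<epsilon> I b Z J c W"
    and "\<And>r. Z r \<subseteq> fil I b r" and "\<And>r. W r \<subseteq> fil J c r"
  shows "presented_interleaving \<epsilon> ({0} \<times> I) (level_grade \<epsilon> b) (\<lambda>r. tag 0 ` Z r)
           ({0} \<times> J) (level_grade \<epsilon> c) (\<lambda>r. tag 0 ` W r)"
proof -
  obtain \<phi> \<psi> where *: "lin \<phi>" "lin \<psi>"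
    "\<forall>r. (\<forall>x\<in>fil I b r. \<phi> x \<in> fil J c (r + diag \<epsilon>) \<and> x - \<psi> (\<phi> x) \<in> Z (r + diag (2 * \<epsilon>))) \<and>
          (\<forall>y\<in>fil J c r. \<psi> y \<in> fil I b (r + diag \<epsilon>) \<and> y - \<phi> (\<psi> y) \<in> W (r + diag (2 * \<epsilon>))) \<and>
          (\<forall>x\<in>Z r. \<phi> x \<in> W (r + diag \<epsilon>)) \<and> (\<forall>y\<in>W r. \<psi> y \<in> Z (r + diag \<epsilon>))"
    using assms(1) unfolding presented_interleaving_def by blast
  have r: "r + diag 0 = r" for r :: "real ^ 'b" by (simp add: vec_eq_iff)
  show ?thesis
    unfolding presented_interleaving_def
  proof (rule exI[of _ "\<lambda>x. tag 0 (\<phi> (untag 0 x))"], rule exI[of _ "\<lambda>x. tag 0 (\<psi> (untag 0 x))"], intro conjI allI)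
    show "lin (\<lambda>x. tag 0 (\<phi> (untag 0 x)))" "lin (\<lambda>x. tag 0 (\<psi> (untag 0 x)))"
      by (rule lin_comp[OF lin_comp[OF lin_untag *(1)] lin_tag] lin_comp[OF lin_comp[OF lin_untag *(2)] lin_tag])+
  qed (use * in \<open>auto simp: fil_level r lin_diff[OF lin_tag, symmetric]\<close>)
qed

text \<open>
  Each step applies Schanuel's lemma to the covers of the two current syzygies.  The new
  generators of one sum come from the syzygy of the other, which is why the two resolutions alternate.
\<close>

lemma alternating_interleaving:
  fixes I :: "bool \<Rightarrow> nat \<Rightarrow> 'i set" and b :: "'i \<Rightarrow> real ^ 'n::finite"
    and d :: "bool \<Rightarrow> nat \<Rightarrow> ('i \<Rightarrow> 'k::field) \<Rightarrow> ('i \<Rightarrow> 'k)"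
    and Z :: "bool \<Rightarrow> nat \<Rightarrow> real ^ 'n \<Rightarrow> ('i \<Rightarrow> 'k) set"
  assumes "\<epsilon> \<ge> 0" and fin: "\<And>s k. finite (I s k)" and lin: "\<And>s k. lin (d s k)"
    and sub: "\<And>s k r. fv.subspace (Z s k r)" "\<And>s k r. Z s k r \<subseteq> fil (I s k) b r"
    and img: "\<And>s k r. d s k ` fil (I s (Suc k)) b r = Z s k r"
    and ker: "\<And>s k r. Z s (Suc k) r = {x \<in> fil (I s (Suc k)) b r. d s k x = 0}"
    and base: "presented_interleaving \<epsilon> (I True 0) b (Z True 0) (I False 0) b (Z False 0)"
  shows "presented_interleaving \<epsilon>
    (alternating I True m) (level_grade \<epsilon> b) (\<lambda>r. tag m ` Z (True = even m) m (r + diag (real m * \<epsilon>)))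
    (alternating I False m) (level_grade \<epsilon> b) (\<lambda>r. tag m ` Z (False = even m) m (r + diag (real m * \<epsilon>)))"
proof (induction m)
  case 0
  have "alternating I s 0 = {0} \<times> I s 0" for s by (auto simp: alternating_def)
  moreover have "r + diag (real 0 * \<epsilon>) = r" for r :: "real ^ 'n" by (simp add: vec_eq_iff)
  ultimately show ?case using presented_interleaving_level_0[OF base sub(2) sub(2)] by simp
next
  case (Suc m)
  let ?T = "\<lambda>s m r. tag m ` Z (s = even m) m (r + diag (real m * \<epsilon>))"
  let ?new = "\<lambda>s. {Suc m} \<times> I (s = even (Suc m)) (Suc m)"
  define D where "D = (\<lambda>s x. tag m (d (s = even (Suc m)) m (untag (Suc m) x)))"
  have shift: "r + diag (real (Suc m) * \<epsilon>) = r + diag \<epsilon> + diag (real m * \<epsilon>)" for r :: "real ^ 'n"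
    by (simp add: vec_eq_iff algebra_simps)
  have linD: "lin (D s)" for s
    unfolding D_def by (rule lin_comp[OF lin_comp[OF lin_untag lin] lin_tag])
  have imgD: "D s ` fil (?new s) (level_grade \<epsilon> b) r = ?T (\<not> s) m (r + diag \<epsilon>)" for s r
  proof -
    have "D s ` fil (?new s) (level_grade \<epsilon> b) r
        = tag m ` d (s = even (Suc m)) m ` fil (I (s = even (Suc m)) (Suc m)) b (r + diag \<epsilon> + diag (real m * \<epsilon>))"
      unfolding fil_level shift D_def by (simp only: image_image untag_tag)
    moreover have "((\<not> s) = even m) = (s = even (Suc m))" by auto
    ultimately show ?thesis unfolding img by simp
  qed
  have kerD: "{x \<in> fil (?new s) (level_grade \<epsilon> b) r. D s x = 0} = ?T s (Suc m) r" for s r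
    unfolding fil_level D_def ker by auto
  have T_sub: "fv.subspace (?T s m r)" for s r
    by (intro subspace_lin_image lin_tag sub)
  have T_fil: "?T s m r \<subseteq> fil (alternating I s m) (level_grade \<epsilon> b) r" for s r
  proof -
    have "?T s m r \<subseteq> fil ({m} \<times> I (s = even m) m) (level_grade \<epsilon> b) r"
      unfolding fil_level using sub(2) by blast
    also have "\<dots> \<subseteq> fil (alternating I s m) (level_grade \<epsilon> b) r"
      unfolding fil_def alternating_def by auto
    finally show ?thesis .
  qed
  have disj: "alternating I s m \<inter> ?new s' = {}" for s s' by (auto simp: alternating_def)
  have "presented_interleaving \<epsilon>
    (alternating I True m \<union> ?new True) (level_grade \<epsilon> b)
       (\<lambda>r. {x \<in> fil (?new True) (level_grade \<epsilon> b) r. D True x = 0})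
    (alternating I False m \<union> ?new False) (level_grade \<epsilon> b)
       (\<lambda>r. {x \<in> fil (?new False) (level_grade \<epsilon> b) r. D False x = 0})"
  proof (rule schanuel_step[OF \<open>\<epsilon> \<ge> 0\<close> _ _ _ _ disj disj Suc.IH T_sub T_sub T_fil T_fil linD linD])
    show "D False ` fil (?new False) (level_grade \<epsilon> b) r = ?T True m (r + diag \<epsilon>)" for r
      using imgD[of False] by simp
    show "D True ` fil (?new True) (level_grade \<epsilon> b) r = ?T False m (r + diag \<epsilon>)" for r
      using imgD[of True] by simp
  qed (use fin finite_alternating[of I] in auto)
  then show ?case unfolding kerD alternating_Suc .
qed

section \<open>Interleaved free modules\<close>

lemma presented_interleaving_sym:
  "presented_interleaving \<epsilon> I b Z J c W \<Longrightarrow> presented_interleaving \<epsilon> J c W I b Z"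
  unfolding presented_interleaving_def by blast

text \<open>
  The dependence is kept as a vector, so that linear maps can be applied to it.
\<close>

lemma linear_relation:
  fixes \<phi> :: "('i \<Rightarrow> 'k::field) \<Rightarrow> ('j \<Rightarrow> 'k)"
  assumes "finite S" "finite T" "card T < card S" "lin \<phi>"
  shows "\<exists>x. x \<noteq> 0 \<and> (\<forall>i. x i \<noteq> 0 \<longrightarrow> i \<in> S) \<and> (\<forall>j\<in>T. \<phi> x j = 0)"
proof -
  obtain a where a: "\<exists>i\<in>S. a i \<noteq> 0" "\<forall>j\<in>T. (\<Sum>i\<in>S. a i * \<phi> (unit_vec i) j) = 0"
    using linear_dependence[OF assms(2,1,3), of "\<lambda>i. \<phi> (unit_vec i)"] by blast
  have x: "restr S a = lincomb S unit_vec a"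
    using assms(1) by (auto simp: fun_eq_iff restr_def lincomb_apply unit_vec_apply
        if_distrib[of "\<lambda>x. _ * x"] cong: if_cong)
  have "\<phi> (restr S a) = lincomb S (\<lambda>i. \<phi> (unit_vec i)) a"
    unfolding x by (rule lin_lincomb_eq[OF assms(4)])
  then have "\<forall>j\<in>T. \<phi> (restr S a) j = 0" using a(2) by (simp add: lincomb_apply)
  then show ?thesis
    using a(1) by (intro exI[of _ "restr S a"]) (auto simp: restr_def fun_eq_iff)
qed

text \<open>
  Assume fewer generators of grade \<open>r\<close> in \<open>J\<close>.  Then some combination \<open>x\<close> of the generators of grade
  \<open>r\<close> in \<open>I\<close> has image without coefficients at the grade \<open>r\<close>.  Only generators of grade exactly
  \<open>r\<close> could carry it back to grade \<open>r\<close>, so \<open>\<psi> (\<phi> x)\<close> vanishes there, while it agrees with \<open>x\<close>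
  there because the relations \<open>Z\<close> do.
\<close>

lemma multiplicity_le:
  fixes b :: "'i \<Rightarrow> real ^ 'n::finite" and Z :: "real ^ 'n \<Rightarrow> ('i \<Rightarrow> 'k::field) set"
  assumes fin: "finite I" "finite J" and int: "presented_interleaving 0 I b Z J c W"
    and rad: "\<And>x i. x \<in> Z r \<Longrightarrow> x i \<noteq> 0 \<Longrightarrow> b i \<noteq> r"
  shows "card {i \<in> I. b i = r} \<le> card {j \<in> J. c j = r}"
proof (rule ccontr)
  assume less: "\<not> ?thesis"
  have r0: "s + diag (2 * 0) = s" "s + diag 0 = s" for s :: "real ^ 'n" by (simp_all add: vec_eq_iff)
  obtain \<phi> \<psi> where lin: "lin \<phi>" "lin \<psi>"
    and \<phi>: "\<And>s x. x \<in> fil I b s \<Longrightarrow> \<phi> x \<in> fil J c s"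
      "\<And>s x. x \<in> fil I b s \<Longrightarrow> x - \<psi> (\<phi> x) \<in> Z s"
    and \<psi>: "\<And>s x. x \<in> fil J c s \<Longrightarrow> \<psi> x \<in> fil I b s"
    using int unfolding presented_interleaving_def r0 by blast
  obtain x where x: "x \<noteq> 0" "\<And>i. x i \<noteq> 0 \<Longrightarrow> i \<in> I \<and> b i = r"
    "\<And>j. j \<in> J \<Longrightarrow> c j = r \<Longrightarrow> \<phi> x j = 0"
    using linear_relation[OF _ _ _ lin(1), of "{i \<in> I. b i = r}" "{j \<in> J. c j = r}"] fin less by auto
  have xr: "x \<in> fil I b r" using x(2) by (auto simp: fil_iff)
  obtain i where i: "x i \<noteq> 0" using x(1) by (auto simp: fun_eq_iff)
  have "\<psi> (\<phi> x) i = (\<Sum>j\<in>J. \<phi> x j * \<psi> (unit_vec j) i)"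
    using lin_eq_lincomb[OF fin(2) \<phi>(1)[OF xr] lin(2)] by (simp add: lincomb_apply)
  also have "\<dots> = 0"
  proof (rule sum.neutral, rule ballI, rule ccontr)
    fix j assume j: "j \<in> J" "\<phi> x j * \<psi> (unit_vec j) i \<noteq> 0"
    have "c j \<le> r" using filD(2)[OF \<phi>(1)[OF xr]] j by auto
    moreover have "r \<le> c j"
      using filD(2)[OF \<psi>[OF unit_vec_fil[OF j(1) order.refl]], of i] j(2) x(2)[OF i] by auto
    ultimately show False using x(3)[OF j(1)] j(2) by auto
  qed
  finally have "(x - \<psi> (\<phi> x)) i \<noteq> 0" using i by simp
  then show False using rad[OF \<phi>(2)[OF xr]] x(2)[OF i] by blast
qed

lemma infnorm_le_cart:
  fixes x :: "real ^ 'n::finite"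
  assumes "\<And>k. \<bar>x $ k\<bar> \<le> e"
  shows "infnorm x \<le> e"
  unfolding infnorm_cart using assms by (intro cSup_least) auto

text \<open>
  One coordinate of \<open>q\<close> lies below that of \<open>p\<close> by more than \<open>(n - 1) \<epsilon>\<close>, and the \<open>n - 1\<close> others exceed those of
  \<open>p\<close> by at most \<open>\<epsilon>\<close> each.  A gap in the other direction is impossible since
  \<open>\<epsilon> \<le> (n - 1) \<epsilon>\<close>, which uses \<open>n \<ge> 2\<close>.
\<close>

lemma coordinate_sum_gt:
  fixes p q :: "real ^ 'n::finite"
  assumes "CARD('n) \<ge> 2" "\<epsilon> \<ge> 0" "q \<le> p + diag \<epsilon>"
    and "infnorm (p - q) > (real CARD('n) - 1) * \<epsilon>"
  shows "(\<Sum>k\<in>UNIV. q $ k) < (\<Sum>k\<in>UNIV. p $ k)"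
proof -
  have le: "q $ k - p $ k \<le> \<epsilon>" for k
    using assms(3) by (auto simp: less_eq_vec_def algebra_simps dest: spec[of _ k])
  have "\<epsilon> * 1 \<le> \<epsilon> * (real CARD('n) - 1)" using assms(1,2) by (intro mult_left_mono) auto
  then have eps: "\<epsilon> \<le> (real CARD('n) - 1) * \<epsilon>" by (simp add: mult.commute)
  obtain k where "\<bar>(p - q) $ k\<bar> > (real CARD('n) - 1) * \<epsilon>"
    using infnorm_le_cart[of "p - q"] assms(4) by (meson not_le)
  then have k: "p $ k - q $ k > (real CARD('n) - 1) * \<epsilon>" using le[of k] eps by (auto simp: abs_real_def split: if_splits)
  have "(\<Sum>l\<in>UNIV - {k}. q $ l - p $ l) \<le> (\<Sum>l\<in>UNIV - {k}. \<epsilon>)" by (intro sum_mono le)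
  also have "\<dots> = (real CARD('n) - 1) * \<epsilon>" by (simp add: card_Diff_singleton of_nat_diff)
  also have "\<dots> < p $ k - q $ k" by (rule k)
  finally have "(\<Sum>l\<in>UNIV. q $ l - p $ l) < 0" by (subst sum.remove[of _ k]) auto
  then show ?thesis by (simp add: sum_subtractf)
qed

text \<open>
  If \<open>q\<close> is far from both, the sum of coordinates drops strictly from \<open>p\<close> to \<open>q\<close> and again from
  \<open>q\<close> to \<open>p'\<close>.
\<close>

lemma near_source_or_target:
  fixes p q p' :: "real ^ 'n::finite"
  assumes "CARD('n) \<ge> 2" "\<epsilon> \<ge> 0" "q \<le> p + diag \<epsilon>" "p' \<le> q + diag \<epsilon>"
    and "(\<Sum>k\<in>UNIV. p $ k) \<le> (\<Sum>k\<in>UNIV. p' $ k)"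
  shows "infnorm (p - q) \<le> (real CARD('n) - 1) * \<epsilon> \<or> infnorm (p' - q) \<le> (real CARD('n) - 1) * \<epsilon>"
  using coordinate_sum_gt[OF assms(1-3)] coordinate_sum_gt[OF assms(1,2,4)] assms(5)
  by (metis infnorm_sub not_le order.strict_trans1 order.asym)

lemma upper_bound_vec:
  fixes b :: "'i \<Rightarrow> real ^ 'n::finite"
  assumes "finite I"
  shows "\<exists>R. \<forall>i\<in>I. b i \<le> R"
proof -
  have "b i \<le> (\<chi> k. \<Sum>j\<in>I. \<bar>b j $ k\<bar>)" if "i \<in> I" for i
    unfolding less_eq_vec_def
  proof
    fix k
    have "b i $ k \<le> \<bar>b i $ k\<bar>" by simp
    also have "\<dots> \<le> (\<Sum>j\<in>I. \<bar>b j $ k\<bar>)" using that assms by (intro member_le_sum) auto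
    finally show "b i $ k \<le> (\<chi> k. \<Sum>j\<in>I. \<bar>b j $ k\<bar>) $ k" by simp
  qed
  then show ?thesis by blast
qed

text \<open>
  Hall's condition for the neighbours within \<open>(n - 1) \<epsilon>\<close>.  If a set \<open>S\<close> has too few neighbours, some
  nonzero combination \<open>x\<close> of \<open>S\<close> has image with no coefficient at a neighbour of \<open>S\<close>.
  Among the generators in \<open>x\<close> take \<open>i'\<close> with the largest sum of coordinates.  As \<open>x = \<psi> (\<phi> x)\<close>, some
  path from a generator \<open>i\<close> in \<open>x\<close> through some \<open>j\<close> ends in \<open>i'\<close>, and then \<open>j\<close> is close to
  \<open>i\<close> or \<open>i'\<close>, that is, a neighbour of \<open>S\<close>.
\<close>

lemma free_interleaving_injection:
  fixes b :: "'i \<Rightarrow> real ^ 'n::finite" and c :: "'j \<Rightarrow> real ^ 'n"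
    and Z :: "real ^ 'n \<Rightarrow> ('i \<Rightarrow> 'k::field) set" and W :: "real ^ 'n \<Rightarrow> ('j \<Rightarrow> 'k) set"
  assumes n: "CARD('n) \<ge> 2" and "\<epsilon> \<ge> 0" and fin: "finite I" "finite J"
    and int: "presented_interleaving \<epsilon> I b Z J c W" and Z: "\<And>r. Z r \<subseteq> {0}"
  shows "\<exists>h. inj_on h I \<and> (\<forall>i\<in>I. h i \<in> J \<and> infnorm (b i - c (h i)) \<le> (real CARD('n) - 1) * \<epsilon>)"
proof -
  define N where "N = (\<lambda>i. {j \<in> J. infnorm (b i - c j) \<le> (real CARD('n) - 1) * \<epsilon>})"
  obtain \<phi> \<psi> where lin: "lin \<phi>" "lin \<psi>"
    and \<phi>: "\<And>s x. x \<in> fil I b s \<Longrightarrow> \<phi> x \<in> fil J c (s + diag \<epsilon>)"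
      "\<And>s x. x \<in> fil I b s \<Longrightarrow> x - \<psi> (\<phi> x) \<in> Z (s + diag (2 * \<epsilon>))"
    and \<psi>: "\<And>s x. x \<in> fil J c s \<Longrightarrow> \<psi> x \<in> fil I b (s + diag \<epsilon>)"
    using int unfolding presented_interleaving_def by blast
  obtain R where R: "\<forall>i\<in>I. b i \<le> R" using upper_bound_vec[OF fin(1)] by blast
  have "card S \<le> card (\<Union>(N ` S))" if S: "S \<subseteq> I" for S
  proof (rule ccontr)
    assume less: "\<not> ?thesis"
    have finS: "finite S" using S fin finite_subset by blast
    have "finite (\<Union>(N ` S))" using finS fin unfolding N_def by auto
    then obtain x where "x \<noteq> 0 \<and> (\<forall>i. x i \<noteq> 0 \<longrightarrow> i \<in> S) \<and> (\<forall>j\<in>\<Union>(N ` S). \<phi> x j = 0)"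
      using linear_relation[OF finS _ _ lin(1), of "\<Union>(N ` S)"] less by (meson not_le)
    then have x: "x \<noteq> 0" "\<And>i. x i \<noteq> 0 \<Longrightarrow> i \<in> S" "\<And>j. j \<in> \<Union>(N ` S) \<Longrightarrow> \<phi> x j = 0" by blast+
    have xR: "x \<in> fil I b R" using x(2) S R by (auto simp: fil_iff)
    define supp where "supp = {i \<in> S. x i \<noteq> 0}"
    have "finite supp" "supp \<noteq> {}" using finS x(1,2) unfolding supp_def by (auto simp: fun_eq_iff)
    define \<alpha> where "\<alpha> = (\<lambda>i. \<Sum>k\<in>UNIV. b i $ k)"
    have "Max (\<alpha> ` supp) \<in> \<alpha> ` supp" using \<open>finite supp\<close> \<open>supp \<noteq> {}\<close> by (intro Max_in) auto
    then obtain i' where "i' \<in> supp" "Max (\<alpha> ` supp) = \<alpha> i'" by blast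
    moreover have "\<alpha> i \<le> Max (\<alpha> ` supp)" if "i \<in> supp" for i
      using that \<open>finite supp\<close> by (intro Max_ge) auto
    ultimately have i': "i' \<in> supp" "\<forall>i\<in>supp. (\<Sum>k\<in>UNIV. b i $ k) \<le> (\<Sum>k\<in>UNIV. b i' $ k)"
      unfolding \<alpha>_def by simp_all
    have "x - \<psi> (\<phi> x) = 0" using \<phi>(2)[OF xR] Z by blast
    then have "x = \<psi> (\<phi> x)" by simp
    then have "x i' = (\<Sum>j\<in>J. \<phi> x j * \<psi> (unit_vec j) i')"
      using lin_eq_lincomb[OF fin(2) \<phi>(1)[OF xR] lin(2)] by (metis lincomb_apply)
    moreover have "x i' \<noteq> 0" using i' unfolding supp_def by auto
    ultimately obtain j where j: "j \<in> J" "\<phi> x j \<noteq> 0" "\<psi> (unit_vec j) i' \<noteq> 0"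
      by (metis (no_types, lifting) mult_zero_left mult_zero_right sum.neutral)
    have "\<phi> x j = (\<Sum>i\<in>I. x i * \<phi> (unit_vec i) j)"
      using lin_eq_lincomb[OF fin(1) xR lin(1)] by (simp add: lincomb_apply)
    then obtain i where i: "i \<in> I" "x i \<noteq> 0" "\<phi> (unit_vec i) j \<noteq> 0"
      using j(2) by (metis (no_types, lifting) mult_zero_left mult_zero_right sum.neutral)
    have isupp: "i \<in> supp" using i x(2) unfolding supp_def by auto
    have "c j \<le> b i + diag \<epsilon>"
      using filD(2)[OF \<phi>(1)[OF unit_vec_fil[OF i(1) order.refl]] i(3)] .
    moreover have "b i' \<le> c j + diag \<epsilon>"
      using filD(2)[OF \<psi>[OF unit_vec_fil[OF j(1) order.refl]] j(3)] .
    ultimately have "j \<in> N i \<or> j \<in> N i'"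
      using near_source_or_target[OF n \<open>\<epsilon> \<ge> 0\<close>, of "c j" "b i" "b i'"] i'(2) isupp j(1)
      unfolding N_def by auto
    then have "\<phi> x j = 0" using x(3) isupp i'(1) unfolding supp_def by auto
    then show False using j(2) by simp
  qed
  then obtain h where "inj_on h I" "\<forall>i\<in>I. h i \<in> N i"
    using hall_marriage[OF fin(1), of N] fin(2) unfolding N_def by auto
  then show ?thesis unfolding N_def by auto
qed

lemma free_interleaving_bijection:
  fixes b :: "'i \<Rightarrow> real ^ 'n::finite" and c :: "'j \<Rightarrow> real ^ 'n"
    and Z :: "real ^ 'n \<Rightarrow> ('i \<Rightarrow> 'k::field) set" and W :: "real ^ 'n \<Rightarrow> ('j \<Rightarrow> 'k) set"
  assumes "CARD('n) \<ge> 2" "\<epsilon> \<ge> 0" and fin: "finite I" "finite J"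
    and int: "presented_interleaving \<epsilon> I b Z J c W"
    and "\<And>r. Z r \<subseteq> {0}" "\<And>r. W r \<subseteq> {0}"
  shows "\<exists>h. bij_betw h I J \<and> (\<forall>i\<in>I. infnorm (b i - c (h i)) \<le> (real CARD('n) - 1) * \<epsilon>)"
proof -
  obtain h where h: "inj_on h I" "\<forall>i\<in>I. h i \<in> J \<and> infnorm (b i - c (h i)) \<le> (real CARD('n) - 1) * \<epsilon>"
    using free_interleaving_injection[OF assms(1-6)] by blast
  obtain g where g: "inj_on g J" "g ` J \<subseteq> I"
    using free_interleaving_injection[OF assms(1,2) fin(2,1) presented_interleaving_sym[OF int] assms(7)]
    by auto
  have "card (h ` I) = card J"
    using card_inj_on_le[OF g fin(1)] card_image[OF h(1)] card_mono[OF fin(2), of "h ` I"] h(2) by auto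
  then have "h ` I = J" using card_subset_eq[OF fin(2), of "h ` I"] h(2) by auto
  then show ?thesis using h by (intro exI[of _ h]) (auto simp: bij_betw_def)
qed

section \<open>Free persistence modules\<close>

text \<open>
  Submodules of free modules, in particular free modules and syzygies, as persistence modules.
\<close>

definition filmod :: "(real ^ 'n \<Rightarrow> ('i \<Rightarrow> 'k::field) set) \<Rightarrow> ('k, 'n::finite, 'i \<Rightarrow> 'k) pmodule" where
  "filmod K = \<lparr>scl = smul, obj = K, arr = (\<lambda>_ _ x. x)\<rparr>"

lemma filmod_simps [simp]:
  "scl (filmod K) = smul" "obj (filmod K) = K" "arr (filmod K) r s x = x"
  by (simp_all add: filmod_def)

lemma finite_copies [simp]: "finite (copies B)"
proof -
  have "copies B = (SIGMA i:set_mset B. {..<count B i})"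
    by (auto simp: copies_def) (metis count_inI less_zeroE)
  then show ?thesis by simp
qed

lemma free_module_scl [simp]: "scl (free_module B) = smul"
  by (auto simp: free_module_def direct_sum_def free_at_def fun_eq_iff split: prod.splits)

lemma free_module_obj [simp]:
  fixes B :: "(real ^ 'n::finite) multiset"
  shows "obj (free_module B :: ('k::field, 'n, _) pmodule) r = fil (copies B) fst r"
proof -
  have "finite {j. x j \<noteq> 0}" if "\<forall>j. j \<notin> copies B \<longrightarrow> x j = 0" for x :: "(real ^ 'n) \<times> nat \<Rightarrow> 'k"
    using that by (intro finite_subset[OF _ finite_copies[of B]]) auto
  moreover have "(y \<in> obj (case j of (i, _) \<Rightarrow> free_at i) r) = (y \<noteq> 0 \<longrightarrow> fst j \<le> r)"
    for y :: 'k and j :: "(real ^ 'n) \<times> nat"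
    by (cases j) (auto simp: free_at_def)
  ultimately show ?thesis
    unfolding free_module_def direct_sum_def fil_def by (auto simp del: split_paired_All split_paired_Ex) blast
qed

text \<open>
  Outside its support condition the structure map of \<open>free_module\<close> truncates, so it is an
  inclusion only on vectors that lie in the module at some grade.
\<close>

lemma free_module_arr: "x \<in> fil (copies B) fst q \<Longrightarrow> arr (free_module B) r s x = x"
  by (auto simp: free_module_def direct_sum_def free_at_def fil_def fun_eq_iff split: prod.splits)

lemma morphism_free_module_iff:
  "morphism (free_module B) N u \<longleftrightarrow> morphism (filmod (fil (copies B) fst)) N u"
  unfolding morphism_def by (auto simp: free_module_arr)

lemma finite_spanning_set:
  assumes "finite I" "fv.subspace V" "V \<subseteq> fil I b r"
  shows "\<exists>S. finite S \<and> S \<subseteq> V \<and> fv.span S = V"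
proof -
  obtain S where S: "S \<subseteq> V" "fv.independent S" "V \<subseteq> fv.span S"
    using fv.basis_exists[of V] by metis
  have "x \<in> fv.span (unit_vec ` I)" if "x \<in> V" for x
  proof -
    have "x = (\<Sum>i\<in>I. smul (x i) (unit_vec i))"
      using fil_eq_lincomb[OF assms(1), of x b r] that assms(3) by (auto simp: lincomb_def)
    also have "\<dots> \<in> fv.span (unit_vec ` I)"
      by (intro fv.span_sum fv.span_scale fv.span_base) auto
    finally show ?thesis .
  qed
  then have "finite S"
    using fv.independent_span_bound[of "unit_vec ` I" S] S assms(1) by blast
  moreover have "fv.span S = V" using fv.span_minimal[OF S(1) assms(2)] S(3) by blast
  ultimately show ?thesis using S(1) by blast
qed

text \<open>
  Stated for any record with inclusions as structure maps, so that it covers both \<open>filmod\<close> and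
  \<open>free_module\<close>, whose structure maps differ off the module.
\<close>

lemma persistence_module_inclusions:
  fixes M :: "('k::field, 'n::finite, 'i \<Rightarrow> 'k) pmodule"
  assumes "scl M = smul" "\<And>r s x. x \<in> obj M r \<Longrightarrow> arr M r s x = x"
    and "finite I" "\<And>r. fv.subspace (obj M r)" "\<And>r. obj M r \<subseteq> fil I b r"
    and "\<And>r s. r \<le> s \<Longrightarrow> obj M r \<subseteq> obj M s"
  shows "persistence_module M"
proof (rule persistence_module.intro)
  show "vector_space (scl M)" unfolding assms(1) by (rule fv.vector_space_axioms)
  show "module.subspace (scl M) (obj M r)" for r unfolding assms(1) by (rule assms(4))
  show "\<exists>S. finite S \<and> module.span (scl M) S = obj M r" for r
    unfolding assms(1) using finite_spanning_set[OF assms(3,4,5)] by blast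
  show "linear_between (scl M) (obj M r) (scl M) (obj M s) (arr M r s)" if "r \<le> s" for r s
    unfolding linear_between_def using assms(2) assms(6)[OF that]
      fv.subspace_add[OF assms(4)] fv.subspace_scale[OF assms(4)]
    by (auto simp: assms(1))
  show "arr M s t (arr M r s x) = arr M r t x" if "r \<le> s" "s \<le> t" "x \<in> obj M r" for r s t x
    using assms(2,6) that by (metis subsetD)
qed (use assms in auto)

lemma persistence_module_filmod:
  assumes "finite I" "\<And>r. fv.subspace (K r)" "\<And>r. K r \<subseteq> fil I b r" "\<And>r s. r \<le> s \<Longrightarrow> K r \<subseteq> K s"
  shows "persistence_module (filmod K)"
  by (rule persistence_module_inclusions[of _ I b]) (use assms in auto)

lemma persistence_module_fil: "finite I \<Longrightarrow> persistence_module (filmod (fil I b))"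
  by (rule persistence_module_filmod[of I _ b]) (auto simp: subspace_fil dest: fil_mono)

lemma persistence_module_free: "persistence_module (free_module B)"
  by (rule persistence_module_inclusions[of _ "copies B" fst])
    (auto simp: subspace_fil free_module_arr dest: fil_mono)

sublocale persistence_module \<subseteq> vs: vector_space "scl M"
  by (rule vector_space)

lemma persistence_module_shift:
  assumes "persistence_module M"
  shows "persistence_module (shift M \<epsilon>)"
proof -
  interpret persistence_module M by fact
  have mono: "r + diag \<epsilon> \<le> s + diag \<epsilon>" if "r \<le> s" for r s :: "real ^ 'b"
    using that by (simp add: less_eq_vec_def)
  show ?thesis
    by (rule persistence_module.intro)
      (use mono vector_space subspace finite_dimensional linear arr_id arr_comp in
        \<open>simp_all add: shift_def\<close>)
qed

lemma linear_betweenD: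
  assumes "linear_between s V t W f"
  shows "x \<in> V \<Longrightarrow> f x \<in> W" "x \<in> V \<Longrightarrow> y \<in> V \<Longrightarrow> f (x + y) = f x + f y"
    "x \<in> V \<Longrightarrow> f (s c x) = t c (f x)"
  using assms by (auto simp: linear_between_def)

lemma linear_between_0:
  assumes "linear_between s V t W f" "vector_space s" "vector_space t" "module.subspace s V"
  shows "f 0 = 0"
proof -
  interpret s: vector_space s by fact
  interpret t: vector_space t by fact
  show ?thesis using linear_betweenD(3)[OF assms(1), of 0 0] s.subspace_0[OF assms(4)] by simp
qed

lemma linear_between_diff:
  assumes "linear_between s V t W f" "vector_space s" "module.subspace s V" "x \<in> V" "y \<in> V"
  shows "f (x - y) = f x - f y"
proof -
  interpret s: vector_space s by fact
  have "x - y \<in> V" using s.subspace_diff assms by blast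
  then show ?thesis using linear_betweenD(2)[OF assms(1), of "x - y" y] assms by simp
qed

lemma linear_between_sum:
  assumes f: "linear_between s V t W f" and vs: "vector_space s" "vector_space t" "module.subspace s V"
    and "finite A" "\<And>a. a \<in> A \<Longrightarrow> v a \<in> V"
  shows "f (\<Sum>a\<in>A. s (c a) (v a)) = (\<Sum>a\<in>A. t (c a) (f (v a)))"
proof -
  interpret s: vector_space s by fact
  interpret t: vector_space t by fact
  have "f (\<Sum>a\<in>A. s (c a) (v a)) = (\<Sum>a\<in>A. t (c a) (f (v a))) \<and> (\<Sum>a\<in>A. s (c a) (v a)) \<in> V"
    using assms(5,6)
  proof (induction A rule: finite_induct)
    case empty
    then show ?case using linear_between_0[OF f vs] s.subspace_0[OF vs(3)] by simp
  next
    case (insert a A)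
    moreover have "s (c a) (v a) \<in> V" using insert s.subspace_scale[OF vs(3)] by blast
    ultimately show ?case
      using linear_betweenD(2)[OF f, of "s (c a) (v a)"] linear_betweenD(3)[OF f]
        s.subspace_add[OF vs(3)] by auto
  qed
  then show ?thesis by blast
qed

lemma morphismD:
  assumes "morphism M N f"
  shows "linear_between (scl M) (obj M r) (scl N) (obj N r) (f r)"
    and "r \<le> s \<Longrightarrow> x \<in> obj M r \<Longrightarrow> f s (arr M r s x) = arr N r s (f r x)"
  using assms by (auto simp: morphism_def)

lemma morphism_comp:
  "morphism L M f \<Longrightarrow> morphism M N g \<Longrightarrow> morphism L N (\<lambda>r x. g r (f r x))"
  unfolding morphism_def linear_between_def by (auto simp: Pi_iff)

lemma morphism_shift: "morphism M N f \<Longrightarrow> morphism (shift M \<epsilon>) (shift N \<epsilon>) (\<lambda>r. f (r + diag \<epsilon>))"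
  unfolding morphism_def shift_def by (auto simp: less_eq_vec_def)

text \<open>
  The morphism from the free module on \<open>I\<close> that sends generator \<open>i\<close> to \<open>g i\<close>.  Restricting the sum to
  the generators born up to \<open>r\<close> keeps \<open>arr M (b i) r\<close> away from incomparable grades.
\<close>

definition free_extension :: "('k, 'n::finite, 'v::ab_group_add) pmodule \<Rightarrow> 'i set \<Rightarrow> ('i \<Rightarrow> real ^ 'n) \<Rightarrow> ('i \<Rightarrow> 'v) \<Rightarrow>
    real ^ 'n \<Rightarrow> ('i \<Rightarrow> 'k::field) \<Rightarrow> 'v" where
  "free_extension M I b g r x = (\<Sum>i\<in>{i \<in> I. b i \<le> r}. scl M (x i) (arr M (b i) r (g i)))"

context persistence_module
begin

lemma arr_in: "r \<le> s \<Longrightarrow> x \<in> obj M r \<Longrightarrow> arr M r s x \<in> obj M s"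
  using linear linear_betweenD(1) by blast

lemma free_extension_morphism:
  assumes fin: "finite I" and g: "\<And>i. i \<in> I \<Longrightarrow> g i \<in> obj M (b i)"
  shows "morphism (filmod (fil I b)) M (free_extension M I b g)"
proof -
  have 1: "free_extension M I b g r x \<in> obj M r" for r x
    unfolding free_extension_def using g arr_in
    by (intro vs.subspace_sum[OF subspace] vs.subspace_scale[OF subspace]) auto
  have 2: "free_extension M I b g s x = arr M r s (free_extension M I b g r x)" if "r \<le> s" "x \<in> fil I b r" for r s x
  proof -
    have "free_extension M I b g s x = (\<Sum>i\<in>{i \<in> I. b i \<le> r}. scl M (x i) (arr M (b i) s (g i)))"
      unfolding free_extension_def using that fin
      by (intro sum.mono_neutral_right) (auto simp: fil_iff vs.scale_zero_left intro: order.trans)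
    also have "\<dots> = (\<Sum>i\<in>{i \<in> I. b i \<le> r}. scl M (x i) (arr M r s (arr M (b i) r (g i))))"
      using that g arr_comp by (intro sum.cong) auto
    also have "\<dots> = arr M r s (free_extension M I b g r x)"
      unfolding free_extension_def
      by (rule linear_between_sum[symmetric, OF linear[OF that(1)] vector_space vector_space subspace])
        (use fin g arr_in in auto)
    finally show ?thesis .
  qed
  have 3: "free_extension M I b g r (x + y) = free_extension M I b g r x + free_extension M I b g r y" for r x y
    by (simp add: free_extension_def vs.scale_left_distrib sum.distrib)
  have 4: "free_extension M I b g r (smul c x) = scl M c (free_extension M I b g r x)" for r x c
    by (simp add: free_extension_def vs.scale_sum_right)
  show ?thesis using 1 2 3 4 by (auto simp: morphism_def linear_between_def)
qed

lemma free_extension_unit: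
  assumes "finite I" "i \<in> I" "g i \<in> obj M (b i)"
  shows "free_extension M I b g (b i) (unit_vec i) = g i"
proof -
  have "free_extension M I b g (b i) (unit_vec i) = (\<Sum>j\<in>{j \<in> I. b j \<le> b i}. if j = i then g i else 0)"
    unfolding free_extension_def using assms arr_id by (intro sum.cong) (auto simp: unit_vec_apply)
  then show ?thesis using assms by simp
qed

lemma morphism_eq_free_extension:
  assumes fin: "finite I" and u: "morphism (filmod (fil I b)) M u" and x: "x \<in> fil I b r"
  shows "u r x = free_extension M I b (\<lambda>i. u (b i) (unit_vec i)) r x"
proof -
  let ?J = "{i \<in> I. b i \<le> r}"
  have "x = (\<Sum>i\<in>I. smul (x i) (unit_vec i))"
    using fil_eq_lincomb[OF fin x] by (simp add: lincomb_def)
  also have "\<dots> = (\<Sum>i\<in>?J. smul (x i) (unit_vec i))"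
    using x fin by (intro sum.mono_neutral_right) (auto simp: fil_iff fun_eq_iff)
  finally have "u r x = u r (\<Sum>i\<in>?J. smul (x i) (unit_vec i))" by simp
  also have "\<dots> = (\<Sum>i\<in>?J. scl M (x i) (u r (unit_vec i)))"
    using linear_between_sum[OF morphismD(1)[OF u, of r, simplified] fv.vector_space_axioms vector_space subspace_fil,
        of ?J unit_vec x] fin unit_vec_fil[of _ I b r] by auto
  also have "\<dots> = free_extension M I b (\<lambda>i. u (b i) (unit_vec i)) r x"
    unfolding free_extension_def
  proof (rule sum.cong[OF refl])
    fix i assume "i \<in> ?J"
    then show "scl M (x i) (u r (unit_vec i)) = scl M (x i) (arr M (b i) r (u (b i) (unit_vec i)))"
      using morphismD(2)[OF u, of "b i" r "unit_vec i"] by (simp add: unit_vec_fil)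
  qed
  finally show ?thesis .
qed

lemma morphism_eqI:
  assumes "finite I" "morphism (filmod (fil I b)) M u" "morphism (filmod (fil I b)) M v"
    and "\<And>i. i \<in> I \<Longrightarrow> u (b i) (unit_vec i) = v (b i) (unit_vec i)" and "x \<in> fil I b r"
  shows "u r x = v r x"
  using morphism_eq_free_extension[OF assms(1,2,5)] morphism_eq_free_extension[OF assms(1,3,5)] assms(4)
  unfolding free_extension_def by simp

end

text \<open>
  Free modules are projective: choose preimages of the images of the generators.  In contrast to
  \<open>projective\<close>, the vectors of \<open>A\<close> and \<open>B\<close> may have any type; lifting interleavings needs this.
\<close>

lemma free_lift:
  assumes A: "persistence_module A" and B: "persistence_module B" and g: "morphism A B g" "surjective A B g"
    and fin: "finite I" and h: "morphism (filmod (fil I b)) B h"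
  shows "\<exists>l. morphism (filmod (fil I b)) A l \<and> (\<forall>r. \<forall>x\<in>fil I b r. g r (l r x) = h r x)"
proof -
  interpret A: persistence_module A by fact
  interpret B: persistence_module B by fact
  have "\<exists>a\<in>obj A (b i). g (b i) a = h (b i) (unit_vec i)" if "i \<in> I" for i
  proof -
    have "h (b i) (unit_vec i) \<in> obj B (b i)"
      using linear_betweenD(1)[OF morphismD(1)[OF h, of "b i"]] unit_vec_fil[OF that order.refl, of b] by simp
    then show ?thesis using g(2) unfolding surjective_def by (metis imageE)
  qed
  then obtain a where a: "\<And>i. i \<in> I \<Longrightarrow> a i \<in> obj A (b i)" "\<And>i. i \<in> I \<Longrightarrow> g (b i) (a i) = h (b i) (unit_vec i)"
    by metis
  have l: "morphism (filmod (fil I b)) A (free_extension A I b a)"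
    by (rule A.free_extension_morphism[OF fin a(1)])
  moreover have "g r (free_extension A I b a r x) = h r x" if "x \<in> fil I b r" for r x
    by (rule B.morphism_eqI[OF fin morphism_comp[OF l g(1)] h _ that])
      (use a A.free_extension_unit[OF fin] in auto)
  ultimately show ?thesis by blast
qed

lemma projective_free: "projective (free_module B)"
  unfolding projective_def morphism_free_module_iff
  using persistence_module_free free_lift[OF _ _ _ _ finite_copies] by fastforce

text \<open>
  As the structure maps are inclusions, naturality makes the components of a morphism
  restrictions of a single linear map.
\<close>

lemma morphism_globalise:
  fixes X :: "('k::field, 'n::finite, 'j \<Rightarrow> 'k) pmodule"
  assumes X: "persistence_module X" "scl X = smul" "\<And>r s x. x \<in> obj X r \<Longrightarrow> arr X r s x = x"
    and fin: "finite I" and u: "morphism (filmod (fil I b)) X u"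
  shows "\<exists>f. lin f \<and> (\<forall>r. \<forall>x\<in>fil I b r. f x = u r x)"
proof -
  interpret X: persistence_module X by fact
  let ?f = "lincomb I (\<lambda>i. u (b i) (unit_vec i))"
  have u_in: "u (b i) (unit_vec i) \<in> obj X (b i)" if "i \<in> I" for i
    using linear_betweenD(1)[OF morphismD(1)[OF u, of "b i"]] unit_vec_fil[OF that order.refl, of b] by simp
  have "?f x = u r x" if x: "x \<in> fil I b r" for r x
  proof -
    have "?f x = (\<Sum>i\<in>{i \<in> I. b i \<le> r}. smul (x i) (u (b i) (unit_vec i)))"
      unfolding lincomb_def using x fin by (intro sum.mono_neutral_right) (auto simp: fil_iff)
    also have "\<dots> = u r x"
      unfolding X.morphism_eq_free_extension[OF fin u x] free_extension_def using X(2,3) u_in by (intro sum.cong) auto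
    finally show ?thesis .
  qed
  then show ?thesis using lin_lincomb by blast
qed

definition kernel_fam :: "'i set \<Rightarrow> ('i \<Rightarrow> real ^ 'n) \<Rightarrow> (real ^ 'n \<Rightarrow> ('i \<Rightarrow> 'k::field) \<Rightarrow> 'v::zero) \<Rightarrow>
    real ^ 'n \<Rightarrow> ('i \<Rightarrow> 'k) set" where
  "kernel_fam I b p r = {x \<in> fil I b r. p r x = 0}"

lemma lift_interleaving_morphism:
  fixes M :: "('k::field, 'n::finite, 'v::ab_group_add) pmodule"
    and N :: "('k, 'n, 'w::ab_group_add) pmodule"
  assumes N: "persistence_module N" and fin: "finite I" "finite J"
    and p: "morphism (filmod (fil I b)) M p"
    and q: "morphism (filmod (fil J c)) N q" "surjective (filmod (fil J c)) N q"
    and f: "morphism M (shift N \<epsilon>) f"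
  shows "\<exists>\<phi>. lin \<phi> \<and> (\<forall>r. \<forall>x\<in>fil I b r. \<phi> x \<in> fil J c (r + diag \<epsilon>) \<and> q (r + diag \<epsilon>) (\<phi> x) = f r (p r x))"
proof -
  let ?A = "shift (filmod (fil J c :: _ \<Rightarrow> ('b \<Rightarrow> 'k) set)) \<epsilon>"
  have A: "persistence_module ?A" using fin by (intro persistence_module_shift persistence_module_fil)
  have "surjective ?A (shift N \<epsilon>) (\<lambda>r. q (r + diag \<epsilon>))"
    using q(2) by (simp add: surjective_def shift_def)
  then obtain l where l: "morphism (filmod (fil I b)) ?A l" "\<forall>r. \<forall>x\<in>fil I b r. q (r + diag \<epsilon>) (l r x) = f r (p r x)"
    using free_lift[OF A persistence_module_shift[OF N] morphism_shift[OF q(1)] _ fin(1) morphism_comp[OF p f]]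
    by blast
  obtain \<phi> where "lin \<phi>" "\<forall>r. \<forall>x\<in>fil I b r. \<phi> x = l r x"
    using morphism_globalise[OF A _ _ fin(1) l(1)] by (auto simp: shift_def)
  moreover have "l r x \<in> fil J c (r + diag \<epsilon>)" if "x \<in> fil I b r" for r x
    using linear_betweenD(1)[OF morphismD(1)[OF l(1), of r]] that by (simp add: shift_def)
  ultimately show ?thesis using l(2) by auto
qed

text \<open>
  Both interleaving morphisms lift to the free covers, and the composites agree with the
  structure maps up to elements of the kernels.
\<close>

lemma interleaved_presentations:
  fixes M :: "('k::field, 'n::finite, 'v::ab_group_add) pmodule"
    and N :: "('k, 'n, 'w::ab_group_add) pmodule"
  assumes M: "persistence_module M" and N: "persistence_module N" and fin: "finite I" "finite J"
    and p: "morphism (filmod (fil I b)) M p" "surjective (filmod (fil I b)) M p"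
    and q: "morphism (filmod (fil J c)) N q" "surjective (filmod (fil J c)) N q"
    and "\<epsilon> \<ge> 0" and int: "interleaved \<epsilon> M N"
  shows "presented_interleaving \<epsilon> I b (kernel_fam I b p) J c (kernel_fam J c q)"
proof -
  interpret M: persistence_module M by fact
  interpret N: persistence_module N by fact
  obtain f g where f: "morphism M (shift N \<epsilon>) f" and g: "morphism N (shift M \<epsilon>) g"
    and gf: "\<And>r x. x \<in> obj M r \<Longrightarrow> g (r + diag \<epsilon>) (f r x) = arr M r (r + diag (2 * \<epsilon>)) x"
    and fg: "\<And>r x. x \<in> obj N r \<Longrightarrow> f (r + diag \<epsilon>) (g r x) = arr N r (r + diag (2 * \<epsilon>)) x"
    using int unfolding interleaved_def shift_hom_def shift_unit_def by blast
  obtain \<phi> where \<phi>: "lin \<phi>" "\<And>r x. x \<in> fil I b r \<Longrightarrow> \<phi> x \<in> fil J c (r + diag \<epsilon>)"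
    "\<And>r x. x \<in> fil I b r \<Longrightarrow> q (r + diag \<epsilon>) (\<phi> x) = f r (p r x)"
    using lift_interleaving_morphism[OF N fin p(1) q f] by blast
  obtain \<psi> where \<psi>: "lin \<psi>" "\<And>r x. x \<in> fil J c r \<Longrightarrow> \<psi> x \<in> fil I b (r + diag \<epsilon>)"
    "\<And>r x. x \<in> fil J c r \<Longrightarrow> p (r + diag \<epsilon>) (\<psi> x) = g r (q r x)"
    using lift_interleaving_morphism[OF M fin(2,1) q(1) p g] by blast
  have le: "r \<le> r + diag (2 * \<epsilon>)" for r :: "real ^ 'n" using \<open>\<epsilon> \<ge> 0\<close> by (simp add: less_eq_vec_def)
  have gf0: "f r 0 = 0" for r
    using linear_between_0[OF morphismD(1)[OF f] M.vector_space _ M.subspace] N.vector_space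
    by (simp add: shift_def)
  have fg0: "g r 0 = 0" for r
    using linear_between_0[OF morphismD(1)[OF g] N.vector_space _ N.subspace] M.vector_space
    by (simp add: shift_def)
  have 1: "x - \<psi> (\<phi> x) \<in> kernel_fam I b p (r + diag (2 * \<epsilon>))" if x: "x \<in> fil I b r" for x r
  proof -
    have x': "x \<in> fil I b (r + diag (2 * \<epsilon>))" using fil_mono[OF le] x by blast
    have y: "\<psi> (\<phi> x) \<in> fil I b (r + diag (2 * \<epsilon>))" using \<psi>(2)[OF \<phi>(2)[OF x]] by (simp add: add_diag_diag)
    have "p (r + diag (2 * \<epsilon>)) (\<psi> (\<phi> x)) = g (r + diag \<epsilon>) (f r (p r x))"
      using \<psi>(3)[OF \<phi>(2)[OF x]] \<phi>(3)[OF x] by (simp add: add_diag_diag)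
    also have "\<dots> = arr M r (r + diag (2 * \<epsilon>)) (p r x)"
      using linear_betweenD(1)[OF morphismD(1)[OF p(1)]] x by (intro gf) auto
    also have "\<dots> = p (r + diag (2 * \<epsilon>)) x" using morphismD(2)[OF p(1) le] x by simp
    finally have "p (r + diag (2 * \<epsilon>)) (x - \<psi> (\<phi> x)) = 0"
      using linear_between_diff[OF morphismD(1)[OF p(1)] _ _, of "r + diag (2 * \<epsilon>)" x "\<psi> (\<phi> x)", simplified,
          OF fv.vector_space_axioms subspace_fil x' y] by simp
    then show ?thesis using fv.subspace_diff[OF subspace_fil x' y] by (simp add: kernel_fam_def)
  qed
  have 2: "x - \<phi> (\<psi> x) \<in> kernel_fam J c q (r + diag (2 * \<epsilon>))" if x: "x \<in> fil J c r" for x r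
  proof -
    have x': "x \<in> fil J c (r + diag (2 * \<epsilon>))" using fil_mono[OF le] x by blast
    have y: "\<phi> (\<psi> x) \<in> fil J c (r + diag (2 * \<epsilon>))" using \<phi>(2)[OF \<psi>(2)[OF x]] by (simp add: add_diag_diag)
    have "q (r + diag (2 * \<epsilon>)) (\<phi> (\<psi> x)) = f (r + diag \<epsilon>) (g r (q r x))"
      using \<phi>(3)[OF \<psi>(2)[OF x]] \<psi>(3)[OF x] by (simp add: add_diag_diag)
    also have "\<dots> = arr N r (r + diag (2 * \<epsilon>)) (q r x)"
      using linear_betweenD(1)[OF morphismD(1)[OF q(1)]] x by (intro fg) auto
    also have "\<dots> = q (r + diag (2 * \<epsilon>)) x" using morphismD(2)[OF q(1) le] x by simp
    finally have "q (r + diag (2 * \<epsilon>)) (x - \<phi> (\<psi> x)) = 0"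
      using linear_between_diff[OF morphismD(1)[OF q(1)] _ _, of "r + diag (2 * \<epsilon>)" x "\<phi> (\<psi> x)", simplified,
          OF fv.vector_space_axioms subspace_fil x' y] by simp
    then show ?thesis using fv.subspace_diff[OF subspace_fil x' y] by (simp add: kernel_fam_def)
  qed
  show ?thesis
    unfolding presented_interleaving_def
    by (rule exI[of _ \<phi>], rule exI[of _ \<psi>])
      (use \<phi> \<psi> 1 2 gf0 fg0 in \<open>auto simp: kernel_fam_def\<close>)
qed

lemma interleaved_0_refl:
  assumes "persistence_module M"
  shows "interleaved 0 M M"
proof -
  interpret persistence_module M by fact
  have r: "r + diag 0 = r" for r :: "real ^ 'b" by (simp add: vec_eq_iff)
  show ?thesis
    unfolding interleaved_def
    by (rule exI[of _ "\<lambda>_ x. x"], rule exI[of _ "\<lambda>_ x. x"])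
      (use arr_id in \<open>auto simp: shift_def morphism_def linear_between_def r shift_hom_def shift_unit_def\<close>)
qed

section \<open>Minimal generating families\<close>

lemma card_copies: "card {x \<in> copies B. fst x = v} = count B v"
proof -
  have "{x \<in> copies B. fst x = v} = {v} \<times> {..<count B v}" by (auto simp: copies_def)
  then show ?thesis by (simp add: card_cartesian_product)
qed

lemma fst_copies: "fst ` copies B = set_mset B"
proof
  show "fst ` copies B \<subseteq> set_mset B" by (auto simp: copies_def) (metis count_inI less_zeroE)
  show "set_mset B \<subseteq> fst ` copies B"
  proof
    fix v assume "v \<in># B"
    then show "v \<in> fst ` copies B" by (intro image_eqI[of _ _ "(v, 0)"]) (auto simp: copies_def)
  qed
qed

lemma bij_betw_copies:
  assumes "finite I" and "\<And>v. count B v = card {i \<in> I. b i = v}"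
  shows "\<exists>\<sigma>. bij_betw \<sigma> (copies B) I \<and> (\<forall>x\<in>copies B. b (\<sigma> x) = fst x)"
proof -
  have "\<exists>h. bij_betw h {0..<count B v} {i \<in> I. b i = v}" for v
    unfolding assms(2) using assms(1) by (intro ex_bij_betw_nat_finite) auto
  then obtain h where h: "\<And>v. bij_betw (h v) {0..<count B v} {i \<in> I. b i = v}" by metis
  define \<sigma> where "\<sigma> = (\<lambda>(v, k). h v k)"
  have h_in: "h v k \<in> I" "b (h v k) = v" if "k < count B v" for v k
    using bij_betwE[OF h[of v]] that by auto
  have "inj_on \<sigma> (copies B)"
  proof (rule inj_onI)
    fix x y assume "x \<in> copies B" "y \<in> copies B" "\<sigma> x = \<sigma> y"
    then obtain v k w l where *: "x = (v, k)" "y = (w, l)" "k < count B v" "l < count B w" "h v k = h w l"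
      by (auto simp: copies_def \<sigma>_def)
    then have "v = w" using h_in by metis
    then show "x = y" using * inj_onD[OF bij_betw_imp_inj_on[OF h[of v]], of k l] by auto
  qed
  moreover have "\<sigma> ` copies B = I"
  proof
    show "\<sigma> ` copies B \<subseteq> I" using h_in by (auto simp: copies_def \<sigma>_def)
    show "I \<subseteq> \<sigma> ` copies B"
    proof
      fix i assume "i \<in> I"
      then have "i \<in> h (b i) ` {0..<count B (b i)}" using bij_betw_imp_surj_on[OF h] by auto
      then obtain k where "k < count B (b i)" "i = h (b i) k" by auto
      then show "i \<in> \<sigma> ` copies B" by (intro image_eqI[of _ _ "(b i, k)"]) (auto simp: copies_def \<sigma>_def)
    qed
  qed
  ultimately show ?thesis
    using h_in by (intro exI[of _ \<sigma>]) (auto simp: bij_betw_def \<sigma>_def copies_def)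
qed

text \<open>
  Families of generators are built over whatever index type is convenient; this turns them
  into the index sets \<open>copies B\<close> of \<open>free_module\<close>.
\<close>

lemma ex_multiset_reindex:
  assumes "finite I"
  shows "\<exists>B \<sigma>. bij_betw \<sigma> (copies B) I \<and> (\<forall>x\<in>copies B. b (\<sigma> x) = fst x) \<and> set_mset B = b ` I"
proof -
  have "count (image_mset b (mset_set I)) v = card {i \<in> I. b i = v}" for v
  proof -
    have "count (image_mset b (mset_set I)) v = (\<Sum>i\<in>b -` {v} \<inter> I. 1)"
      using assms by (simp add: count_image_mset)
    also have "b -` {v} \<inter> I = {i \<in> I. b i = v}" by auto
    finally show ?thesis by simp
  qed
  then show ?thesis
    using bij_betw_copies[OF assms, of "image_mset b (mset_set I)" b] assms
    by (intro exI[of _ "image_mset b (mset_set I)"]) auto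
qed

lemma free_extension_subset:
  fixes M :: "('k::field, 'n::finite, 'v::ab_group_add) pmodule"
  assumes "persistence_module M" "finite I" "J \<subseteq> I" "\<And>i. i \<notin> J \<Longrightarrow> x i = 0"
  shows "free_extension M J b g r x = free_extension M I b g r x"
proof -
  interpret persistence_module M by fact
  show ?thesis
    unfolding free_extension_def using assms by (intro sum.mono_neutral_left) auto
qed

text \<open>
  In a smallest generating subfamily no generator is redundant.  A relation with a nonzero
  coefficient at a generator born at the very grade of the relation would express that generator
  through the others.
\<close>

lemma minimal_generators:
  fixes M :: "('k::field, 'n::finite, 'v::ab_group_add) pmodule" and g :: "'i \<Rightarrow> 'v"
  assumes M: "persistence_module M" and fin: "finite I" and g: "\<And>i. i \<in> I \<Longrightarrow> g i \<in> obj M (b i)"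
    and surj: "surjective (filmod (fil I b)) M (free_extension M I b g)"
  shows "\<exists>J\<subseteq>I. surjective (filmod (fil J b)) M (free_extension M J b g) \<and>
    (\<forall>r x i. x \<in> kernel_fam J b (free_extension M J b g) r \<longrightarrow> x i \<noteq> 0 \<longrightarrow> b i \<noteq> r)"
proof -
  interpret persistence_module M by fact
  let ?gen = "\<lambda>J. J \<subseteq> I \<and> surjective (filmod (fil J b)) M (free_extension M J b g)"
  obtain J where J: "?gen J" and least: "\<And>J'. ?gen J' \<Longrightarrow> card J \<le> card J'"
    using ex_has_least_nat[of ?gen I card] surj by blast
  have finJ: "finite J" using J fin finite_subset by blast
  have mor: "morphism (filmod (fil J b)) M (free_extension M J b g)"
    using g J by (intro free_extension_morphism[OF finJ]) auto
  have "b i \<noteq> r" if x: "x \<in> kernel_fam J b (free_extension M J b g) r" and i: "x i \<noteq> 0" for r x i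
  proof
    assume bi: "b i = r"
    have xJ: "x \<in> fil J b r" "free_extension M J b g r x = 0" using x by (auto simp: kernel_fam_def)
    have iJ: "i \<in> J" using filD(1)[OF xJ(1) i] .
    have "m \<in> free_extension M (J - {i}) b g s ` fil (J - {i}) b s" if m: "m \<in> obj M s" for s m
    proof -
      obtain y where y: "y \<in> fil J b s" "free_extension M J b g s y = m"
        using J m unfolding surjective_def by (metis filmod_simps(2) imageE)
      \<comment> \<open>Subtract the multiple of the relation \<open>x\<close> that cancels the coefficient at \<open>i\<close>.\<close>
      define y' where "y' = y - smul (y i / x i) x"
      \<comment> \<open>If \<open>y\<close> uses generator \<open>i\<close> at all then \<open>r \<le> s\<close>, so that the relation also holds at \<open>s\<close>.\<close>
      have x0: "smul (y i / x i) x \<in> fil J b s \<and> free_extension M J b g s (smul (y i / x i) x) = 0"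
      proof (cases "y i = 0")
        case True
        then have z: "smul (y i / x i) x = 0" by (simp add: fun_eq_iff)
        have "free_extension M J b g s 0 = 0"
          by (rule linear_between_0[OF morphismD(1)[OF mor] _ vector_space])
            (simp_all add: fv.vector_space_axioms subspace_fil)
        then show ?thesis using fv.subspace_0[OF subspace_fil[of J b s]] by (simp only: z simp_thms)
      next
        case False
        then have le: "r \<le> s" using filD(2)[OF y(1)] bi by blast
        then have xs: "x \<in> fil J b s" using fil_mono xJ(1) by blast
        have "free_extension M J b g s x = arr M r s 0"
          using morphismD(2)[OF mor le, of x] xJ by simp
        also have "\<dots> = 0"
          using linear_between_0[OF linear[OF le] vector_space vector_space subspace] .
        finally show ?thesis
          using linear_betweenD(3)[OF morphismD(1)[OF mor, of s], of x] xs
            fv.subspace_scale[OF subspace_fil xs] by simp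
      qed
      have y': "y' \<in> fil J b s" unfolding y'_def using fv.subspace_diff[OF subspace_fil y(1)] x0 by blast
      have y'i: "y' i = 0" using i by (simp add: y'_def)
      have "free_extension M J b g s y' = m"
        using linear_between_diff[OF morphismD(1)[OF mor, of s], simplified,
            OF fv.vector_space_axioms subspace_fil y(1) conjunct1[OF x0]] x0 y(2) unfolding y'_def by simp
      moreover have "free_extension M (J - {i}) b g s y' = free_extension M J b g s y'"
        using y' y'i finJ by (intro free_extension_subset[OF M]) (auto simp: fil_iff)
      moreover have "y' \<in> fil (J - {i}) b s" using y' y'i by (auto simp: fil_iff)
      ultimately show ?thesis by (intro image_eqI[of _ _ y']) auto
    qed
    moreover have "morphism (filmod (fil (J - {i}) b)) M (free_extension M (J - {i}) b g)"
      using g J finJ by (intro free_extension_morphism) auto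
    then have "free_extension M (J - {i}) b g s ` fil (J - {i}) b s \<subseteq> obj M s" for s
      using linear_betweenD(1)[OF morphismD(1)] by fastforce
    ultimately have "?gen (J - {i})" using J unfolding surjective_def by (auto simp: image_subset_iff)
    from least[OF this] show False using iJ finJ card_Diff1_less[of J i] by linarith
  qed
  then show ?thesis using J by blast
qed

lemma free_extension_reindex:
  assumes "bij_betw \<sigma> J' J" "\<And>i. i \<in> J' \<Longrightarrow> b (\<sigma> i) = b' i" "\<And>i. i \<in> J' \<Longrightarrow> x i = y (\<sigma> i)"
  shows "free_extension M J' b' (\<lambda>i. g (\<sigma> i)) r x = free_extension M J b g r y"
proof -
  have "bij_betw \<sigma> {i \<in> J'. b' i \<le> r} {j \<in> J. b j \<le> r}"
    using assms(1,2) unfolding bij_betw_def inj_on_def by force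
  then have "free_extension M J b g r y = (\<Sum>i\<in>{i \<in> J'. b' i \<le> r}. scl M (y (\<sigma> i)) (arr M (b (\<sigma> i)) r (g (\<sigma> i))))"
    unfolding free_extension_def by (rule sum.reindex_bij_betw[symmetric])
  also have "\<dots> = free_extension M J' b' (\<lambda>i. g (\<sigma> i)) r x"
    unfolding free_extension_def using assms(2,3) by (intro sum.cong) auto
  finally show ?thesis by simp
qed

lemma minimal_cover:
  fixes M :: "('k::field, 'n::finite, 'v::ab_group_add) pmodule" and g :: "'i \<Rightarrow> 'v"
  assumes M: "persistence_module M" and fin: "finite I" and g: "\<And>i. i \<in> I \<Longrightarrow> g i \<in> obj M (b i)"
    and surj: "surjective (filmod (fil I b)) M (free_extension M I b g)"
  shows "\<exists>B e. morphism (free_module B) M e \<and> surjective (free_module B) M e \<and> set_mset B \<subseteq> b ` I \<and>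
    (\<forall>r x i. x \<in> kernel_fam (copies B) fst e r \<longrightarrow> x i \<noteq> 0 \<longrightarrow> fst i \<noteq> r)"
proof -
  interpret persistence_module M by fact
  obtain J where J: "J \<subseteq> I" "surjective (filmod (fil J b)) M (free_extension M J b g)"
    and rad: "\<And>r x i. x \<in> kernel_fam J b (free_extension M J b g) r \<Longrightarrow> x i \<noteq> 0 \<Longrightarrow> b i \<noteq> r"
    using minimal_generators[OF M fin g surj] by blast
  have finJ: "finite J" using J(1) fin finite_subset by blast
  obtain B \<sigma> where \<sigma>: "bij_betw \<sigma> (copies B) J" "\<And>x. x \<in> copies B \<Longrightarrow> b (\<sigma> x) = fst x"
    and B: "set_mset B = b ` J"
    using ex_multiset_reindex[OF finJ, of b] by blast
  let ?e = "free_extension M (copies B) fst (\<lambda>i. g (\<sigma> i))"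
  have \<sigma>J: "\<sigma> i \<in> J" if "i \<in> copies B" for i using \<sigma>(1) that by (auto simp: bij_betw_def)
  have mor: "morphism (filmod (fil (copies B) fst)) M ?e"
    by (rule free_extension_morphism) (use g J \<sigma>J \<sigma>(2) in fastforce)+
  have "\<exists>x\<in>fil (copies B) fst r. ?e r x = m" if m: "m \<in> obj M r" for r m
  proof -
    obtain y where y: "y \<in> fil J b r" "free_extension M J b g r y = m"
      using J m unfolding surjective_def by (metis filmod_simps(2) imageE)
    let ?x = "\<lambda>i. if i \<in> copies B then y (\<sigma> i) else 0"
    have "?x \<in> fil (copies B) fst r" using y(1) \<sigma>(2) by (auto simp: fil_iff split: if_splits)
    moreover have "?e r ?x = free_extension M J b g r y"
      by (rule free_extension_reindex[OF \<sigma>(1)]) (use \<sigma>(2) in auto)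
    then have "?e r ?x = m" using y(2) by simp
    ultimately show ?thesis by blast
  qed
  then have "surjective (free_module B) M ?e"
    using linear_betweenD(1)[OF morphismD(1)[OF mor]] unfolding surjective_def by (auto simp: image_iff)
  moreover have "fst i \<noteq> r" if x: "x \<in> kernel_fam (copies B) fst ?e r" and i: "x i \<noteq> 0" for r x i
  proof -
    have xB: "x \<in> fil (copies B) fst r" "?e r x = 0" using x by (auto simp: kernel_fam_def)
    define y where "y = (\<lambda>j. if j \<in> J then x (inv_into (copies B) \<sigma> j) else 0)"
    have y\<sigma>: "y (\<sigma> k) = x k" if "k \<in> copies B" for k
      using that \<sigma>J \<sigma>(1) by (simp add: y_def bij_betw_def)
    have "y \<in> fil J b r"
      unfolding fil_iff
    proof (intro allI impI)
      fix j assume j: "y j \<noteq> 0"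
      then have "j \<in> J" by (auto simp: y_def split: if_splits)
      then obtain k where k: "k \<in> copies B" "j = \<sigma> k" using \<sigma>(1) by (auto simp: bij_betw_def)
      then show "j \<in> J \<and> b j \<le> r" using \<open>j \<in> J\<close> j y\<sigma> \<sigma>(2) filD(2)[OF xB(1), of k] by auto
    qed
    moreover have "?e r x = free_extension M J b g r y"
      by (rule free_extension_reindex[OF \<sigma>(1)]) (use \<sigma>(2) y\<sigma> in auto)
    then have "free_extension M J b g r y = 0" using xB(2) by simp
    ultimately have "y \<in> kernel_fam J b (free_extension M J b g) r" by (simp add: kernel_fam_def)
    moreover have iB: "i \<in> copies B" using filD(1)[OF xB(1) i] .
    ultimately show ?thesis using rad[of y r "\<sigma> i"] y\<sigma>[OF iB] i \<sigma>(2)[OF iB] by simp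
  qed
  ultimately show ?thesis
    using mor B J(1) by (intro exI[of _ B] exI[of _ ?e]) (auto simp: morphism_free_module_iff)
qed

text \<open>
  For a monotone family: each nonzero value is reached already at one of finitely many grades.
  This is the finiteness that makes syzygies finitely generated.
\<close>

definition tame :: "(real ^ 'n::finite \<Rightarrow> ('i \<Rightarrow> 'k::field) set) \<Rightarrow> bool" where
  "tame Z \<longleftrightarrow> (\<exists>G. finite G \<and> (\<forall>r. Z r \<subseteq> {0} \<or> (\<exists>s\<in>G. s \<le> r \<and> Z r \<subseteq> Z s)))"

text \<open>
  If \<open>Z\<close> at \<open>r\<close> depends only on which grades of \<open>D\<close> lie below \<open>r\<close>, then \<open>r\<close> may be replaced by
  the join of these grades.
\<close>

lemma tameI:
  fixes Z :: "real ^ 'n::finite \<Rightarrow> ('i \<Rightarrow> 'k::field) set"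
  assumes "finite D"
    and "\<And>s r. s \<le> r \<Longrightarrow> (\<And>a. a \<in> D \<Longrightarrow> a \<le> r \<Longrightarrow> a \<le> s) \<Longrightarrow> Z r \<subseteq> Z s"
    and "\<And>r. (\<And>a. a \<in> D \<Longrightarrow> \<not> a \<le> r) \<Longrightarrow> Z r \<subseteq> {0}"
  shows "tame Z"
proof -
  define join :: "(real ^ 'n) set \<Rightarrow> real ^ 'n" where "join = (\<lambda>S. \<chi> k. Max ((\<lambda>a. a $ k) ` S))"
  have "Z r \<subseteq> {0} \<or> (\<exists>s\<in>join ` Pow D. s \<le> r \<and> Z r \<subseteq> Z s)" for r
  proof (cases "\<exists>a\<in>D. a \<le> r")
    case True
    let ?S = "{a \<in> D. a \<le> r}"
    have S: "finite ?S" "?S \<noteq> {}" using True assms(1) by auto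
    have le: "join ?S \<le> r"
      unfolding join_def less_eq_vec_def using S by (auto simp: less_eq_vec_def)
    moreover have "a \<le> join ?S" if "a \<in> D" "a \<le> r" for a
      unfolding join_def using S that by (subst less_eq_vec_def) auto
    ultimately have "Z r \<subseteq> Z (join ?S)" by (intro assms(2)) auto
    moreover have "join ?S \<in> join ` Pow D" by blast
    ultimately show ?thesis using le by blast
  qed (use assms(3) in blast)
  then show ?thesis unfolding tame_def using assms(1) by (intro exI[of _ "join ` Pow D"]) auto
qed

lemma tame_kernel:
  fixes b :: "'i \<Rightarrow> real ^ 'n::finite"
  assumes "finite I"
  shows "tame (\<lambda>r. {x \<in> fil I b r. f x = (0 :: 'v::zero)})"
proof (rule tameI[of "b ` I"])
  show "{x \<in> fil I b r. f x = 0} \<subseteq> {x \<in> fil I b s. f x = 0}"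
    if "\<And>a. a \<in> b ` I \<Longrightarrow> a \<le> r \<Longrightarrow> a \<le> s" for s r
    using that unfolding fil_def by blast
  show "{x \<in> fil I b r. f x = 0} \<subseteq> {0}" if "\<And>a. a \<in> b ` I \<Longrightarrow> \<not> a \<le> r" for r
    using that unfolding fil_def by (auto simp: fun_eq_iff) (metis imageI)
qed (use assms in auto)

text \<open>
  Bases of \<open>K\<close> at the finitely many relevant grades generate \<open>K\<close>, and \<open>minimal_cover\<close> thins them out.
\<close>

lemma minimal_cover_tame:
  fixes K :: "real ^ 'n::finite \<Rightarrow> ('i \<Rightarrow> 'k::field) set"
  assumes fin: "finite I" and sub: "\<And>r. fv.subspace (K r)" "\<And>r. K r \<subseteq> fil I b r"
    and mono: "\<And>r s. r \<le> s \<Longrightarrow> K r \<subseteq> K s" and tame: "tame K"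
  shows "\<exists>B d. lin d \<and> (\<forall>r. d ` fil (copies B) fst r = K r) \<and>
    (\<forall>r x i. x \<in> fil (copies B) fst r \<longrightarrow> d x = 0 \<longrightarrow> x i \<noteq> 0 \<longrightarrow> fst i \<noteq> r)"
proof -
  have K: "persistence_module (filmod K)" by (rule persistence_module_filmod[OF fin sub mono])
  interpret persistence_module "filmod K" by (rule K)
  obtain G where "finite G \<and> (\<forall>r. K r \<subseteq> {0} \<or> (\<exists>s\<in>G. s \<le> r \<and> K r \<subseteq> K s))"
    using tame unfolding tame_def ..
  then have G: "finite G" "\<And>r. K r \<subseteq> {0} \<or> (\<exists>s\<in>G. s \<le> r \<and> K r \<subseteq> K s)" by simp_all
  have "\<exists>S. finite S \<and> S \<subseteq> K s \<and> fv.span S = K s" for s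
    by (rule finite_spanning_set[OF fin sub(1,2)])
  then obtain S where S: "\<And>s. finite (S s)" "\<And>s. S s \<subseteq> K s" "\<And>s. fv.span (S s) = K s" by metis
  define J where "J = (SIGMA s:G. S s)"
  have finJ: "finite J" using G S(1) by (auto simp: J_def)
  have gen: "snd i \<in> obj (filmod K) (fst i)" if "i \<in> J" for i using that subsetD[OF S(2)] by (auto simp: J_def)
  let ?e = "free_extension (filmod K) J fst snd"
  have mor: "morphism (filmod (fil J fst)) (filmod K) ?e" by (rule free_extension_morphism[OF finJ gen])
  have "z \<in> ?e r ` fil J fst r" if z: "z \<in> K r" for z r
  proof (cases "z = 0")
    case True
    have "?e r 0 = 0" by (simp add: free_extension_def fun_eq_iff sum_fun_apply)
    then show ?thesis using True fv.subspace_0[OF subspace_fil[of J fst r]] by (metis image_eqI)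
  next
    case False
    then obtain s where s: "s \<in> G" "s \<le> r" "z \<in> K s" using G(2)[of r] z by blast
    then have "z \<in> fv.span (S s)" using S(3) by simp
    then obtain u where u: "z = (\<Sum>v\<in>S s. smul (u v) v)" unfolding fv.span_finite[OF S(1)] by blast
    define x where "x = (\<lambda>(t, v). if t = s \<and> v \<in> S s then u v else 0)"
    have x: "x \<in> fil J fst r" using s by (auto simp: fil_iff x_def J_def split: if_splits)
    have "?e r x = (\<Sum>i\<in>Pair s ` S s. smul (x i) (snd i))"
      unfolding free_extension_def using s finJ
      by (simp, intro sum.mono_neutral_right) (auto simp: J_def x_def split: if_splits)
    also have "\<dots> = z" unfolding u by (subst sum.reindex) (auto simp: x_def inj_on_def intro!: sum.cong)
    finally show ?thesis using x by (metis image_eqI)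
  qed
  then have "surjective (filmod (fil J fst)) (filmod K) ?e"
    using linear_betweenD(1)[OF morphismD(1)[OF mor]] unfolding surjective_def by auto
  then have "\<exists>B e. morphism (free_module B) (filmod K) e \<and> surjective (free_module B) (filmod K) e \<and>
      set_mset B \<subseteq> fst ` J \<and> (\<forall>r x i. x \<in> kernel_fam (copies B) fst e r \<longrightarrow> x i \<noteq> 0 \<longrightarrow> fst i \<noteq> r)"
    by (intro minimal_cover[OF K finJ]) (use gen in auto)
  then obtain B e where e: "morphism (free_module B) (filmod K) e" "surjective (free_module B) (filmod K) e"
    and rad: "\<forall>r x i. x \<in> kernel_fam (copies B) fst e r \<longrightarrow> x i \<noteq> 0 \<longrightarrow> fst i \<noteq> r"
    by - (elim exE conjE, rule that, assumption+)
  obtain d where d: "lin d" "\<And>r x. x \<in> fil (copies B) fst r \<Longrightarrow> d x = e r x"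
    using morphism_globalise[OF K _ _ finite_copies e(1)[unfolded morphism_free_module_iff]] by auto
  have "d ` fil (copies B) fst r = e r ` fil (copies B) fst r" for r
    using d(2) by (intro image_cong) auto
  then have "\<forall>r. d ` fil (copies B) fst r = K r" using e(2) unfolding surjective_def by simp
  moreover have "fst i \<noteq> r" if "x \<in> fil (copies B) fst r" "d x = 0" "x i \<noteq> 0" for r x i
  proof -
    have "x \<in> kernel_fam (copies B) fst e r" using that d(2) by (simp add: kernel_fam_def)
    then show ?thesis using rad that(3) by blast
  qed
  ultimately show ?thesis
    using d(1) by - (rule exI[of _ B], rule exI[of _ d], simp del: split_paired_All)
qed

section \<open>Finitely presentable modules, projective modules and barcodes\<close>

text \<open>
  The grades at which elements of \<open>M\<close> can die: an element that dies between \<open>s\<close> and \<open>r\<close> needs a grade of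
  \<open>D\<close> that lies below \<open>r\<close> but not below \<open>s\<close>.
\<close>

definition critical_grades :: "('k::field, 'n::finite, 'v::ab_group_add) pmodule \<Rightarrow> (real ^ 'n) set \<Rightarrow> bool" where
  "critical_grades M D \<longleftrightarrow> finite D \<and>
     (\<forall>s r. s \<le> r \<longrightarrow> (\<forall>a\<in>D. a \<le> r \<longrightarrow> a \<le> s) \<longrightarrow> (\<forall>m\<in>obj M s. arr M s r m = 0 \<longrightarrow> m = 0))"

text \<open>
  \<open>D\<close> consists of the grades of all generators and relations of a presentation: an
  element becomes zero only when a new relation is born.
\<close>

lemma finitely_presentable_cover:
  fixes M :: "('k::field, 'n::finite, 'v::ab_group_add) pmodule"
  assumes "finitely_presentable M"
  shows "\<exists>C D p. critical_grades M D \<and> set_mset C \<subseteq> D \<and>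
    morphism (free_module C) M p \<and> surjective (free_module C) M p"
proof -
  obtain B C f p where fp: "persistence_module M" "morphism (free_module B) (free_module C) f"
    "morphism (free_module C) M p" "exact_at (free_module B) f (free_module C) p"
    "surjective (free_module C) M p"
    using assms unfolding finitely_presentable_def by metis
  interpret persistence_module M by fact
  define D where "D = set_mset B \<union> set_mset C"
  have same: "fil (copies A) fst r \<subseteq> (fil (copies A) fst s :: (_ \<Rightarrow> 'k) set)"
    if "\<forall>a\<in>D. a \<le> r \<longrightarrow> a \<le> s" "set_mset A \<subseteq> D" for A s r
    using that fst_copies[of A] unfolding fil_def by blast
  have "m = 0" if le: "s \<le> r" and D: "\<forall>a\<in>D. a \<le> r \<longrightarrow> a \<le> s" and m: "m \<in> obj M s" "arr M s r m = 0" for s r m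
  proof -
    obtain x where x: "x \<in> fil (copies C) fst s" "p s x = m"
      using fp(5) m(1) unfolding surjective_def by (metis free_module_obj imageE)
    have xr: "x \<in> fil (copies C) fst r" using fil_mono[OF le] x(1) by blast
    have "p r x = 0"
      using morphismD(2)[OF fp(3) le, of x] x m(2) free_module_arr[OF x(1)] by simp
    then obtain y where y: "y \<in> fil (copies B) fst r" "x = f r y"
      using fp(4) xr unfolding exact_at_def by (metis (mono_tags, lifting) free_module_obj imageE mem_Collect_eq)
    have ys: "y \<in> fil (copies B) fst s" using same[OF D, of B] y(1) unfolding D_def by blast
    have "f s y \<in> fil (copies C) fst s" using linear_betweenD(1)[OF morphismD(1)[OF fp(2)], of y s] ys by simp
    then have "f r y = f s y"
      using morphismD(2)[OF fp(2) le, of y] ys free_module_arr[OF ys] free_module_arr by simp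
    then have "x \<in> f s ` obj (free_module B) s" using y(2) ys by simp
    then have "p s x = 0" using fp(4) unfolding exact_at_def by blast
    then show ?thesis using x(2) by simp
  qed
  then have "critical_grades M D" unfolding critical_grades_def D_def by blast
  then show ?thesis using fp unfolding D_def by blast
qed

lemma tame_kernel_fam:
  fixes M :: "('k::field, 'n::finite, 'v::ab_group_add) pmodule"
  assumes D: "critical_grades M D" and e: "morphism (filmod (fil I b)) M e" and b: "b ` I \<subseteq> D"
  shows "tame (kernel_fam I b e)"
proof (rule tameI[of D])
  show "finite D" using D by (simp add: critical_grades_def)
  show "kernel_fam I b e r \<subseteq> kernel_fam I b e s" if le: "s \<le> r" and D': "\<And>a. a \<in> D \<Longrightarrow> a \<le> r \<Longrightarrow> a \<le> s" for s r
  proof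
    fix x assume x: "x \<in> kernel_fam I b e r"
    then have xs: "x \<in> fil I b s" using D' b unfolding kernel_fam_def fil_def by blast
    have "arr M s r (e s x) = 0"
      using morphismD(2)[OF e le, of x] xs x by (simp add: kernel_fam_def)
    moreover have "e s x \<in> obj M s" using linear_betweenD(1)[OF morphismD(1)[OF e], of x s] xs by simp
    ultimately have "e s x = 0" using D le D' unfolding critical_grades_def by blast
    then show "x \<in> kernel_fam I b e s" using xs by (simp add: kernel_fam_def)
  qed
  show "kernel_fam I b e r \<subseteq> {0}" if "\<And>a. a \<in> D \<Longrightarrow> \<not> a \<le> r" for r
    using that b unfolding kernel_fam_def fil_def by (fastforce simp: fun_eq_iff)
qed

lemma subspace_kernel_fam:
  assumes "persistence_module M" "morphism (filmod (fil I b)) M e"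
  shows "fv.subspace (kernel_fam I b e r)"
proof -
  interpret persistence_module M by fact
  note l = morphismD(1)[OF assms(2), of r, simplified]
  show ?thesis
    unfolding kernel_fam_def
    using linear_between_0[OF l fv.vector_space_axioms vector_space subspace_fil]
      linear_betweenD(2,3)[OF l] fv.subspace_0[OF subspace_fil] fv.subspace_add[OF subspace_fil]
      fv.subspace_scale[OF subspace_fil]
    by (intro fv.subspaceI) auto
qed

lemma kernel_fam_mono:
  assumes "persistence_module M" "morphism (filmod (fil I b)) M e" "r \<le> s"
  shows "kernel_fam I b e r \<subseteq> kernel_fam I b e s"
proof
  interpret persistence_module M by fact
  fix x assume x: "x \<in> kernel_fam I b e r"
  then have "e s x = arr M r s 0"
    using morphismD(2)[OF assms(2,3), of x] by (simp add: kernel_fam_def)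
  also have "\<dots> = 0" using linear_between_0[OF linear[OF assms(3)] vector_space vector_space subspace] .
  finally show "x \<in> kernel_fam I b e s"
    using x fil_mono[OF assms(3), of I b] by (auto simp: kernel_fam_def)
qed

lemma minimal_cover_finitely_presentable:
  fixes M :: "('k::field, 'n::finite, 'v::ab_group_add) pmodule"
  assumes "finitely_presentable M"
  shows "\<exists>B e. morphism (free_module B) M e \<and> surjective (free_module B) M e \<and>
    tame (kernel_fam (copies B) fst e) \<and>
    (\<forall>r x i. x \<in> kernel_fam (copies B) fst e r \<longrightarrow> x i \<noteq> 0 \<longrightarrow> fst i \<noteq> r)"
proof -
  have M: "persistence_module M" using assms by (simp add: finitely_presentable_def)
  interpret persistence_module M by (rule M)
  obtain C D p where D: "critical_grades M D" "set_mset C \<subseteq> D"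
    and p: "morphism (filmod (fil (copies C) fst)) M p" "surjective (free_module C) M p"
    using finitely_presentable_cover[OF assms] unfolding morphism_free_module_iff by blast
  let ?g = "\<lambda>i. p (fst i) (unit_vec i)"
  have g: "?g i \<in> obj M (fst i)" if "i \<in> copies C" for i
    using linear_betweenD(1)[OF morphismD(1)[OF p(1), of "fst i"], of "unit_vec i"]
    by (simp add: unit_vec_fil that)
  have "p r ` fil (copies C) fst r = free_extension M (copies C) fst ?g r ` fil (copies C) fst r" for r
    by (intro image_cong morphism_eq_free_extension[OF finite_copies p(1)]) auto
  then have surj: "surjective (filmod (fil (copies C) fst)) M (free_extension M (copies C) fst ?g)"
    using p(2) unfolding surjective_def by simp
  have "\<exists>B e. morphism (free_module B) M e \<and> surjective (free_module B) M e \<and> set_mset B \<subseteq> fst ` copies C \<and>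
    (\<forall>r x i. x \<in> kernel_fam (copies B) fst e r \<longrightarrow> x i \<noteq> 0 \<longrightarrow> fst i \<noteq> r)"
    by (rule minimal_cover[OF M finite_copies g surj])
  then obtain B e where *: "morphism (free_module B) M e \<and> surjective (free_module B) M e \<and> set_mset B \<subseteq> fst ` copies C \<and>
    (\<forall>r x i. x \<in> kernel_fam (copies B) fst e r \<longrightarrow> x i \<noteq> 0 \<longrightarrow> fst i \<noteq> r)"
    by (elim exE)
  moreover have "tame (kernel_fam (copies B) fst e)"
    by (rule tame_kernel_fam[OF D(1)]) (use * D(2) in \<open>auto simp: morphism_free_module_iff fst_copies\<close>)
  ultimately show ?thesis by (intro exI[of _ B] exI[of _ e]) simp
qed

text \<open>
  Such a map sends each generator to a combination of generators of strictly smaller grade, so it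
  cannot reproduce the coefficients of \<open>x\<close> at a maximal grade of the support of \<open>x\<close>.
\<close>

lemma fixed_by_radical_endomorphism_eq_0:
  fixes b :: "'i \<Rightarrow> real ^ 'n::finite" and f :: "('i \<Rightarrow> 'k::field) \<Rightarrow> ('i \<Rightarrow> 'k)"
  assumes fin: "finite I" and f: "lin f" "\<And>r x. x \<in> fil I b r \<Longrightarrow> f x \<in> fil I b r"
    and rad: "\<And>r x i. x \<in> fil I b r \<Longrightarrow> f x i \<noteq> 0 \<Longrightarrow> b i \<noteq> r"
    and x: "x \<in> fil I b r" "f x = x"
  shows "x = 0"
proof (rule ccontr)
  assume "x \<noteq> 0"
  then obtain i0 where "x i0 \<noteq> 0" by (auto simp: fun_eq_iff)
  define S where "S = {i \<in> I. x i \<noteq> 0}"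
  have S: "finite (b ` S)" "b ` S \<noteq> {}" using fin \<open>x i0 \<noteq> 0\<close> filD(1)[OF x(1)] unfolding S_def by auto
  obtain v where "v \<in> b ` S" and max: "\<And>w. w \<in> b ` S \<Longrightarrow> v \<le> w \<Longrightarrow> v = w"
    using finite_has_maximal[OF S] by blast
  then obtain i where i: "i \<in> I" "x i \<noteq> 0" "v = b i" unfolding S_def by blast
  have "x i = (\<Sum>j\<in>I. x j * f (unit_vec j) i)"
    using lin_eq_lincomb[OF fin x(1) f(1)] x(2) by (metis lincomb_apply)
  then obtain j where j: "j \<in> I" "x j \<noteq> 0" "f (unit_vec j) i \<noteq> 0"
    using i(2) by (metis (no_types, lifting) mult_zero_left mult_zero_right sum.neutral)
  have u: "(unit_vec j :: 'i \<Rightarrow> 'k) \<in> fil I b (b j)" using j(1) by (rule unit_vec_fil) simp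
  have "b i \<le> b j" using filD(2)[OF f(2)[OF u] j(3)] .
  moreover have "b i \<noteq> b j" using rad[OF u j(3)] .
  ultimately show False using max[of "b j"] j i unfolding S_def by auto
qed

text \<open>
  A minimal cover \<open>e\<close> of \<open>P\<close> splits.  The projection \<open>f\<close> onto its kernel is idempotent, and by
  minimality its image lies in the radical, so \<open>f = 0\<close> and \<open>e\<close> is injective.
\<close>

lemma projective_isomorphic_free:
  fixes P :: "('k::field, 'n::finite) concrete_pmodule"
  assumes fp: "finitely_presentable P" and pr: "projective P"
  shows "\<exists>B. isomorphic P (free_module B)"
proof -
  have P: "persistence_module P" using fp by (simp add: finitely_presentable_def)
  interpret persistence_module P by (rule P)
  obtain B e where e: "morphism (free_module B) P e" "surjective (free_module B) P e"
    and rad: "\<forall>r x i. x \<in> kernel_fam (copies B) fst e r \<longrightarrow> x i \<noteq> 0 \<longrightarrow> fst i \<noteq> r"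
    using minimal_cover_finitely_presentable[OF fp] by - (elim exE conjE, rule that, assumption+)
  have "morphism P P (\<lambda>r x. x)" by (auto simp: morphism_def linear_between_def)
  moreover have "\<forall>(A :: ('k, 'n) concrete_pmodule) (B :: ('k, 'n) concrete_pmodule) g h. persistence_module A \<and> persistence_module B \<and> morphism A B g \<and> surjective A B g \<and>
      morphism P B h \<longrightarrow> (\<exists>l. morphism P A l \<and> (\<forall>r. \<forall>x\<in>obj P r. g r (l r x) = h r x))"
    using pr unfolding projective_def by (rule conjunct2)
  from this[rule_format, of "free_module B" P e "\<lambda>r x. x"]
  have "morphism P P (\<lambda>r x. x) \<Longrightarrow> \<exists>l. morphism P (free_module B) l \<and> (\<forall>r. \<forall>x\<in>obj P r. e r (l r x) = x)"
    using e P by (simp add: persistence_module_free)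
  ultimately obtain l where l: "morphism P (free_module B) l" "\<And>r x. x \<in> obj P r \<Longrightarrow> e r (l r x) = x"
    by blast
  define u where "u = (\<lambda>r x. l r (e r x))"
  have "morphism (filmod (fil (copies B) fst)) (free_module B) u"
    unfolding u_def using morphism_comp[OF e(1) l(1)] morphism_free_module_iff by blast
  then obtain t where t: "lin t" "\<And>r x. x \<in> fil (copies B) fst r \<Longrightarrow> t x = u r x"
    using morphism_globalise[OF persistence_module_free _ _ finite_copies, of B B fst u]
    by (auto simp: free_module_arr)
  have eP: "e r x \<in> obj P r" if "x \<in> fil (copies B) fst r" for r x
    using linear_betweenD(1)[OF morphismD(1)[OF e(1)], of x r] that by simp
  have lF: "l r x \<in> fil (copies B) fst r" if "x \<in> obj P r" for r x
    using linear_betweenD(1)[OF morphismD(1)[OF l(1)] that] by simp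
  \<comment> \<open>\<open>t\<close> is the idempotent \<open>l \<circ> e\<close>, so \<open>f\<close> projects onto the kernel of \<open>e\<close>.\<close>
  define f where "f = (\<lambda>x. x - t x)"
  have linf: "lin f" unfolding f_def by (intro lin_minus lin_id t)
  have t_in: "t x \<in> fil (copies B) fst r" "e r (t x) = e r x" if "x \<in> fil (copies B) fst r" for r x
    using t(2)[OF that] lF[OF eP[OF that]] l(2)[OF eP[OF that]] by (simp_all add: u_def)
  have f_ker: "f x \<in> kernel_fam (copies B) fst e r" if x: "x \<in> fil (copies B) fst r" for r x
    using linear_between_diff[OF morphismD(1)[OF e(1)] _ _, of r x "t x", simplified,
        OF fv.vector_space_axioms subspace_fil x t_in(1)[OF x]] t_in[OF x]
      fv.subspace_diff[OF subspace_fil x t_in(1)[OF x]]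
    unfolding f_def kernel_fam_def by simp
  have inj: "x = 0" if x: "x \<in> fil (copies B) fst r" "e r x = 0" for r x
  proof (rule fixed_by_radical_endomorphism_eq_0[OF finite_copies linf _ _ x(1)])
    show "f x \<in> fil (copies B) fst r" if "x \<in> fil (copies B) fst r" for r x
      using f_ker[OF that] by (simp add: kernel_fam_def)
    show "fst i \<noteq> r" if "x \<in> fil (copies B) fst r" "f x i \<noteq> 0" for r x i
      using rad f_ker[OF that(1)] that(2) by blast
    have "l r 0 = 0"
      using linear_between_0[OF morphismD(1)[OF l(1), of r] vector_space _ subspace] fv.vector_space_axioms by simp
    then show "f x = x" using t(2)[OF x(1)] x(2) unfolding f_def u_def by simp
  qed
  have "l r (e r x) = x" if x: "x \<in> fil (copies B) fst r" for r x
  proof -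
    have "f x \<in> kernel_fam (copies B) fst e r" by (rule f_ker[OF x])
    then have "f x = 0" using inj[of "f x" r] by (simp add: kernel_fam_def)
    then show ?thesis using t(2)[OF x] unfolding f_def u_def by simp
  qed
  then have "isomorphic P (free_module B)"
    unfolding isomorphic_def by (intro exI[of _ l] exI[of _ e]) (use l e in auto)
  then show ?thesis by blast
qed

lemma isomorphic_refl: "isomorphic M M"
  unfolding isomorphic_def
  by (intro exI[of _ "\<lambda>_ x. x"]) (auto simp: morphism_def linear_between_def)

text \<open>
  An isomorphism is a \<open>0\<close>-interleaving of free modules, for which the multiplicities of grades can be compared
  in both directions.
\<close>

lemma isomorphic_free_unique:
  assumes P: "isomorphic P (free_module B)" "isomorphic P (free_module C)"
  shows "B = C"
proof -
  have le: "count B v \<le> count C v" if iso: "isomorphic P (free_module B)" "isomorphic P (free_module C)" for B C v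
  proof -
    let ?B = "free_module B :: ('a, 'b, _) pmodule" and ?C = "free_module C :: ('a, 'b, _) pmodule"
    obtain f g where f: "morphism P ?B f" and g: "morphism ?B P g"
      and fg: "\<And>r x. x \<in> obj P r \<Longrightarrow> g r (f r x) = x" "\<And>r x. x \<in> obj ?B r \<Longrightarrow> f r (g r x) = x"
      using iso(1) unfolding isomorphic_def by blast
    obtain f' g' where f': "morphism P ?C f'" and g': "morphism ?C P g'"
      and fg': "\<And>r x. x \<in> obj P r \<Longrightarrow> g' r (f' r x) = x" "\<And>r x. x \<in> obj ?C r \<Longrightarrow> f' r (g' r x) = x"
      using iso(2) unfolding isomorphic_def by blast
    let ?u = "\<lambda>r x. f' r (g r x)" and ?v = "\<lambda>r x. f r (g' r x)"
    have u: "morphism ?B ?C ?u" and v: "morphism ?C ?B ?v"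
      using morphism_comp[OF g f'] morphism_comp[OF g' f] .
    obtain \<phi> where \<phi>: "lin \<phi>" "\<And>r x. x \<in> fil (copies B) fst r \<Longrightarrow> \<phi> x = ?u r x"
      using morphism_globalise[OF persistence_module_free _ _ finite_copies u[unfolded morphism_free_module_iff]]
      by (auto simp: free_module_arr)
    obtain \<psi> where \<psi>: "lin \<psi>" "\<And>r x. x \<in> fil (copies C) fst r \<Longrightarrow> \<psi> x = ?v r x"
      using morphism_globalise[OF persistence_module_free _ _ finite_copies v[unfolded morphism_free_module_iff]]
      by (auto simp: free_module_arr)
    have gP: "g r x \<in> obj P r" if "x \<in> fil (copies B) fst r" for r x
      using linear_betweenD(1)[OF morphismD(1)[OF g], of x r] that by simp
    have gP': "g' r x \<in> obj P r" if "x \<in> fil (copies C) fst r" for r x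
      using linear_betweenD(1)[OF morphismD(1)[OF g'], of x r] that by simp
    have fP: "f r x \<in> fil (copies B) fst r" "f' r x \<in> fil (copies C) fst r" if "x \<in> obj P r" for r x
      using linear_betweenD(1)[OF morphismD(1)[OF f] that] linear_betweenD(1)[OF morphismD(1)[OF f'] that] by simp_all
    have \<psi>\<phi>: "\<phi> x \<in> fil (copies C) fst r \<and> \<psi> (\<phi> x) = x" if x: "x \<in> fil (copies B) fst r" for r x
      using \<phi>(2)[OF x] \<psi>(2)[of "\<phi> x" r] fP(2)[OF gP[OF x]] fg'(1)[OF gP[OF x]] fg(2)[of x r] x by simp
    have \<phi>\<psi>: "\<psi> x \<in> fil (copies B) fst r \<and> \<phi> (\<psi> x) = x" if x: "x \<in> fil (copies C) fst r" for r x
      using \<psi>(2)[OF x] \<phi>(2)[of "\<psi> x" r] fP(1)[OF gP'[OF x]] fg(1)[OF gP'[OF x]] fg'(2)[of x r] x by simp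
    have r0: "s + diag (2 * 0) = s" "s + diag 0 = s" for s :: "real ^ 'b" by (simp_all add: vec_eq_iff)
    have "presented_interleaving 0 (copies B) fst (\<lambda>_. {0 :: _ \<Rightarrow> 'a}) (copies C) fst (\<lambda>_. {0 :: _ \<Rightarrow> 'a})"
      unfolding presented_interleaving_def r0
      by (rule exI[of _ \<phi>], rule exI[of _ \<psi>])
        (use \<phi>(1) \<psi>(1) \<phi>\<psi> \<psi>\<phi> lin_0[OF \<phi>(1)] lin_0[OF \<psi>(1)] in simp)
    from multiplicity_le[OF finite_copies finite_copies this, of v]
    show ?thesis by (simp add: card_copies)
  qed
  show ?thesis using le[OF P] le[OF P(2,1)] by (intro multiset_eqI) (simp add: le_antisym)
qed

lemma barcode_eq: "isomorphic P (free_module B) \<Longrightarrow> barcode P = B"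
  unfolding barcode_def by (rule the_equality) (auto dest: isomorphic_free_unique)

lemma barcode_free: "barcode (free_module B) = B"
  by (rule barcode_eq[OF isomorphic_refl])

section \<open>Free resolutions\<close>

text \<open>
  The kernel at stage \<open>k\<close>.  Stage \<open>0\<close> is separate because the augmentation \<open>e\<close> has its own
  codomain and depends on the grade.
\<close>

fun syzygy :: "(nat \<Rightarrow> (real ^ 'n::finite) multiset) \<Rightarrow>
    (nat \<Rightarrow> ((real ^ 'n) \<times> nat \<Rightarrow> 'k::field) \<Rightarrow> ((real ^ 'n) \<times> nat \<Rightarrow> 'k)) \<Rightarrow>
    (real ^ 'n \<Rightarrow> ((real ^ 'n) \<times> nat \<Rightarrow> 'k) \<Rightarrow> 'v::zero) \<Rightarrow> nat \<Rightarrow> real ^ 'n \<Rightarrow> ((real ^ 'n) \<times> nat \<Rightarrow> 'k) set" where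
  "syzygy B d e 0 = kernel_fam (copies (B 0)) fst e"
| "syzygy B d e (Suc k) = (\<lambda>r. {x \<in> fil (copies (B (Suc k))) fst r. d k x = 0})"

definition free_resolution :: "('k::field, 'n::finite, 'v::ab_group_add) pmodule \<Rightarrow>
    (nat \<Rightarrow> (real ^ 'n) multiset) \<Rightarrow> (nat \<Rightarrow> ((real ^ 'n) \<times> nat \<Rightarrow> 'k) \<Rightarrow> ((real ^ 'n) \<times> nat \<Rightarrow> 'k)) \<Rightarrow>
    (real ^ 'n \<Rightarrow> ((real ^ 'n) \<times> nat \<Rightarrow> 'k) \<Rightarrow> 'v) \<Rightarrow> bool" where
  "free_resolution M B d e \<longleftrightarrow>
     morphism (free_module (B 0)) M e \<and> surjective (free_module (B 0)) M e \<and>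
     (\<forall>k. lin (d k)) \<and> (\<forall>k r. d k ` fil (copies (B (Suc k))) fst r = syzygy B d e k r)"

text \<open>
  No element has a coefficient at a generator born at the grade of the element, that is, the family lies
  in the radical of the free module.  This is minimality of the cover with this kernel.
\<close>

definition radical_family :: "(real ^ 'n \<Rightarrow> ((real ^ 'n) \<times> nat \<Rightarrow> 'k::zero) set) \<Rightarrow> bool" where
  "radical_family Z \<longleftrightarrow> (\<forall>r. \<forall>x\<in>Z r. \<forall>i. x i \<noteq> 0 \<longrightarrow> fst i \<noteq> r)"

text \<open>
  The closure properties that allow the family to be covered by a free module again.
\<close>

definition syzygy_family :: "(real ^ 'n::finite) multiset \<Rightarrow> (real ^ 'n \<Rightarrow> ((real ^ 'n) \<times> nat \<Rightarrow> 'k::field) set) \<Rightarrow> bool" where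
  "syzygy_family B Z \<longleftrightarrow> (\<forall>r. fv.subspace (Z r) \<and> Z r \<subseteq> fil (copies B) fst r) \<and>
     (\<forall>r s. r \<le> s \<longrightarrow> Z r \<subseteq> Z s) \<and> tame Z"

lemma syzygy_family_kernel:
  assumes "lin d"
  shows "syzygy_family B (\<lambda>r. {x \<in> fil (copies B) fst r. d x = 0})"
  unfolding syzygy_family_def
  using subspace_fil_kernel[OF assms] fil_mono[of _ _ "copies B" fst] tame_kernel[OF finite_copies] by blast

text \<open>
  Resolutions are built stage by stage from a way to cover one syzygy family; the
  invariant records what the construction of the next stage needs or ensures.
\<close>

lemma build_resolution:
  fixes M :: "('k::field, 'n::finite, 'v::ab_group_add) pmodule"
  assumes M: "persistence_module M" and e: "morphism (free_module B0) M e" "surjective (free_module B0) M e"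
    and tame: "tame (kernel_fam (copies B0) fst e)"
    and init: "Inv 0 B0 (kernel_fam (copies B0) fst e)"
    and step: "\<And>k B Z. Inv k B Z \<Longrightarrow> syzygy_family B Z \<Longrightarrow>
      \<exists>B' d. lin d \<and> (\<forall>r. d ` fil (copies B') fst r = Z r) \<and>
        Inv (Suc k) B' (\<lambda>r. {x \<in> fil (copies B') fst r. d x = 0})"
  shows "\<exists>B d. free_resolution M B d e \<and> (\<forall>k. Inv k (B k) (syzygy B d e k))"
proof -
  note e' = e(1)[unfolded morphism_free_module_iff]
  let ?Z0 = "kernel_fam (copies B0) fst e"
  have Z0: "syzygy_family B0 ?Z0"
    unfolding syzygy_family_def
    using subspace_kernel_fam[OF M e'] kernel_fam_mono[OF M e'] tame by (auto simp: kernel_fam_def)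
  let ?P = "\<lambda>k (B, Z). Inv k B Z \<and> syzygy_family B Z \<and> (k = 0 \<longrightarrow> B = B0 \<and> Z = ?Z0)"
  let ?Q = "\<lambda>(B, Z) (B', Z'). \<exists>d. lin d \<and> (\<forall>r. d ` fil (copies B') fst r = Z r) \<and>
      Z' = (\<lambda>r. {x \<in> fil (copies B') fst r. d x = 0})"
  have "\<exists>f. \<forall>k. ?P k (f k) \<and> ?Q (f k) (f (Suc k))"
  proof (rule dependent_nat_choice)
    show "\<exists>x. ?P 0 x" using init Z0 by (intro exI[of _ "(B0, ?Z0)"]) simp
    fix x k assume x: "?P k x"
    obtain B Z where BZ: "x = (B, Z)" by (cases x)
    obtain B' d where B': "lin d" "\<forall>r. d ` fil (copies B') fst r = Z r"
      "Inv (Suc k) B' (\<lambda>r. {x \<in> fil (copies B') fst r. d x = 0})"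
      using step[of k B Z] x BZ by auto
    then show "\<exists>y. ?P (Suc k) y \<and> ?Q x y"
      using syzygy_family_kernel[OF B'(1), of B'] BZ
      by (intro exI[of _ "(B', \<lambda>r. {x \<in> fil (copies B') fst r. d x = 0})"]) auto
  qed
  then obtain f where "\<forall>k. ?P k (f k) \<and> ?Q (f k) (f (Suc k))" ..
  then have f: "?P k (f k)" "?Q (f k) (f (Suc k))" for k by simp_all
  define B where "B = (\<lambda>k. fst (f k))"
  define Z where "Z = (\<lambda>k. snd (f k))"
  have fk: "f k = (B k, Z k)" for k by (simp add: B_def Z_def)
  have inv: "Inv k (B k) (Z k)" and B_0: "B 0 = B0" "Z 0 = ?Z0" for k
    using f(1)[of k] f(1)[of 0] unfolding fk by auto
  have "\<exists>d. lin d \<and> (\<forall>r. d ` fil (copies (B (Suc k))) fst r = Z k r) \<and>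
      Z (Suc k) = (\<lambda>r. {x \<in> fil (copies (B (Suc k))) fst r. d x = 0})" for k
    using f(2)[of k] unfolding fk by simp
  then have "\<exists>d. \<forall>k. lin (d k) \<and> (\<forall>r. d k ` fil (copies (B (Suc k))) fst r = Z k r) \<and>
      Z (Suc k) = (\<lambda>r. {x \<in> fil (copies (B (Suc k))) fst r. d k x = 0})"
    by (intro choice allI)
  then obtain d where "\<forall>k. lin (d k) \<and> (\<forall>r. d k ` fil (copies (B (Suc k))) fst r = Z k r) \<and>
      Z (Suc k) = (\<lambda>r. {x \<in> fil (copies (B (Suc k))) fst r. d k x = 0})" ..
  then have d: "lin (d k)" "d k ` fil (copies (B (Suc k))) fst r = Z k r"
    "Z (Suc k) = (\<lambda>r. {x \<in> fil (copies (B (Suc k))) fst r. d k x = 0})" for k r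
    by blast+
  have "syzygy B d e k = Z k" for k by (cases k) (simp_all add: B_0 d(3))
  then have "free_resolution M B d e \<and> (\<forall>k. Inv k (B k) (syzygy B d e k))"
    unfolding free_resolution_def using e B_0 d inv by simp
  then show ?thesis by blast
qed

lemma minimal_free_resolution_exists:
  fixes M :: "('k::field, 'n::finite, 'v::ab_group_add) pmodule"
  assumes "finitely_presentable M"
  shows "\<exists>B d e. free_resolution M B d e \<and> (\<forall>k. radical_family (syzygy B d e k))"
proof -
  have M: "persistence_module M" using assms by (simp add: finitely_presentable_def)
  obtain B0 e where e: "morphism (free_module B0) M e" "surjective (free_module B0) M e"
    "tame (kernel_fam (copies B0) fst e)"
    "\<forall>r x i. x \<in> kernel_fam (copies B0) fst e r \<longrightarrow> x i \<noteq> 0 \<longrightarrow> fst i \<noteq> r"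
    using minimal_cover_finitely_presentable[OF assms] by - (elim exE conjE, rule that, assumption+)
  have "\<exists>B d. free_resolution M B d e \<and> (\<forall>k. radical_family (syzygy B d e k))"
  proof (rule build_resolution[OF M e(1-3), where Inv = "\<lambda>_ _. radical_family"])
    show "radical_family (kernel_fam (copies B0) fst e)" using e(4) unfolding radical_family_def by blast
    fix B :: "(real ^ 'n) multiset" and Z :: "real ^ 'n \<Rightarrow> ((real ^ 'n) \<times> nat \<Rightarrow> 'k) set"
    assume Z: "syzygy_family B Z"
    have "\<exists>B' d. lin d \<and> (\<forall>r. d ` fil (copies B') fst r = Z r) \<and>
      (\<forall>r x i. x \<in> fil (copies B') fst r \<longrightarrow> d x = 0 \<longrightarrow> x i \<noteq> 0 \<longrightarrow> fst i \<noteq> r)"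
      by (rule minimal_cover_tame[OF finite_copies[of B], where b = fst])
        (use Z in \<open>simp_all add: syzygy_family_def\<close>)
    then show "\<exists>B' d. lin d \<and> (\<forall>r. d ` fil (copies B') fst r = Z r) \<and>
        radical_family (\<lambda>r. {x \<in> fil (copies B') fst r. d x = 0})"
    proof (elim exE)
      fix B' d assume *: "lin d \<and> (\<forall>r. d ` fil (copies B') fst r = Z r) \<and>
        (\<forall>r x i. x \<in> fil (copies B') fst r \<longrightarrow> d x = 0 \<longrightarrow> x i \<noteq> 0 \<longrightarrow> fst i \<noteq> r)"
      then have "radical_family (\<lambda>r. {x \<in> fil (copies B') fst r. d x = 0})"
        unfolding radical_family_def by blast
      then show ?thesis using * by blast
    qed
  qed
  then show ?thesis by blast
qed

lemma finitely_presentable_free: "finitely_presentable (free_module B)"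
proof -
  have 0: "fil (copies {#}) fst r = ({0} :: ((real ^ 'b) \<times> nat \<Rightarrow> 'a) set)" for r
    by (auto simp: fil_def copies_def fun_eq_iff)
  have "morphism (free_module {#}) (free_module B) (\<lambda>_ _. 0)"
    unfolding morphism_free_module_iff morphism_def linear_between_def
    by (auto simp: fv.subspace_0[OF subspace_fil] free_module_arr[OF fv.subspace_0[OF subspace_fil]])
  moreover have "morphism (free_module B) (free_module B) (\<lambda>_ x. x)"
    by (auto simp: morphism_def linear_between_def)
  moreover have "exact_at (free_module {#}) (\<lambda>_ _. 0) (free_module B) (\<lambda>_ x. x)"
    using fv.subspace_0[OF subspace_fil] unfolding exact_at_def by (auto simp: 0)
  moreover have "surjective (free_module B) (free_module B) (\<lambda>_ x. x)" by (simp add: surjective_def)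
  ultimately show ?thesis
    unfolding finitely_presentable_def using persistence_module_free by blast
qed

lemma free_resolution_projective:
  assumes "free_resolution M B d e"
  shows "projective_resolution M (\<lambda>k. free_module (B k)) (\<lambda>k _. d k) e"
proof -
  have res: "morphism (free_module (B 0)) M e" "surjective (free_module (B 0)) M e" "\<And>k. lin (d k)"
    and img: "\<And>k r. d k ` fil (copies (B (Suc k))) fst r = syzygy B d e k r"
    using assms unfolding free_resolution_def by auto
  have in_fil: "d k x \<in> fil (copies (B k)) fst r" if "x \<in> fil (copies (B (Suc k))) fst r" for k x r
  proof -
    have "d k x \<in> syzygy B d e k r" using that img by blast
    then show ?thesis by (cases k) (auto simp: kernel_fam_def)
  qed
  have "morphism (free_module (B (Suc k))) (free_module (B k)) (\<lambda>_. d k)" for k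
    unfolding morphism_free_module_iff
    using in_fil res(3) by (auto simp: morphism_def linear_between_def lin_add lin_smul free_module_arr[OF in_fil])
  moreover have "exact_at (free_module (B 1)) (\<lambda>_. d 0) (free_module (B 0)) e"
    using img[of 0] by (simp add: exact_at_def kernel_fam_def)
  moreover have "exact_at (free_module (B (Suc (Suc k)))) (\<lambda>_. d (Suc k)) (free_module (B (Suc k))) (\<lambda>_. d k)" for k
    using img[of "Suc k"] by (simp add: exact_at_def)
  ultimately show ?thesis
    unfolding projective_resolution_def
    using res finitely_presentable_free projective_free by blast
qed

text \<open>
  Every term is replaced by the free module isomorphic to it, and the differentials are transported.
\<close>

lemma projective_resolution_free:
  fixes M :: "('k::field, 'n::finite, 'v::ab_group_add) pmodule"
  assumes "projective_resolution M P d e"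
  shows "\<exists>B d' e'. free_resolution M B d' e' \<and> (\<forall>k. B k = barcode (P k))"
proof -
  have PP: "\<And>k. finitely_presentable (P k)" "\<And>k. projective (P k)"
    and d: "\<And>k. morphism (P (Suc k)) (P k) (d k)"
    and e: "morphism (P 0) M e" "surjective (P 0) M e"
    and ex: "exact_at (P 1) (d 0) (P 0) e" "\<And>k. exact_at (P (Suc (Suc k))) (d (Suc k)) (P (Suc k)) (d k)"
    using assms unfolding projective_resolution_def by auto
  define B where "B = (\<lambda>k. barcode (P k))"
  have "isomorphic (P k) (free_module (B k))" for k
    using projective_isomorphic_free[OF PP] barcode_eq unfolding B_def by metis
  then have "\<exists>\<beta> \<alpha>. morphism (P k) (free_module (B k)) \<beta> \<and> morphism (free_module (B k)) (P k) \<alpha> \<and>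
        (\<forall>r. \<forall>x\<in>obj (P k) r. \<alpha> r (\<beta> r x) = x) \<and> (\<forall>r. \<forall>y\<in>fil (copies (B k)) fst r. \<beta> r (\<alpha> r y) = y)" for k
    unfolding isomorphic_def by simp
  then obtain \<beta> \<alpha> where \<beta>: "\<And>k. morphism (P k) (free_module (B k)) (\<beta> k)"
    and \<alpha>: "\<And>k. morphism (free_module (B k)) (P k) (\<alpha> k)"
    and \<alpha>\<beta>: "\<And>k r x. x \<in> obj (P k) r \<Longrightarrow> \<alpha> k r (\<beta> k r x) = x"
    and \<beta>\<alpha>: "\<And>k r x. x \<in> fil (copies (B k)) fst r \<Longrightarrow> \<beta> k r (\<alpha> k r x) = x"
    by metis
  have \<alpha>_in: "\<alpha> k r x \<in> obj (P k) r" if "x \<in> fil (copies (B k)) fst r" for k r x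
    using linear_betweenD(1)[OF morphismD(1)[OF \<alpha>], of x k r] that by simp
  have \<beta>_in: "\<beta> k r x \<in> fil (copies (B k)) fst r" if "x \<in> obj (P k) r" for k r x
    using linear_betweenD(1)[OF morphismD(1)[OF \<beta>] that] by simp
  have d_in: "d k r x \<in> obj (P k) r" if "x \<in> obj (P (Suc k)) r" for k r x
    using linear_betweenD(1)[OF morphismD(1)[OF d] that] .
  have \<beta>_0: "\<beta> k r 0 = 0" and zero_in: "0 \<in> obj (P k) r" for k r
  proof -
    interpret persistence_module "P k" using PP(1) by (simp add: finitely_presentable_def)
    show "\<beta> k r 0 = 0"
      using linear_between_0[OF morphismD(1)[OF \<beta>, of k r] vector_space _ subspace] fv.vector_space_axioms by simp
    show "0 \<in> obj (P k) r" by (rule vs.subspace_0[OF subspace])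
  qed
  have "\<exists>f. lin f \<and> (\<forall>r. \<forall>x\<in>fil (copies (B (Suc k))) fst r. f x = \<beta> k r (d k r (\<alpha> (Suc k) r x)))" for k
    using morphism_globalise[OF persistence_module_free _ _ finite_copies,
        OF _ _ morphism_comp[OF morphism_comp[OF \<alpha> d] \<beta>, unfolded morphism_free_module_iff]]
    by (simp add: free_module_arr)
  then obtain d' where d': "\<And>k. lin (d' k)"
    "\<And>k r x. x \<in> fil (copies (B (Suc k))) fst r \<Longrightarrow> d' k x = \<beta> k r (d k r (\<alpha> (Suc k) r x))"
    by metis
  define e' where "e' = (\<lambda>r x. e r (\<alpha> 0 r x))"
  have \<alpha>_img: "\<alpha> k r ` fil (copies (B k)) fst r = obj (P k) r" for k r
    using \<alpha>_in \<alpha>\<beta> \<beta>_in by (auto simp: image_iff) metis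
  have e'_mor: "morphism (free_module (B 0)) M e'" unfolding e'_def by (rule morphism_comp[OF \<alpha> e(1)])
  have "e' r ` fil (copies (B 0)) fst r = e r ` \<alpha> 0 r ` fil (copies (B 0)) fst r" for r
    unfolding e'_def by (simp add: image_image)
  then have e'_surj: "surjective (free_module (B 0)) M e'"
    using e(2) unfolding surjective_def by (simp add: \<alpha>_img)
  have \<beta>_img: "\<beta> k r ` {y \<in> obj (P k) r. Q y} = {x \<in> fil (copies (B k)) fst r. Q (\<alpha> k r x)}" for k r Q
    using \<alpha>_in \<alpha>\<beta> \<beta>_in \<beta>\<alpha> by (auto simp: image_iff) metis
  have d'_img: "d' k ` fil (copies (B (Suc k))) fst r = \<beta> k r ` d k r ` obj (P (Suc k)) r" for k r
  proof -
    have "d' k ` fil (copies (B (Suc k))) fst r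
        = (\<lambda>x. \<beta> k r (d k r (\<alpha> (Suc k) r x))) ` fil (copies (B (Suc k))) fst r"
      by (intro image_cong d'(2)) auto
    also have "\<dots> = \<beta> k r ` d k r ` \<alpha> (Suc k) r ` fil (copies (B (Suc k))) fst r"
      by (simp add: image_image)
    finally show ?thesis by (simp only: \<alpha>_img)
  qed
  have "d' k ` fil (copies (B (Suc k))) fst r = syzygy B d' e' k r" for k r
  proof (cases k)
    case 0
    have "d 0 r ` obj (P (Suc 0)) r = {y \<in> obj (P 0) r. e r y = 0}"
      using ex(1) by (simp add: exact_at_def)
    then show ?thesis unfolding 0 d'_img by (simp add: \<beta>_img kernel_fam_def e'_def)
  next
    case (Suc j)
    have "d' j x = 0 \<longleftrightarrow> d j r (\<alpha> (Suc j) r x) = 0" if x: "x \<in> fil (copies (B (Suc j))) fst r" for x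
    proof -
      have "\<alpha> j r 0 = 0" using \<alpha>\<beta>[of 0 j r] \<beta>_0[of j r] zero_in[of j r] by simp
      then show ?thesis
        using d'(2)[OF x] \<beta>_0[of j r] \<alpha>\<beta>[OF d_in[OF \<alpha>_in[OF x]]] by auto
    qed
    moreover have "d (Suc j) r ` obj (P (Suc (Suc j))) r = {y \<in> obj (P (Suc j)) r. d j r y = 0}"
      using ex(2)[of j] by (simp add: exact_at_def)
    ultimately show ?thesis unfolding Suc d'_img by (auto simp: \<beta>_img)
  qed
  then have "free_resolution M B d' e'"
    unfolding free_resolution_def using e'_mor e'_surj d'(1) by simp
  then show ?thesis unfolding B_def by blast
qed

section \<open>A free resolution of length at most the number of parameters\<close>

\<comment> \<open>Indices are pairs, and splitting quantified indices would keep facts about whole indices from applying.\<close>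
declare split_paired_All [simp del] split_paired_Ex [simp del]

text \<open>
  The positions \<open>pos\<close> play the part of the order on the generators in a module term order.
\<close>

definition leads :: "('i \<Rightarrow> nat) \<Rightarrow> ('i \<Rightarrow> 'k::zero) \<Rightarrow> 'i \<Rightarrow> bool" where
  "leads pos x i \<longleftrightarrow> x i \<noteq> 0 \<and> (\<forall>j. x j \<noteq> 0 \<longrightarrow> pos j \<le> pos i)"

text \<open>
  Each leading generator \<open>i\<close> of the family is the leading generator of an element whose grade agrees with the
  grade of \<open>i\<close> in the coordinates of \<open>P\<close>.  In the language of Groebner bases, the leading
  monomials involve only the variables outside \<open>P\<close>.
\<close>

definition leading_grades_fixed :: "'n set \<Rightarrow> ((real ^ 'n::finite) \<times> nat \<Rightarrow> nat) \<Rightarrow>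
    (real ^ 'n \<Rightarrow> ((real ^ 'n) \<times> nat \<Rightarrow> 'k::field) set) \<Rightarrow> bool" where
  "leading_grades_fixed P pos Z \<longleftrightarrow> (\<forall>r x i. x \<in> Z r \<longrightarrow> leads pos x i \<longrightarrow>
     (\<exists>s\<le>r. (\<forall>p\<in>P. s $ p = fst i $ p) \<and> (\<exists>y\<in>Z s. leads pos y i)))"

lemma leads_exists:
  assumes "x \<in> fil I b r" "finite I" "x \<noteq> 0"
  shows "\<exists>i\<in>I. leads pos x i"
proof -
  define S where "S = {i \<in> I. x i \<noteq> 0}"
  have S: "finite (pos ` S)" "pos ` S \<noteq> {}"
    using assms filD(1)[OF assms(1)] unfolding S_def by (auto simp: fun_eq_iff)
  then obtain i where i: "i \<in> S" "Max (pos ` S) = pos i" using Max_in by blast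
  have "pos j \<le> pos i" if "x j \<noteq> 0" for j
    using Max_ge[OF S(1), of "pos j"] filD(1)[OF assms(1) that] that i(2) unfolding S_def by auto
  then show ?thesis using i unfolding leads_def S_def by blast
qed

text \<open>
  Schreyer's theorem on syzygies.  A Groebner basis \<open>g\<close> of \<open>Z\<close> has, for each leading generator, elements at
  the minimal grades at which it leads.  The leading terms of the syzygies of \<open>g\<close> come
  from pairs with the same leading generator, at the join of the two grades.  If
  the basis is ordered by coordinate \<open>q\<close> within each leading generator, the join agrees with the larger
  grade in coordinate \<open>q\<close>, so the fixed coordinates grow from \<open>P\<close> to \<open>insert q P\<close>.  Once all are
  fixed, two minimal grades of one leading generator would be comparable, so there is no syzygy.
\<close>

lemma schreyer_step:
  fixes Z :: "real ^ 'n::finite \<Rightarrow> ((real ^ 'n) \<times> nat \<Rightarrow> 'k::field) set"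
  assumes inj: "inj_on pos (copies B)" and Z: "syzygy_family B Z"
    and fixed: "leading_grades_fixed P pos Z"
  shows "\<exists>B' d pos'. lin d \<and> (\<forall>r. d ` fil (copies B') fst r = Z r) \<and> inj_on pos' (copies B') \<and>
    leading_grades_fixed (insert q P) pos' (\<lambda>r. {x \<in> fil (copies B') fst r. d x = 0}) \<and>
    (insert q P = UNIV \<longrightarrow> (\<forall>r. {x \<in> fil (copies B') fst r. d x = 0} \<subseteq> {0}))"
proof -
  have sub: "fv.subspace (Z r)" and Z_fil: "Z r \<subseteq> fil (copies B) fst r" for r
    using Z unfolding syzygy_family_def by auto
  have mono: "x \<in> Z s" if "x \<in> Z r" "r \<le> s" for x r s
    using Z that unfolding syzygy_family_def by blast
  obtain G where "finite G \<and> (\<forall>r. Z r \<subseteq> {0} \<or> (\<exists>s\<in>G. s \<le> r \<and> Z r \<subseteq> Z s))"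
    using conjunct2[OF conjunct2[OF Z[unfolded syzygy_family_def]]] unfolding tame_def ..
  then have G: "finite G" "Z r \<subseteq> {0} \<or> (\<exists>s\<in>G. s \<le> r \<and> Z r \<subseteq> Z s)" for r by simp_all
  have lead_in: "i \<in> copies B" "fst i \<le> r" if "x \<in> Z r" "leads pos x i" for x r i
    using filD[of x "copies B" fst r i] Z_fil that unfolding leads_def by auto

  \<comment> \<open>Grades at which generator \<open>i\<close> leads; \<open>S i\<close> consists of the minimal ones.\<close>
  define W where "W = (\<lambda>i. {s \<in> G. (\<forall>p\<in>P. s $ p = fst i $ p) \<and> (\<exists>y\<in>Z s. leads pos y i)})"
  define S where "S = (\<lambda>i. {s \<in> W i. \<forall>t\<in>W i. t \<le> s \<longrightarrow> t = s})"
  have finW: "finite (W i)" for i using G(1) unfolding W_def by auto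
  have in_W: "\<exists>s\<in>W i. s \<le> r" if x: "x \<in> Z r" "leads pos x i" for x r i
  proof -
    obtain s y where s: "s \<le> r" "\<forall>p\<in>P. s $ p = fst i $ p" "y \<in> Z s" "leads pos y i"
      using fixed x unfolding leading_grades_fixed_def by blast
    have "y \<noteq> 0" using s(4) by (auto simp: leads_def)
    then obtain t where t: "t \<in> G" "t \<le> s" "y \<in> Z t" using G(2)[of s] s(3) by blast
    have "t $ p = fst i $ p" if "p \<in> P" for p
      using s(2) that t(2) lead_in(2)[OF t(3) s(4)] by (metis less_eq_vec_def order_antisym)
    then have "t \<in> W i" using t s(4) unfolding W_def by blast
    then show ?thesis using t(2) s(1) by (meson order.trans)
  qed
  have in_S: "\<exists>s\<in>S i. s \<le> r" if x: "x \<in> Z r" "leads pos x i" for x r i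
  proof -
    obtain t where t: "t \<in> W i" "t \<le> r" using in_W[OF x] by blast
    obtain s where "s \<in> W i" "s \<le> t" "\<forall>u\<in>W i. u \<le> s \<longrightarrow> s = u"
      using finite_has_minimal2[OF finW t(1)] by blast
    then show ?thesis using t(2) unfolding S_def by (intro bexI[of _ s]) auto
  qed

  \<comment> \<open>One basis element for each leading generator and each of its minimal grades.\<close>
  define J where "J = (SIGMA i:copies B. S i)"
  have finJ: "finite J" using finW unfolding J_def S_def by auto
  obtain B' \<sigma> where \<sigma>: "bij_betw \<sigma> (copies B') J" "\<forall>x\<in>copies B'. snd (\<sigma> x) = fst x"
    using ex_multiset_reindex[OF finJ, of snd] by blast
  define l where "l = (\<lambda>x. fst (\<sigma> x))"
  have l_in: "l x \<in> copies B" "fst x \<in> S (l x)" if "x \<in> copies B'" for x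
    using bij_betwE[OF \<sigma>(1)] \<sigma>(2) that unfolding J_def l_def by fastforce+
  have l_inj: "x = y" if "x \<in> copies B'" "y \<in> copies B'" "l x = l y" "fst x = fst y" for x y
    using inj_onD[OF bij_betw_imp_inj_on[OF \<sigma>(1)], of x y] that \<sigma>(2) unfolding l_def
    by (metis prod_eqI)
  have l_surj: "\<exists>x\<in>copies B'. l x = i \<and> fst x = s" if "i \<in> copies B" "s \<in> S i" for i s
  proof -
    have "(i, s) \<in> \<sigma> ` copies B'" using \<sigma>(1) that unfolding J_def bij_betw_def by blast
    then obtain x where x: "(i, s) = \<sigma> x" "x \<in> copies B'" by (elim imageE)
    then have "fst x = s" using \<sigma>(2) by (metis snd_conv)
    moreover have "l x = i" unfolding l_def x(1)[symmetric] by simp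
    ultimately show ?thesis using x(2) by blast
  qed

  have "\<exists>y. y \<in> Z (fst x) \<and> leads pos y (l x) \<and> y (l x) = 1" if x: "x \<in> copies B'" for x
  proof -
    obtain y where y: "y \<in> Z (fst x)" "leads pos y (l x)"
      using l_in(2)[OF x] unfolding S_def W_def by blast
    have "smul (1 / y (l x)) y \<in> Z (fst x)" by (rule fv.subspace_scale[OF sub y(1)])
    then show ?thesis using y(2) by (intro exI[of _ "smul (1 / y (l x)) y"]) (auto simp: leads_def)
  qed
  then obtain g where g: "\<And>x. x \<in> copies B' \<Longrightarrow> g x \<in> Z (fst x)"
    "\<And>x. x \<in> copies B' \<Longrightarrow> leads pos (g x) (l x)" "\<And>x. x \<in> copies B' \<Longrightarrow> g x (l x) = 1"
    by metis
  define d where "d = lincomb (copies B') g"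
  have lind: "lin d" unfolding d_def by (rule lin_lincomb)
  have d_unit: "d (unit_vec x) = g x" if "x \<in> copies B'" for x
    unfolding d_def by (rule lincomb_unit[OF finite_copies that])

  \<comment> \<open>Division with remainder by the basis, which removes the leading term in each step.\<close>
  have generate: "\<exists>c\<in>fil (copies B') fst r. d c = z \<and> (\<forall>x. c x \<noteq> 0 \<longrightarrow> pos (l x) < m)"
    if "z \<in> Z r" "\<forall>j. z j \<noteq> 0 \<longrightarrow> pos j < m" for m r z
    using that
  proof (induction m arbitrary: z)
    case 0
    then have "z = 0" by (auto simp: fun_eq_iff)
    then have "d 0 = z \<and> (\<forall>x. (0 :: (real ^ 'n) \<times> nat \<Rightarrow> 'k) x \<noteq> 0 \<longrightarrow> pos (l x) < 0)"
      using lin_0[OF lind] by simp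
    then show ?case using fv.subspace_0[OF subspace_fil] by blast
  next
    case (Suc m)
    show ?case
    proof (cases "\<exists>i. z i \<noteq> 0 \<and> pos i = m")
      case True
      then obtain i where i: "z i \<noteq> 0" "pos i = m" by blast
      have lead: "leads pos z i" using i Suc.prems(2) unfolding leads_def by (auto simp: less_Suc_eq_le)
      obtain s where s: "s \<in> S i" "s \<le> r" using in_S[OF Suc.prems(1) lead] by blast
      obtain x where x: "x \<in> copies B'" "l x = i" "fst x = s"
        using l_surj[OF lead_in(1)[OF Suc.prems(1) lead] s(1)] by blast
      define z' where "z' = z - smul (z i) (g x)"
      have z': "z' \<in> Z r"
        unfolding z'_def using g(1)[OF x(1)] mono s(2) x(3) Suc.prems(1)
        by (intro fv.subspace_diff[OF sub] fv.subspace_scale[OF sub]) auto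
      have z'i: "z' i = 0" using g(3)[OF x(1)] x(2) by (simp add: z'_def)
      have "pos j < m" if j: "z' j \<noteq> 0" for j
      proof -
        have "z j \<noteq> 0 \<or> g x j \<noteq> 0" using j by (auto simp: z'_def)
        then have "pos j \<le> m"
          using Suc.prems(2) g(2)[OF x(1)] x(2) i(2) unfolding leads_def by (auto simp: less_Suc_eq_le)
        moreover have "pos j \<noteq> pos i"
          using inj_onD[OF inj, of j i] j z'i lead_in(1)[OF Suc.prems(1) lead]
            filD(1)[of z' "copies B" fst r j] z' Z_fil by auto
        ultimately show ?thesis using i(2) by simp
      qed
      then obtain c where c: "c \<in> fil (copies B') fst r" "d c = z'" "\<forall>x. c x \<noteq> 0 \<longrightarrow> pos (l x) < m"
        using Suc.IH[OF z'] by blast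
      let ?c = "c + smul (z i) (unit_vec x)"
      have "?c \<in> fil (copies B') fst r"
        using c(1) unit_vec_fil[OF x(1), of fst r] s(2) x(3)
        by (intro fv.subspace_add[OF subspace_fil] fv.subspace_scale[OF subspace_fil]) auto
      moreover have "d ?c = z"
        using c(2) d_unit[OF x(1)] by (simp add: lin_add[OF lind] lin_smul[OF lind] z'_def)
      moreover have "\<forall>y. ?c y \<noteq> 0 \<longrightarrow> pos (l y) < Suc m"
        using c(3) x(2) i(2) by (auto simp: unit_vec_apply less_Suc_eq split: if_splits)
      ultimately show ?thesis by blast
    next
      case False
      then have "\<forall>j. z j \<noteq> 0 \<longrightarrow> pos j < m" using Suc.prems(2) by (auto simp: less_Suc_eq)
      from Suc.IH[OF Suc.prems(1) this] show ?thesis using less_SucI by blast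
    qed
  qed
  have img: "d ` fil (copies B') fst r = Z r" for r
  proof
    show "d ` fil (copies B') fst r \<subseteq> Z r"
    proof
      fix z assume "z \<in> d ` fil (copies B') fst r"
      then obtain c where c: "c \<in> fil (copies B') fst r" "z = d c" by blast
      show "z \<in> Z r"
        unfolding c(2) d_def using g(1) mono filD(2)[OF c(1)] by (intro lincomb_in_subspace[OF sub]) blast
    qed
    show "Z r \<subseteq> d ` fil (copies B') fst r"
    proof
      fix z assume z: "z \<in> Z r"
      have "\<forall>j. z j \<noteq> 0 \<longrightarrow> pos j < Suc (Max (pos ` copies B))"
        using filD(1)[OF subsetD[OF Z_fil z]] by (simp add: less_Suc_eq_le Max_ge)
      from generate[OF z this] show "z \<in> d ` fil (copies B') fst r" by blast
    qed
  qed

  \<comment> \<open>The order on the basis: first by leading generator, then by coordinate \<open>q\<close> of the grade.\<close>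
  let ?R = "\<lambda>x y. pos (l x) < pos (l y) \<or> (l x = l y \<and> fst x $ q < fst y $ q)"
  obtain pos' :: "(real ^ 'n) \<times> nat \<Rightarrow> nat"
    where pos': "inj_on pos' (copies B')" "\<forall>x\<in>copies B'. \<forall>y\<in>copies B'. ?R x y \<longrightarrow> pos' x < pos' y"
    using linear_extension[OF finite_copies[of B'], of ?R] by fastforce

  \<comment> \<open>The leading term of a syzygy cancels only against another basis element with the same leading generator.\<close>
  have partner: "\<exists>y\<in>copies B'. y \<noteq> x \<and> c y \<noteq> 0 \<and> l y = l x \<and> fst y $ q \<le> fst x $ q \<and> pos' y < pos' x"
    if c: "c \<in> fil (copies B') fst r" "d c = 0" "leads pos' c x" for c r x
  proof -
    have x: "x \<in> copies B'" "c x \<noteq> 0" using filD(1)[OF c(1)] c(3) by (auto simp: leads_def)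
    have "0 = d c (l x)" using c(2) by simp
    also have "\<dots> = (\<Sum>y\<in>copies B'. c y * g y (l x))" unfolding d_def by (rule lincomb_apply)
    also have "\<dots> = c x + (\<Sum>y\<in>copies B' - {x}. c y * g y (l x))"
      using x g(3)[OF x(1)] by (subst sum.remove[of _ x]) auto
    finally have "(\<Sum>y\<in>copies B' - {x}. c y * g y (l x)) \<noteq> 0" using x(2) by auto
    then obtain y where y: "y \<in> copies B' - {x}" "c y * g y (l x) \<noteq> 0"
      by (meson sum.neutral)
    then have y': "y \<in> copies B'" "y \<noteq> x" "c y \<noteq> 0" "g y (l x) \<noteq> 0" by auto
    have le: "pos' y \<le> pos' x" using c(3) y'(3) unfolding leads_def by blast
    then have "\<not> ?R x y" using pos'(2) x(1) y'(1) by (meson leD)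
    moreover have "pos (l x) \<le> pos (l y)" using g(2)[OF y'(1)] y'(4) unfolding leads_def by blast
    ultimately have "pos (l x) = pos (l y)" by auto
    then have "l y = l x" using inj_onD[OF inj] l_in(1)[OF x(1)] l_in(1)[OF y'(1)] by metis
    moreover have "pos' y < pos' x"
      using le y'(1,2) x(1) inj_onD[OF pos'(1), of y x] by (auto simp: order.order_iff_strict)
    ultimately show ?thesis using y' \<open>\<not> ?R x y\<close> by (intro bexI[of _ y]) auto
  qed
  have agree: "fst x $ p = fst (l x) $ p" if "x \<in> copies B'" "p \<in> P" for x p
    using l_in(2)[OF that(1)] that(2) unfolding S_def W_def by blast

  have "leading_grades_fixed (insert q P) pos' (\<lambda>r. {x \<in> fil (copies B') fst r. d x = 0})"
    unfolding leading_grades_fixed_def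
  proof (intro allI impI)
    fix r c x assume c: "c \<in> {x \<in> fil (copies B') fst r. d x = 0}" "leads pos' c x"
    then have x: "x \<in> copies B'" "fst x \<le> r" using filD[of c "copies B'" fst r x] by (auto simp: leads_def)
    obtain y where y: "y \<in> copies B'" "y \<noteq> x" "c y \<noteq> 0" "l y = l x" "fst y $ q \<le> fst x $ q" "pos' y < pos' x"
      using partner[of c r x] c by blast
    have yr: "fst y \<le> r" using filD(2)[of c "copies B'" fst r y] c(1) y(3) by auto
    \<comment> \<open>The syzygy of the pair \<open>x\<close>, \<open>y\<close> lives at the join of their grades.\<close>
    define s where "s = (\<chi> p. max (fst x $ p) (fst y $ p))"
    have s: "fst x \<le> s" "fst y \<le> s" "s \<le> r"
      using x(2) yr unfolding s_def by (auto simp: less_eq_vec_def)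
    have s_fixed: "\<forall>p\<in>insert q P. s $ p = fst x $ p"
      using agree[OF x(1)] agree[OF y(1)] y(4,5) unfolding s_def by auto
    let ?z = "g x - g y"
    have z: "?z \<in> Z s" using g(1) x(1) y(1) mono s by (intro fv.subspace_diff[OF sub]) blast+
    have "pos j < pos (l x)" if j: "?z j \<noteq> 0" for j
    proof -
      have "g x j \<noteq> 0 \<or> g y j \<noteq> 0" using j by auto
      then have "pos j \<le> pos (l x)"
        using g(2)[OF x(1)] g(2)[OF y(1)] y(4) unfolding leads_def by auto
      moreover have "j \<noteq> l x" using j g(3)[OF x(1)] g(3)[OF y(1)] y(4) by auto
      moreover have "j \<in> copies B" using filD(1)[of ?z "copies B" fst s j] z Z_fil j by blast
      ultimately show ?thesis
        using inj_onD[OF inj, of j "l x"] l_in(1)[OF x(1)] by (auto simp: order.order_iff_strict)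
    qed
    then obtain c' where c': "c' \<in> fil (copies B') fst s" "d c' = ?z" "\<forall>w. c' w \<noteq> 0 \<longrightarrow> pos (l w) < pos (l x)"
      using generate[OF z, of "pos (l x)"] by blast
    \<comment> \<open>The difference of the two basis elements has a smaller leading term; dividing it gives the syzygy.\<close>
    let ?y = "unit_vec x - unit_vec y - c'"
    have "?y \<in> fil (copies B') fst s"
      using unit_vec_fil[of x _ fst, OF x(1) s(1)] unit_vec_fil[of y _ fst, OF y(1) s(2)] c'(1)
      by (intro fv.subspace_diff[OF subspace_fil])
    moreover have "d ?y = 0"
      using c'(2) d_unit[OF x(1)] d_unit[OF y(1)] by (simp add: lin_diff[OF lind])
    moreover have "leads pos' ?y x"
      unfolding leads_def
    proof (intro conjI allI impI)
      have "c' x = 0" using c'(3) by blast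
      then show "?y x \<noteq> 0" using y(2) by (simp add: unit_vec_apply)
      fix w assume "?y w \<noteq> 0"
      then consider "w = x" | "w = y" | "c' w \<noteq> 0" by (auto simp: unit_vec_apply split: if_splits)
      then show "pos' w \<le> pos' x"
      proof cases
        case 3
        then have "w \<in> copies B'" "?R w x" using c'(3) filD(1)[OF c'(1)] by auto
        then show ?thesis using pos'(2) x(1) by (meson less_imp_le)
      qed (use y(6) in auto)
    qed
    ultimately show "\<exists>s\<le>r. (\<forall>p\<in>insert q P. s $ p = fst x $ p) \<and>
        (\<exists>y\<in>{x \<in> fil (copies B') fst s. d x = 0}. leads pos' y x)"
      using s(3) s_fixed by blast
  qed
  moreover have "{x \<in> fil (copies B') fst r. d x = 0} \<subseteq> {0}" if all: "insert q P = UNIV" for r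
  proof (rule subsetI, rule ccontr)
    fix c assume c: "c \<in> {x \<in> fil (copies B') fst r. d x = 0}" "c \<notin> {0}"
    then obtain x where x: "x \<in> copies B'" "leads pos' c x"
      using leads_exists[OF _ finite_copies, of c B' fst r pos'] by blast
    obtain y where y: "y \<in> copies B'" "y \<noteq> x" "l y = l x" "fst y $ q \<le> fst x $ q"
      using partner[of c r x] c(1) x(2) by blast
    have "fst y $ p \<le> fst x $ p" for p
    proof (cases "p = q")
      case False
      then have "p \<in> P" using all by blast
      then show ?thesis using agree[OF x(1)] agree[OF y(1)] y(3) by simp
    qed (use y(4) in simp)
    then have "fst y \<le> fst x" by (simp add: less_eq_vec_def)
    moreover have "fst y \<in> W (l x)" "fst x \<in> S (l x)"
      using l_in(2)[OF x(1)] l_in(2)[OF y(1)] y(3) unfolding S_def by auto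
    ultimately have "fst y = fst x" unfolding S_def by blast
    then show False using l_inj[OF y(1) x(1) y(3)] y(2) by blast
  qed
  ultimately show ?thesis
    using lind img pos'(1) by (intro exI[of _ B'] exI[of _ d] exI[of _ pos']) blast
qed

text \<open>
  One more coordinate is fixed at each stage, so stage \<open>n\<close> has no syzygies.
\<close>

lemma short_free_resolution:
  fixes M :: "('k::field, 'n::finite, 'v::ab_group_add) pmodule"
  assumes "finitely_presentable M"
  shows "\<exists>B d e. free_resolution M B d e \<and> (\<forall>k>CARD('n). B k = {#})"
proof -
  have M: "persistence_module M" using assms by (simp add: finitely_presentable_def)
  obtain B0 e where e: "morphism (free_module B0) M e" "surjective (free_module B0) M e"
    "tame (kernel_fam (copies B0) fst e)"
    using minimal_cover_finitely_presentable[OF assms] by - (elim exE conjE, rule that, assumption+)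
  define Inv :: "nat \<Rightarrow> (real ^ 'n) multiset \<Rightarrow> (real ^ 'n \<Rightarrow> ((real ^ 'n) \<times> nat \<Rightarrow> 'k) set) \<Rightarrow> bool"
    where "Inv = (\<lambda>k B Z. (\<exists>pos P. inj_on pos (copies B) \<and> card P = min k CARD('n) \<and>
      leading_grades_fixed P pos Z) \<and> (k \<ge> CARD('n) \<longrightarrow> (\<forall>r. Z r \<subseteq> {0})) \<and> (k > CARD('n) \<longrightarrow> B = {#}))"
  have "\<exists>B d. free_resolution M B d e \<and> (\<forall>k. Inv k (B k) (syzygy B d e k))"
  proof (rule build_resolution[OF M e])
    obtain pos :: "(real ^ 'n) \<times> nat \<Rightarrow> nat" where "inj_on pos (copies B0)"
      using linear_extension[OF finite_copies[of B0], of "\<lambda>_ _. False"] by auto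
    moreover have "leading_grades_fixed {} pos (kernel_fam (copies B0) fst e)"
      unfolding leading_grades_fixed_def by blast
    ultimately show "Inv 0 B0 (kernel_fam (copies B0) fst e)"
      unfolding Inv_def using card.empty by (intro conjI exI[of _ pos] exI[of _ "{}"]) auto
    fix k and B :: "(real ^ 'n) multiset" and Z :: "real ^ 'n \<Rightarrow> ((real ^ 'n) \<times> nat \<Rightarrow> 'k) set"
    assume inv: "Inv k B Z" and Z: "syzygy_family B Z"
    obtain pos P where P: "inj_on pos (copies B)" "card P = min k CARD('n)" "leading_grades_fixed P pos Z"
      using inv unfolding Inv_def by - (elim exE conjE, rule that, assumption+)
    show "\<exists>B' d. lin d \<and> (\<forall>r. d ` fil (copies B') fst r = Z r) \<and>
        Inv (Suc k) B' (\<lambda>r. {x \<in> fil (copies B') fst r. d x = 0})"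
    proof (cases "k < CARD('n)")
      case True
      then have "P \<noteq> UNIV" using P(2) by auto
      then obtain q where q: "q \<notin> P" by blast
      obtain B' d pos' where *: "lin d" "\<forall>r. d ` fil (copies B') fst r = Z r" "inj_on pos' (copies B')"
        "leading_grades_fixed (insert q P) pos' (\<lambda>r. {x \<in> fil (copies B') fst r. d x = 0})"
        "insert q P = UNIV \<longrightarrow> (\<forall>r. {x \<in> fil (copies B') fst r. d x = 0} \<subseteq> {0})"
        using schreyer_step[OF P(1) Z P(3), of q] by - (elim exE conjE, rule that, assumption+)
      have card: "card (insert q P) = Suc k" using q P(2) True by simp
      then have "Suc k \<ge> CARD('n) \<Longrightarrow> insert q P = UNIV"
        using card_mono[of UNIV "insert q P"] by (intro card_subset_eq) auto
      then have "Inv (Suc k) B' (\<lambda>r. {x \<in> fil (copies B') fst r. d x = 0})"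
        unfolding Inv_def using * card True by (intro conjI exI[of _ pos'] exI[of _ "insert q P"]) auto
      then show ?thesis using *(1,2) by blast
    next
      \<comment> \<open>From stage \<open>n\<close> on everything is zero.\<close>
      case False
      have Z0: "Z r = {0}" for r
        using inv Z False fv.subspace_0[of "Z r"] unfolding Inv_def syzygy_family_def by auto
      have F0: "fil (copies {#}) fst r = ({0} :: ((real ^ 'n) \<times> nat \<Rightarrow> 'k) set)" for r
        by (auto simp: fil_def copies_def fun_eq_iff)
      let ?Z = "\<lambda>r. {x :: (real ^ 'n) \<times> nat \<Rightarrow> 'k. x \<in> fil (copies {#}) fst r \<and> (0 :: (real ^ 'n) \<times> nat \<Rightarrow> 'k) = 0}"
      have Z': "?Z = (\<lambda>_. {0})" unfolding F0 by simp
      have "leading_grades_fixed UNIV (\<lambda>_. 0) ?Z"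
        unfolding Z' leading_grades_fixed_def leads_def by auto
      moreover have "inj_on (\<lambda>_. 0 :: nat) (copies ({#} :: (real ^ 'n) multiset))"
        by (simp add: copies_def)
      ultimately have "Inv (Suc k) {#} ?Z"
        unfolding Inv_def Z' using False by (intro conjI exI[of _ "\<lambda>_. 0"] exI[of _ UNIV]) simp_all
      then show ?thesis
        by (intro exI[of _ "{#}"] exI[of _ "\<lambda>_. 0"]) (simp add: lin_zero Z0 F0)
    qed
  qed
  then obtain B d where "free_resolution M B d e" "\<forall>k. Inv k (B k) (syzygy B d e k)" by blast
  then show ?thesis unfolding Inv_def by (intro exI[of _ B] exI[of _ d] exI[of _ e]) simp
qed

section \<open>Comparing free resolutions\<close>

lemma syzygy_subspace:
  assumes "persistence_module M" "free_resolution M B d e"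
  shows "fv.subspace (syzygy B d e k r)" "syzygy B d e k r \<subseteq> fil (copies (B k)) fst r"
proof -
  have "morphism (filmod (fil (copies (B 0)) fst)) M e" "\<And>k. lin (d k)"
    using assms(2) unfolding free_resolution_def morphism_free_module_iff by auto
  then show "fv.subspace (syzygy B d e k r)"
    by (cases k) (simp_all add: subspace_kernel_fam[OF assms(1)] subspace_fil_kernel)
  show "syzygy B d e k r \<subseteq> fil (copies (B k)) fst r"
    by (cases k) (auto simp: kernel_fam_def)
qed

text \<open>
  The base case comes from lifting the interleaving of the modules to the first covers.
\<close>

lemma resolutions_interleaving:
  fixes M :: "('k::field, 'n::finite, 'v::ab_group_add) pmodule"
    and N :: "('k, 'n, 'w::ab_group_add) pmodule"
  assumes M: "persistence_module M" and N: "persistence_module N"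
    and res: "free_resolution M B d e" "free_resolution N C d' e'"
    and "\<epsilon> \<ge> 0" and int: "interleaved \<epsilon> M N"
  defines "I \<equiv> \<lambda>s k. copies (if s then B k else C k)"
    and "Z \<equiv> \<lambda>s k. if s then syzygy B d e k else syzygy C d' e' k"
  shows "presented_interleaving \<epsilon>
    (alternating I True m) (level_grade \<epsilon> fst) (\<lambda>r. tag m ` Z (True = even m) m (r + diag (real m * \<epsilon>)))
    (alternating I False m) (level_grade \<epsilon> fst) (\<lambda>r. tag m ` Z (False = even m) m (r + diag (real m * \<epsilon>)))"
proof (rule alternating_interleaving[OF \<open>\<epsilon> \<ge> 0\<close>, where d = "\<lambda>s k. if s then d k else d' k"])
  note res' = res[unfolded free_resolution_def morphism_free_module_iff]
  show "finite (I s k)" for s k by (simp add: I_def)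
  show "lin (if s then d k else d' k)" for s k using res' by simp
  show "fv.subspace (Z s k r)" "Z s k r \<subseteq> fil (I s k) fst r" for s k r
    using syzygy_subspace[OF M res(1)] syzygy_subspace[OF N res(2)] by (auto simp: Z_def I_def)
  show "(if s then d k else d' k) ` fil (I s (Suc k)) fst r = Z s k r" for s k r
    using res' by (simp add: Z_def I_def)
  show "Z s (Suc k) r = {x \<in> fil (I s (Suc k)) fst r. (if s then d k else d' k) x = 0}" for s k r
    by (simp add: Z_def I_def)
  have surj: "surjective (filmod (fil (copies (B 0)) fst)) M e" "surjective (filmod (fil (copies (C 0)) fst)) N e'"
    using res' by (simp_all add: surjective_def)
  show "presented_interleaving \<epsilon> (I True 0) fst (Z True 0) (I False 0) fst (Z False 0)"
    using interleaved_presentations[OF M N finite_copies finite_copies _ surj(1) _ surj(2) \<open>\<epsilon> \<ge> 0\<close> int] res'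
    by (simp add: I_def Z_def)
qed

lemma card_alternating:
  "card {x \<in> alternating (\<lambda>s k. copies (if s then B k else C k)) s m. level_grade 0 fst x = v}
    = (\<Sum>k\<le>m. count (if s = even k then B k else C k) v)"
proof (induction m)
  case 0
  have "{x \<in> alternating (\<lambda>s k. copies (if s then B k else C k)) s 0. level_grade 0 fst x = v}
      = Pair 0 ` {x \<in> copies (if s then B 0 else C 0). fst x = v}"
    by (auto simp: alternating_def level_grade_def vec_eq_iff)
  then show ?case using card_copies[of _ v] by (simp add: card_image inj_on_def)
next
  case (Suc m)
  let ?X = "if s = even (Suc m) then B (Suc m) else C (Suc m)"
  let ?I = "\<lambda>s k. copies (if s then B k else C k)"
  have "{x \<in> alternating ?I s (Suc m). level_grade 0 fst x = v}
      = {x \<in> alternating ?I s m. level_grade 0 fst x = v} \<union> Pair (Suc m) ` {x \<in> copies ?X. fst x = v}"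
    unfolding alternating_Suc by (auto simp: level_grade_def vec_eq_iff)
  moreover have "{x \<in> alternating ?I s m. level_grade 0 fst x = v} \<inter> Pair (Suc m) ` {x \<in> copies ?X. fst x = v} = {}"
    by (auto simp: alternating_def)
  moreover have "finite {x \<in> alternating ?I s m. level_grade 0 fst x = v}"
    using finite_alternating[of ?I s m] by simp
  moreover have "card (Pair (Suc m) ` {x \<in> copies ?X. fst x = v}) = count ?X v"
    using card_copies[of ?X v] by (simp add: card_image inj_on_def)
  ultimately show ?case using Suc.IH by (simp add: card_Un_disjoint)
qed

text \<open>
  A module is \<open>0\<close>-interleaved with itself, so the alternating sums up to level \<open>m\<close> of the two
  resolutions present isomorphic modules.  On one side the syzygy belongs to the minimal resolution,
  so \<open>multiplicity_le\<close> bounds its generators by those of the other side.  Adding the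
  bounds for \<open>m\<close> and \<open>m + 1\<close> cancels all levels but the last.
\<close>

lemma minimal_resolution_count_le:
  fixes M :: "('k::field, 'n::finite, 'v::ab_group_add) pmodule"
  assumes M: "persistence_module M"
    and res: "free_resolution M B d e" "free_resolution M C d' e'"
    and minimal: "\<And>k. radical_family (syzygy B d e k)"
  shows "count (B k) v \<le> count (C k) v"
proof -
  let ?I = "\<lambda>s k. copies (if s then B k else C k)"
  let ?b = "\<lambda>m. \<Sum>k\<le>m. count (if even m = even k then B k else C k) v"
  let ?c = "\<lambda>m. \<Sum>k\<le>m. count (if even m = even k then C k else B k) v"
  have le: "?b m \<le> ?c m" for m
  proof -
    have int: "presented_interleaving 0
      (alternating ?I True m) (level_grade 0 fst) (\<lambda>r. tag m ` (if True = even m then syzygy B d e m else syzygy C d' e' m) (r + diag (real m * 0)))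
      (alternating ?I False m) (level_grade 0 fst) (\<lambda>r. tag m ` (if False = even m then syzygy B d e m else syzygy C d' e' m) (r + diag (real m * 0)))"
      by (rule resolutions_interleaving[OF M M res order.refl interleaved_0_refl[OF M]])
    have rad: "level_grade 0 fst i \<noteq> v" if x: "x \<in> tag m ` syzygy B d e m (v + diag (real m * 0))" "x i \<noteq> 0" for x i
    proof -
      obtain y j where "x = tag m y" "y \<in> syzygy B d e m (v + diag (real m * 0))" "i = (m, j)" "y j \<noteq> 0"
        using x by (auto simp: tag_def split: prod.splits if_splits)
      moreover have "v + diag (real m * 0) = v" by (simp add: vec_eq_iff)
      ultimately have "fst j \<noteq> v" using minimal[of m] unfolding radical_family_def by auto
      then show ?thesis using \<open>i = (m, j)\<close> by (auto simp: level_grade_def vec_eq_iff)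
    qed
    have fin: "finite (alternating ?I s m)" for s by (rule finite_alternating) simp
    have flip: "(\<Sum>k\<le>m. count (if (\<not> even m) = even k then B k else C k) v) = ?c m"
      by (intro sum.cong) auto
    show ?thesis
    proof (cases "even m")
      case True
      then have "card {x \<in> alternating ?I True m. level_grade 0 fst x = v}
          \<le> card {x \<in> alternating ?I False m. level_grade 0 fst x = v}"
        using rad by (intro multiplicity_le[OF fin fin int]) auto
      then show ?thesis unfolding card_alternating using True flip by simp
    next
      case False
      then have "card {x \<in> alternating ?I False m. level_grade 0 fst x = v}
          \<le> card {x \<in> alternating ?I True m. level_grade 0 fst x = v}"
        using rad by (intro multiplicity_le[OF fin fin presented_interleaving_sym[OF int]]) auto
      then show ?thesis unfolding card_alternating using False flip by simp
    qed
  qed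
  show ?thesis
  proof (cases k)
    case 0
    then show ?thesis using le[of 0] by simp
  next
    case (Suc m)
    have "?b (Suc m) = ?c m + count (B (Suc m)) v" "?c (Suc m) = ?b m + count (C (Suc m)) v"
      by (auto intro!: sum.cong)
    then show ?thesis unfolding Suc using le[of m] le[of "Suc m"] by linarith
  qed
qed

section \<open>Betti numbers\<close>

text \<open>
  A resolution with syzygies in the radical has in every degree a submultiset of the generators of any projective
  resolution, so it is minimal and any other minimal resolution has the same barcodes.
\<close>

lemma betti_eq:
  fixes M :: "('k::field, 'n::finite, 'v::ab_group_add) pmodule"
  assumes M: "persistence_module M" and res: "free_resolution M B d e"
    and minimal: "\<And>k. radical_family (syzygy B d e k)"
  shows "betti M k = B k"
proof -
  have sub: "B k \<subseteq># barcode (P' k)" if P': "projective_resolution M P' d' e'" for P' d' e' k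
  proof -
    obtain C d'' e'' where "free_resolution M C d'' e''" "\<forall>k. C k = barcode (P' k)"
      using projective_resolution_free[OF P'] by blast
    then show ?thesis
      using minimal_resolution_count_le[OF M res _ minimal, of C d'' e'' k]
      by (simp add: subseteq_mset_def)
  qed
  have min: "minimal_projective_resolution M (\<lambda>k. free_module (B k)) (\<lambda>k _. d k) e"
    unfolding minimal_projective_resolution_def free_rank_def barcode_free
    using free_resolution_projective[OF res] sub size_mset_mono by blast
  show ?thesis
    unfolding betti_def
  proof (rule the_equality)
    show "\<exists>P d e. minimal_projective_resolution M P d e \<and> B k = barcode (P k)"
      using min barcode_free by metis
    fix A assume "\<exists>P d e. minimal_projective_resolution M P d e \<and> A = barcode (P k)"
    then obtain P d' e' where P: "minimal_projective_resolution M P d' e'" "A = barcode (P k)" by blast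
    have "free_rank (P k) \<le> free_rank (free_module (B k) :: ('k, 'n) concrete_pmodule)"
      using P(1) free_resolution_projective[OF res] unfolding minimal_projective_resolution_def by blast
    then have "size A \<le> size (B k)" unfolding free_rank_def barcode_free P(2) .
    moreover have "B k \<subseteq># A" using sub P unfolding minimal_projective_resolution_def by blast
    ultimately show "A = B k" by (metis mset_subset_size nless_le not_le subset_mset.le_less)
  qed
qed

text \<open>
  The bound on the length passes from a short resolution to the minimal one
  because the latter has fewer generators in each degree.
\<close>

lemma finitely_presentable_betti:
  fixes M :: "('k::field, 'n::finite, 'v::ab_group_add) pmodule"
  assumes "finitely_presentable M"
  shows "\<exists>d e. free_resolution M (betti M) d e \<and> syzygy (betti M) d e (CARD('n)) = (\<lambda>_. {0}) \<and>
    (\<forall>k>CARD('n). betti M k = {#})"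
proof -
  have M: "persistence_module M" using assms by (simp add: finitely_presentable_def)
  obtain B d e where res: "free_resolution M B d e" and minimal: "\<forall>k. radical_family (syzygy B d e k)"
    using minimal_free_resolution_exists[OF assms] by blast
  then have B: "betti M = B" using betti_eq[OF M res] by auto
  obtain C d' e' where C: "free_resolution M C d' e'" "\<forall>k>CARD('n). C k = {#}"
    using short_free_resolution[OF assms] by blast
  have zero: "B k = {#}" if "k > CARD('n)" for k
    using minimal_resolution_count_le[OF M res C(1), of k] minimal C(2) that
    by (metis count_empty le_zero_eq multi_count_eq zero_multiset.rep_eq)
  have F0: "fil (copies {#}) fst r = ({0} :: ((real ^ 'n) \<times> nat \<Rightarrow> 'k) set)" for r
    by (auto simp: fil_def copies_def fun_eq_iff)
  have "lin (d CARD('n))" and img: "d CARD('n) ` fil (copies (B (Suc CARD('n)))) fst r = syzygy B d e CARD('n) r" for r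
    using res unfolding free_resolution_def by auto
  then have "syzygy B d e CARD('n) = (\<lambda>_. {0})"
    by (simp add: fun_eq_iff img[symmetric] zero F0 lin_0)
  then show ?thesis using res zero B by blast
qed

section \<open>Stability of Betti signed barcodes\<close>

lemma count_betti:
  assumes "\<forall>k>m. betti M k = {#}"
  shows "count (betti_even M) v = (\<Sum>k\<le>m. if even k then count (betti M k) v else 0)"
    and "count (betti_odd M) v = (\<Sum>k\<le>m. if odd k then count (betti M k) v else 0)"
proof -
  have sub: "k \<le> m" if "betti M k \<noteq> {#}" for k
  proof (rule ccontr)
    assume "\<not> k \<le> m"
    then show False using assms that by simp
  qed
  have "count (\<Sum>k\<in>{k. Q k \<and> betti M k \<noteq> {#}}. betti M k) v = (\<Sum>k\<le>m. if Q k then count (betti M k) v else 0)" for Q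
  proof -
    have "count (\<Sum>k\<in>{k. Q k \<and> betti M k \<noteq> {#}}. betti M k) v
        = (\<Sum>k\<in>{k. Q k \<and> betti M k \<noteq> {#}}. if Q k then count (betti M k) v else 0)"
      by (simp add: count_sum)
    also have "\<dots> = (\<Sum>k\<le>m. if Q k then count (betti M k) v else 0)"
      using sub by (intro sum.mono_neutral_left) auto
    finally show ?thesis .
  qed
  from this[of even] this[of odd] show "count (betti_even M) v = (\<Sum>k\<le>m. if even k then count (betti M k) v else 0)"
    "count (betti_odd M) v = (\<Sum>k\<le>m. if odd k then count (betti M k) v else 0)"
    unfolding betti_even_def betti_odd_def by simp_all
qed

text \<open>
  Undoing the shifts of two levels moves their difference by at most the difference of the shifts.
\<close>

lemma infnorm_level_grade:
  fixes u v :: "(real ^ 'n::finite) \<times> nat"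
  assumes "\<epsilon> \<ge> 0" "k \<le> m" "l \<le> m"
  shows "infnorm (fst u - fst v) \<le> infnorm (level_grade \<epsilon> fst (k, u) - level_grade \<epsilon> fst (l, v)) + real m * \<epsilon>"
proof -
  let ?w = "diag (real k * \<epsilon> - real l * \<epsilon>) :: real ^ 'n"
  have "\<bar>real k - real l\<bar> \<le> real m" using assms(2,3) by linarith
  then have "\<bar>real k * \<epsilon> - real l * \<epsilon>\<bar> \<le> real m * \<epsilon>"
    using assms(1) by (metis abs_mult abs_of_nonneg left_diff_distrib mult_right_mono)
  then have w: "infnorm ?w \<le> real m * \<epsilon>" by (intro infnorm_le_cart) simp
  have "fst u - fst v = (level_grade \<epsilon> fst (k, u) - level_grade \<epsilon> fst (l, v)) + ?w"
    by (simp add: level_grade_def vec_eq_iff)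
  then have "infnorm (fst u - fst v) \<le> infnorm (level_grade \<epsilon> fst (k, u) - level_grade \<epsilon> fst (l, v)) + infnorm ?w"
    by (metis infnorm_triangle)
  then show ?thesis using w by linarith
qed

text \<open>
  The two alternating sums of the minimal resolutions are \<open>\<epsilon>\<close>-interleaved free modules.  The matching of their
  generators costs \<open>(n - 1) \<epsilon>\<close> and undoing the shifts of the levels costs \<open>n \<epsilon>\<close>.
\<close>

lemma interleaved_imp_bijection:
  fixes M :: "('k::field, 'n::finite, 'v::ab_group_add) pmodule"
    and N :: "('k, 'n, 'w::ab_group_add) pmodule"
  assumes n: "CARD('n) \<ge> 2" and fp: "finitely_presentable M" "finitely_presentable N"
    and "\<epsilon> \<ge> 0" and int: "interleaved \<epsilon> M N"
  shows "\<exists>h. eps_bijection ((2 * real CARD('n) - 1) * \<epsilon>)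
    (betti_even M + betti_odd N) (betti_even N + betti_odd M) h"
proof -
  have MN: "persistence_module M" "persistence_module N" using fp by (simp_all add: finitely_presentable_def)
  obtain d e where M: "free_resolution M (betti M) d e" "syzygy (betti M) d e CARD('n) = (\<lambda>_. {0})"
    "\<forall>k>CARD('n). betti M k = {#}"
    using finitely_presentable_betti[OF fp(1)] by blast
  obtain d' e' where N: "free_resolution N (betti N) d' e'" "syzygy (betti N) d' e' CARD('n) = (\<lambda>_. {0})"
    "\<forall>k>CARD('n). betti N k = {#}"
    using finitely_presentable_betti[OF fp(2)] by blast
  let ?I = "\<lambda>s. alternating (\<lambda>s k. copies (if s then betti M k else betti N k)) s CARD('n)"
  let ?g = "level_grade \<epsilon> (fst :: (real ^ 'n) \<times> nat \<Rightarrow> _)"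
  have fin: "finite (?I s)" for s by (rule finite_alternating) simp
  have "\<exists>h. bij_betw h (?I True) (?I False) \<and>
      (\<forall>i\<in>?I True. infnorm (?g i - ?g (h i)) \<le> (real CARD('n) - 1) * \<epsilon>)"
    by (rule free_interleaving_bijection[OF n \<open>\<epsilon> \<ge> 0\<close> fin fin
        resolutions_interleaving[OF MN M(1) N(1) \<open>\<epsilon> \<ge> 0\<close> int, of "CARD('n)"]])
      (simp_all add: M(2) N(2) lin_0[OF lin_tag])
  then obtain h where h: "bij_betw h (?I True) (?I False)"
    "\<forall>i\<in>?I True. infnorm (?g i - ?g (h i)) \<le> (real CARD('n) - 1) * \<epsilon>"
    by blast
  have card: "card {i \<in> ?I s. fst (snd i) = v} = (\<Sum>k\<le>CARD('n). count (if s = even k then betti M k else betti N k) v)" for s v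
  proof -
    have "level_grade 0 fst i = fst (snd i)" for i :: "nat \<times> (real ^ 'n) \<times> nat"
      by (cases i) (simp add: level_grade_def vec_eq_iff)
    then show ?thesis using card_alternating[of "betti M" "betti N" s "CARD('n)" v] by (simp only:)
  qed
  have "\<exists>\<sigma>. bij_betw \<sigma> (copies (betti_even M + betti_odd N)) (?I True) \<and>
      (\<forall>x\<in>copies (betti_even M + betti_odd N). fst (snd (\<sigma> x)) = fst x)"
    by (rule bij_betw_copies[OF fin])
      (simp add: card count_betti[OF M(3)] count_betti[OF N(3)] sum.distrib[symmetric] if_distrib[of "\<lambda>B. count B _"],
       intro sum.cong, auto)
  then obtain \<sigma> where \<sigma>: "bij_betw \<sigma> (copies (betti_even M + betti_odd N)) (?I True)"
      "\<forall>x\<in>copies (betti_even M + betti_odd N). fst (snd (\<sigma> x)) = fst x" by blast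
  have "\<exists>\<tau>. bij_betw \<tau> (copies (betti_even N + betti_odd M)) (?I False) \<and>
      (\<forall>x\<in>copies (betti_even N + betti_odd M). fst (snd (\<tau> x)) = fst x)"
    by (rule bij_betw_copies[OF fin])
      (simp add: card count_betti[OF M(3)] count_betti[OF N(3)] sum.distrib[symmetric] if_distrib[of "\<lambda>B. count B _"],
       intro sum.cong, auto)
  then obtain \<tau> where \<tau>: "bij_betw \<tau> (copies (betti_even N + betti_odd M)) (?I False)"
      "\<forall>x\<in>copies (betti_even N + betti_odd M). fst (snd (\<tau> x)) = fst x" by blast
  let ?\<tau>' = "inv_into (copies (betti_even N + betti_odd M)) \<tau>"
  define H where "H = (\<lambda>x. ?\<tau>' (h (\<sigma> x)))"
  have "bij_betw H (copies (betti_even M + betti_odd N)) (copies (betti_even N + betti_odd M))"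
    using bij_betw_trans[OF bij_betw_trans[OF \<sigma>(1) h(1)] bij_betw_inv_into[OF \<tau>(1)]]
    unfolding H_def comp_def .
  moreover have "infnorm (fst x - fst (H x)) \<le> (2 * real CARD('n) - 1) * \<epsilon>"
    if x: "x \<in> copies (betti_even M + betti_odd N)" for x
  proof -
    have a: "\<sigma> x \<in> ?I True" "h (\<sigma> x) \<in> ?I False"
      using bij_betwE[OF \<sigma>(1)] bij_betwE[OF h(1)] x by blast+
    obtain k u l v where kl: "\<sigma> x = (k, u)" "h (\<sigma> x) = (l, v)" by (metis surj_pair)
    have le: "k \<le> CARD('n)" "l \<le> CARD('n)"
      using a(1)[unfolded kl(1)] a(2)[unfolded kl(2)] by (simp_all add: alternating_def)
    have "H x \<in> copies (betti_even N + betti_odd M)" "\<tau> (H x) = h (\<sigma> x)"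
      using a(2) \<tau>(1) bij_betwE[OF bij_betw_inv_into[OF \<tau>(1)]] bij_betw_inv_into_right[OF \<tau>(1) a(2)]
      unfolding H_def by auto
    then have "fst (H x) = fst (snd (h (\<sigma> x)))" using \<tau>(2) by metis
    then have "fst (H x) = fst v" unfolding kl(2) by simp
    moreover have "fst x = fst u" using bspec[OF \<sigma>(2) x] unfolding kl(1) by simp
    moreover have "infnorm (?g (k, u) - ?g (l, v)) \<le> (real CARD('n) - 1) * \<epsilon>"
      using bspec[OF h(2) a(1), unfolded kl(2), unfolded kl(1)] .
    ultimately have "infnorm (fst x - fst (H x)) \<le> (real CARD('n) - 1) * \<epsilon> + real CARD('n) * \<epsilon>"
      using infnorm_level_grade[OF \<open>\<epsilon> \<ge> 0\<close> le, of u v] by simp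
    then show ?thesis by (simp add: algebra_simps)
  qed
  ultimately show ?thesis unfolding eps_bijection_def by blast
qed

theorem theorem1p1:
  fixes M :: "('k::field, 'n::finite, 'v::ab_group_add) pmodule"
    and N :: "('k, 'n, 'w::ab_group_add) pmodule"
  assumes "CARD('n) \<ge> 2"
    and "finitely_presentable M"
    and "finitely_presentable N"
  shows "signed_bottleneck (betti_signed_barcode M) (betti_signed_barcode N)
           \<le> ennreal ((real CARD('n))\<^sup>2 - 1) * interleaving_distance M N"
proof -
  let ?c = "(real CARD('n))\<^sup>2 - 1"
  let ?d = "bottleneck_distance (betti_even M + betti_odd N) (betti_even N + betti_odd M)"
  have n: "real CARD('n) \<ge> 2" using assms(1) by simp
  have c: "?c > 0" using n by (simp add: power2_eq_square less_1_mult)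
  have "2 * real CARD('n) \<le> real CARD('n) * real CARD('n)" using n by (intro mult_right_mono) auto
  then have c': "2 * real CARD('n) - 1 \<le> ?c" by (simp add: power2_eq_square)
  \<comment> \<open>For \<open>n \<ge> 2\<close> the matching cost \<open>2 n - 1\<close> is at most \<open>n\<^sup>2 - 1\<close>.\<close>
  have le: "?d \<le> ennreal ?c * ennreal \<epsilon>" if \<epsilon>: "0 \<le> \<epsilon>" "interleaved \<epsilon> M N" for \<epsilon>
  proof -
    obtain h where "eps_bijection ((2 * real CARD('n) - 1) * \<epsilon>)
        (betti_even M + betti_odd N) (betti_even N + betti_odd M) h"
      using interleaved_imp_bijection[OF assms \<epsilon>] by blast
    then have "?d \<le> ennreal ((2 * real CARD('n) - 1) * \<epsilon>)"
      unfolding bottleneck_distance_def using n \<epsilon>(1) by (intro INF_lower) auto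
    also have "\<dots> \<le> ennreal (?c * \<epsilon>)" using c' \<epsilon>(1) by (intro ennreal_leI mult_right_mono)
    also have "\<dots> = ennreal ?c * ennreal \<epsilon>" using c \<epsilon>(1) by (simp add: ennreal_mult)
    finally show ?thesis .
  qed
  have "?d / ennreal ?c \<le> interleaving_distance M N"
    unfolding interleaving_distance_def
    using le c by (intro INF_greatest divide_le_posI_ennreal) (auto simp: mult.commute)
  then have "ennreal ?c * (?d / ennreal ?c) \<le> ennreal ?c * interleaving_distance M N"
    by (rule mult_left_mono) simp
  moreover have "ennreal ?c * (?d / ennreal ?c) = ?d"
    using c by (simp add: ennreal_times_divide ennreal_mult_divide_eq mult.commute[of "ennreal ?c"])
  ultimately show ?thesis by (simp add: betti_signed_barcode_def)
qed

end
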